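(* Let $A,B,C,D\in\Pi^+$ be arbitrary predicates. **(I)** The following predicates are 1-provable: (1) $\mathbf t$; (2) $A\lor\neg A$; (3) $A\lor{\sim}A$. **(II)** The following predicates are 2-provable: (4) $A\to A$; (5) $((A\to A)\to B)\to B$; (6) $A\lor A\to A$; (7) $A\to A\lor B$; (8) $B\to A\lor B$; (9) $A\lor B\to B\lor A$; (10) $A\to A\land A$; (11) $A\land B\to A$; (12) $A\land B\to B$; (13) $A\land B\to B\land A$; (14) $(A\lor B)\lor C\to A\lor(B\lor C)$; (15) $(A\land B)\land C\to A\land(B\land C)$; (16) $(A\lor B)\land C\to(A\land C)\lor(B\land C)$; (17) $(A\land B)\lor C\to(A\lor C)\land(B\lor C)$; (18) ${\sim}{\sim}A\to A$; (19) $A\to{\sim}{\sim}A$; (20) ${\sim}(A\lor B)\to{\sim}A\land{\sim}B$; (21) ${\sim}(A\land B)\to{\sim}A\lor{\sim}B$; (22) ${\sim}A\land{\sim}B\to{\sim}(A\lor B)$; (23) ${\sim}A\lor{\sim}B\to{\sim}(A\land B)$; (24) $\neg\neg A\to A$; (25) $A\to\neg\neg A$; (26) $\neg(A\lor B)\to\neg A\land\neg B$; (27) $\neg(A\land B)\to\neg A\lor\neg B$; (28) $\neg A\land\neg B\to\neg(A\lor B)$; (29) $\neg A\lor\neg B\to\neg(A\land B)$; (30) $A\to B\lor\neg B$; (31) $\neg A\land A\to B$. **(III)** The following predicates are 3-provable: (32) $(A\to B)\land(A\to C)\to(A\to B\land C)$; (33) $(A\to C)\land(B\to C)\to(A\lor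 B\to C)$; (34) $(A\to B)\land(C\to D)\to(A\land C\to B\land D)$; (35) $(A\to B)\land(C\to D)\to(A\lor C\to B\lor D)$; (36) $(A\to B)\lor(C\to D)\to(A\land C\to B\lor D)$; (37) $A\circ B\to{\sim}(A\to{\sim}B)$; (38) ${\sim}(A\to{\sim}B)\to A\circ B$; (39) $(A\to B)\circ A\to B$; (40) $A\to(B\to A\circ B)$; (41) $A\to((B\to{\sim}A)\to{\sim}B)$; (42) $A\circ B\land C\to A\circ(B\land{\sim}D)\lor(A\land C\circ D)\circ B$; (43) $A\circ B\land C\to(A\land{\sim}D)\circ B\lor A\circ(B\land D\circ C)$; (44) $A\circ B\land C\to(A\land C\circ B^* )\circ(B\land A^*\circ C)$; (45) $\mathbf t\circ A\to A$; (46) $A\circ\mathbf t\to A$; (47) $A\to A\circ\mathbf t^*$; (48) $\mathbf t\to\mathbf t^*$; (49) $\mathbf t^*\to\mathbf t$; (50) $\mathbf t\land{\sim}\mathbf t\to A$. **(IV)** The following rules are 1-provable: (51) $A,B\vdash A\land B$; (52) $A\to B,A\vdash B$; (53) $A\lor B,{\sim}A\vdash B$; (54) $A\vdash A^*$. **(V)** The following rules are 2-provable: (55) $A\to B,B\to C\vdash A\to C$; (56) $A\to B\vdash{\sim}B\to{\sim}A$; (57) $A\to{\sim}B\vdash B\to{\sim}A$; (58) $A\land B\to C,\ B\to C\lor A\vdash B\to C$; (59) $A\vdash(A\to B)\to B$; (60) $A\land B\to\neg C\vdash A\land C\to\neg B$; (61) $B\land\neg C\to A\land\neg A\vdash B\to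 C$; (62) $B\land C^*\to A\land\neg A\vdash B\to{\sim}C$. **(VI)** The following rules are 3-provable: (63) $A\to B\vdash(B\to C)\to(A\to C)$; (64) $A\to B\vdash(C\to A)\to(C\to B)$; (65) $A\to B,C\to D\vdash(B\to C)\to(A\to D)$; (66) $A\to B,C\to D\vdash A\circ C\to B\circ D$; (67) $A\to(B\to C)\vdash B\to({\sim}C\to{\sim}A)$. **(VII)** The following predicates are 4-provable: (68) $(A\to B)\to((C\to A)\to(C\to B))$; (69) $(A\to(B\to C))\to(A\circ B\to C)$; (70) $(A\circ B\to C)\to(A\to(B\to C))$; (71) $(A\to B)\to(A\circ C\to B\circ C)$; (72) $(A\circ B)\circ C\to A\circ(B\circ C)$; (73) $A\circ(B\circ C)\to(A\circ B)\circ C$. **(VIII)** The following are 3-provable from density: (74) $(A\to{\sim}A)\to{\sim}A$; (75) $A\land B\to A\circ B$; (76) $(A\to B)\to{\sim}A\lor B$. **(IX)** The following are 4-provable from density: (77) $(A\to(A\to B))\to(A\to B)$; (78) $(A\to(B\to C))\to(A\land B\to C)$. **(X)** The following are 3-provable from commutativity: (79) $A\to((A\to B)\to B)$; (80) $(A\to{\sim}B)\to(B\to{\sim}A)$. **(XI)** The following are 4-provable from commutativity: (81) $(A\to(B\to C))\to(B\to(A\to C))$; (82) $(A\to B)\to((B\to C)\to(A\to C))$. **(XII)** The following is 4-provable from density and commutativity: (83) $(A\to(B\to C))\to((A\to B)\to(A\to C))$. **(XIII)** The following is 2-provable from symmetry: (84) $A\land{\sim}A\to B$. **(XIV)** The following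 is 3-provable from symmetry: (85) $A\circ B\to B\circ A$. **(XV)** $\mathsf{CT}_3$ contains the predicates (1)–(50); $\mathsf{CT}_4$ contains the predicates (1)–(50) and (68)–(73); $\mathsf{TR}$ contains the predicates (1)–(50), (68)–(73) and (79)–(83); and each of $\mathsf{CT}_3$, $\mathsf{CT}_4$, $\mathsf{TR}$ has all the rules (51)–(67) (it is closed under them).
   Context: **Predicates.** $\Pi$ is a countably infinite set of binary relation symbols containing the equality symbol $1'$; members of $\Pi$ other than $1'$ are propositional variables. $\Pi^+$ (predicates) is the absolutely free closure of $\Pi$ under the formal operators $A+B$, $\overline A$, $A;B$, $A^\smile$. Abbreviations: $A\lor B=A+B$, $A\land B=A\cdot B=\overline{\overline A+\overline B}$, $\neg A=\overline A$, ${\sim}A=\overline{A^\smile}$, $A\to B=\overline{A^\smile;\overline B}$, $A\circ B=B;A$, $A^*=A^\smile$, $\mathbf t=1'$. Unary operators bind tightest, then $;$, $\circ$, $\land$, $+$, $\lor$, $\to$ in that order. An equation is a formal expression $A\doteq B$; $A\le B$ denotes $A+B\doteq B$. $\Xi^d=\{A\le A;A:A\in\Pi^+\}$ (density), $\Xi^c=\{A;B\doteq B;A:A,B\in\Pi^+\}$ (commutativity), $\Xi^s=\{A\doteq A^\smile:A\in\Pi^+\}$ (symmetry). **Sequent calculus** ($1\le n<\omega$). Let $\Upsilon_n=\{v_i:i<n\}$. An $n$-sequent $\Gamma\,|\,\Delta$ is a pair of subsets of $\{xAy:x,y\in\Upsilon_n,A\in\Pi^+\}$. It is an axiom if $\Gamma\cap\Delta\ne\emptyset$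 or $x1'x\in\Delta$ for some $x$. Rules (premises $\leadsto$ conclusion): Cut: $\Gamma|\Delta,xAy$ and $xAy,\Gamma'|\Delta'\leadsto\Gamma,\Gamma'|\Delta,\Delta'$. Equality: $xAy,\Gamma|\Delta\leadsto xAz,z1'y,\Gamma|\Delta$. Sum: $xAy,\Gamma|\Delta$ and $xBy,\Gamma'|\Delta'\leadsto x(A+B)y,\Gamma,\Gamma'|\Delta,\Delta'$; $\Gamma|\Delta,xAy,xBy\leadsto\Gamma|\Delta,x(A+B)y$. Complement: $\Gamma|\Delta,xAy\leadsto x\overline Ay,\Gamma|\Delta$; $xAy,\Gamma|\Delta\leadsto\Gamma|\Delta,x\overline Ay$. Relative product: $xAy,yBz,\Gamma|\Delta\leadsto x(A;B)z,\Gamma|\Delta$ provided $y\ne x,z$ and $y$ occurs in no formula of $\Gamma\cup\Delta$; $\Gamma|\Delta,xAy$ and $\Gamma'|\Delta',yBz\leadsto\Gamma,\Gamma'|\Delta,\Delta',x(A;B)z$. Converse: $xAy,\Gamma|\Delta\leadsto yA^\smile x,\Gamma|\Delta$; $\Gamma|\Delta,xAy\leadsto\Gamma|\Delta,yA^\smile x$. (The evident rules for $\cdot$ are derivable.) A sequent is $n$-provable from a set $\Theta$ of $n$-sequents if it lies in every set of $n$-sequents containing $\Theta$ and the axioms and closed under the rules. The $n$-sequents corresponding to a set $\Psi$ of equations are all $v_iAv_j,\Gamma|v_iBv_j,\Delta$ and $v_iBv_j,\Gamma|v_iAv_j,\Delta$ with $i,j<n$ and $A\doteq B$ in $\Psi$.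 A predicate $A$ is $n$-provable if the sequent $\;|\;v_0Av_0$ is $n$-provable (from $\emptyset$); it is $n$-provable from density, commutativity or symmetry if $\;|\;v_0Av_0$ is $n$-provable from the $n$-sequents corresponding to $\Xi^d$, $\Xi^c$ or $\Xi^s$ respectively (from the union, when several are named). A rule $A\vdash B$ is $n$-provable if every proof of $\;|\;v_0Av_0$ can be extended, by $n$-sequents obtained via the axioms and rules of the $n$-variable calculus, to a proof of $\;|\;v_0Bv_0$; similarly a rule $A,B\vdash C$ is $n$-provable if every proof containing $\;|\;v_0Av_0$ and $\;|\;v_0Bv_0$ can be so extended to a proof of $\;|\;v_0Cv_0$. **Logics.** $\mathsf{CT}_3=\{A\in\Pi^+:\ \vdash_s^+1'\le A\}$, $\mathsf{CT}_4=\{A\in\Pi^+:\ \vdash_4^+1'\le A\}$, $\mathsf{TR}=\{A\in\Pi^+:\Xi^d\cup\Xi^c\vdash_4^+1'\le A\}$, where $\vdash_s^+$ (for $n=3$) and $\vdash_4^+$ (for $n=4$) are the following. $\Phi_n^+$ is the set of formulas built from $xAy$ ($x,y\in\Upsilon_n$, $A\in\Pi^+$) and equations (no free variables) by $\Rightarrow,\neg,\forall x$ with $x\in\Upsilon_n$ ($\lor,\land,\Leftrightarrow,\exists$ the usual abbreviations). $[\varphi]$ is the universal closure; $S_{xy}\varphi$ interchanges $x$ and $y$ everywhere in $\varphi$ (including in quantifiers). Axioms, for $\varphi,\psi,\xi\in\Phi_n^+$, $x,y\in\Upsilon_n$, $A,B\in\Pi^+$: $[(\varphi\Rightarrow\psi)\Rightarrow((\psi\Rightarrow\xi)\Rightarrow(\varphi\Rightarrow\xi))]$;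 $[(\neg\varphi\Rightarrow\varphi)\Rightarrow\varphi]$; $[\varphi\Rightarrow(\neg\varphi\Rightarrow\psi)]$; $[\forall x\forall y\varphi\Rightarrow\forall y\forall x\varphi]$; $[\forall x(\varphi\Rightarrow\psi)\Rightarrow(\forall x\varphi\Rightarrow\forall x\psi)]$; $[\forall x\varphi\Rightarrow\varphi]$; $[\varphi\Rightarrow\forall x\varphi]$ if $x$ is not free in $\varphi$; $[\exists x(x1'y)]$ if $x\ne y$; $[x1'y\Rightarrow(\varphi\Rightarrow S_{xy}\varphi)]$; $[v_0(A+B)v_1\Leftrightarrow v_0Av_1\lor v_0Bv_1]$; $[v_0\overline Av_1\Leftrightarrow\neg v_0Av_1]$; $[v_0(A;B)v_1\Leftrightarrow\exists v_2(v_0Av_2\land v_2Bv_1)]$; $[v_0A^\smile v_1\Leftrightarrow v_1Av_0]$; $A\doteq B\Leftrightarrow[v_0Av_1\Leftrightarrow v_0Bv_1]$. Provability from $\Psi$ means membership in every set containing $\Psi$ and the axioms and closed under modus ponens. *)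

theory Defs
  imports Main "HOL-Combinatorics.Transposition"
begin

text \<open>The relation symbols are \<open>Ident\<close> (the equality symbol) together with the countably many
  propositional variables \<open>PVar i\<close>.\<close>

datatype pred =
    Ident
  | PVar nat
  | Sum pred pred  (infixl "\<^bold>+" 65)
  | Compl pred
  | RProd pred pred  (infixl "\<^bold>;" 75)
  | Conv pred  ("_\<^sup>\<smile>" [1000] 999)

abbreviation pT :: pred  ("\<^bold>t")
  where "\<^bold>t \<equiv> Ident"

abbreviation pNot :: "pred \<Rightarrow> pred"  ("\<^bold>\<not> _" [90] 90)
  where "\<^bold>\<not> A \<equiv> Compl A"

abbreviation pStar :: "pred \<Rightarrow> pred"  ("_\<^sup>\<star>" [1000] 999)
  where "A\<^sup>\<star> \<equiv> A\<^sup>\<smile>"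

abbreviation pNeg :: "pred \<Rightarrow> pred"  ("\<^bold>\<sim> _" [90] 90)
  where "\<^bold>\<sim> A \<equiv> Compl (A\<^sup>\<smile>)"

text \<open>Fusion is relative product with the factors exchanged.\<close>

abbreviation pFusion :: "pred \<Rightarrow> pred \<Rightarrow> pred"  (infixl "\<^bold>\<circ>" 72)
  where "A \<^bold>\<circ> B \<equiv> B \<^bold>; A"

abbreviation pAnd :: "pred \<Rightarrow> pred \<Rightarrow> pred"  (infixl "\<^bold>\<and>" 70)
  where "A \<^bold>\<and> B \<equiv> Compl (Compl A \<^bold>+ Compl B)"

abbreviation pOr :: "pred \<Rightarrow> pred \<Rightarrow> pred"  (infixl "\<^bold>\<or>" 62)
  where "A \<^bold>\<or> B \<equiv> A \<^bold>+ B"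

abbreviation pImp :: "pred \<Rightarrow> pred \<Rightarrow> pred"  (infixr "\<^bold>\<rightarrow>" 60)
  where "A \<^bold>\<rightarrow> B \<equiv> Compl (A\<^sup>\<smile> \<^bold>; Compl B)"

datatype eqn = Eqn pred pred  (infix "\<doteq>" 55)

abbreviation Leq :: "pred \<Rightarrow> pred \<Rightarrow> eqn"  (infix "\<lesssim>" 55)
  where "A \<lesssim> B \<equiv> A \<^bold>+ B \<doteq> B"

definition density :: "eqn set"
  where "density = {A \<lesssim> A \<^bold>; A | A. True}"

definition commutativity :: "eqn set"
  where "commutativity = {A \<^bold>; B \<doteq> B \<^bold>; A | A B. True}"

definition symmetry :: "eqn set"
  where "symmetry = {A \<doteq> A\<^sup>\<smile> | A. True}"

text \<open>The variable \<open>v\<^sub>i\<close> is the number \<open>i\<close>, the formula \<open>xAy\<close> is the triple \<open>(x, A, y)\<close>, and the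
  sequent with left side \<open>\<Gamma>\<close> and right side \<open>\<Delta>\<close> is the pair \<open>(\<Gamma>, \<Delta>)\<close>. Either side may be
  infinite.\<close>

type_synonym var = nat
type_synonym atom = "var \<times> pred \<times> var"
type_synonym sequent = "atom set \<times> atom set"

definition atoms :: "nat \<Rightarrow> atom set"
  where "atoms n = {(x, A, y) | x A y. x < n \<and> y < n}"

definition sequents :: "nat \<Rightarrow> sequent set"
  where "sequents n = Pow (atoms n) \<times> Pow (atoms n)"

definition seq_axioms :: "nat \<Rightarrow> sequent set"
  where "seq_axioms n =
    {(\<Gamma>, \<Delta>) \<in> sequents n. \<Gamma> \<inter> \<Delta> \<noteq> {} \<or> (\<exists>x. (x, Ident, x) \<in> \<Delta>)}"

text \<open>\<open>seq_rule P s\<close>: the sequent \<open>s\<close> is the conclusion of an instance of a rule whose set of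
  premises is \<open>P\<close>. The restriction to \<open>n\<close> variables is imposed where the rules are used.\<close>

inductive seq_rule :: "sequent set \<Rightarrow> sequent \<Rightarrow> bool" where
  Cut: "seq_rule {(\<Gamma>, insert (x, A, y) \<Delta>), (insert (x, A, y) \<Gamma>', \<Delta>')} (\<Gamma> \<union> \<Gamma>', \<Delta> \<union> \<Delta>')"
| Equality: "seq_rule {(insert (x, A, y) \<Gamma>, \<Delta>)}
    (insert (x, A, z) (insert (z, Ident, y) \<Gamma>), \<Delta>)"
| SumL: "seq_rule {(insert (x, A, y) \<Gamma>, \<Delta>), (insert (x, B, y) \<Gamma>', \<Delta>')}
    (insert (x, A \<^bold>+ B, y) (\<Gamma> \<union> \<Gamma>'), \<Delta> \<union> \<Delta>')"
| SumR: "seq_rule {(\<Gamma>, insert (x, A, y) (insert (x, B, y) \<Delta>))} (\<Gamma>, insert (x, A \<^bold>+ B, y) \<Delta>)"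
| ComplL: "seq_rule {(\<Gamma>, insert (x, A, y) \<Delta>)} (insert (x, Compl A, y) \<Gamma>, \<Delta>)"
| ComplR: "seq_rule {(insert (x, A, y) \<Gamma>, \<Delta>)} (\<Gamma>, insert (x, Compl A, y) \<Delta>)"
| RProdL: "y \<noteq> x \<Longrightarrow> y \<noteq> z \<Longrightarrow> (\<forall>(u, C, w) \<in> \<Gamma> \<union> \<Delta>. u \<noteq> y \<and> w \<noteq> y) \<Longrightarrow>
    seq_rule {(insert (x, A, y) (insert (y, B, z) \<Gamma>), \<Delta>)} (insert (x, A \<^bold>; B, z) \<Gamma>, \<Delta>)"
| RProdR: "seq_rule {(\<Gamma>, insert (x, A, y) \<Delta>), (\<Gamma>', insert (y, B, z) \<Delta>')}
    (\<Gamma> \<union> \<Gamma>', insert (x, A \<^bold>; B, z) (\<Delta> \<union> \<Delta>'))"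
| ConvL: "seq_rule {(insert (x, A, y) \<Gamma>, \<Delta>)} (insert (y, A\<^sup>\<smile>, x) \<Gamma>, \<Delta>)"
| ConvR: "seq_rule {(\<Gamma>, insert (x, A, y) \<Delta>)} (\<Gamma>, insert (y, A\<^sup>\<smile>, x) \<Delta>)"

text \<open>The sequents that are \<open>n\<close>-provable from \<open>\<Theta>\<close>, for \<open>\<Theta>\<close> a set of \<open>n\<close>-sequents.\<close>

inductive_set seq_provable :: "nat \<Rightarrow> sequent set \<Rightarrow> sequent set" for n \<Theta> where
  hyp: "s \<in> \<Theta> \<Longrightarrow> s \<in> seq_provable n \<Theta>"
| ax: "s \<in> seq_axioms n \<Longrightarrow> s \<in> seq_provable n \<Theta>"
| rule: "seq_rule P s \<Longrightarrow> (\<And>p. p \<in> P \<Longrightarrow> p \<in> seq_provable n \<Theta>) \<Longrightarrow> s \<in> sequents n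
    \<Longrightarrow> s \<in> seq_provable n \<Theta>"

definition eqn_sequents :: "nat \<Rightarrow> eqn set \<Rightarrow> sequent set"
  where "eqn_sequents n \<Psi> =
    {(insert (i, A, j) \<Gamma>, insert (i, B, j) \<Delta>) | i j A B \<Gamma> \<Delta>.
       i < n \<and> j < n \<and> (A \<doteq> B \<in> \<Psi> \<or> B \<doteq> A \<in> \<Psi>) \<and> (\<Gamma>, \<Delta>) \<in> sequents n}"

definition pred_sequent :: "pred \<Rightarrow> sequent"
  where "pred_sequent A = ({}, {(0, A, 0)})"

definition provable_from :: "nat \<Rightarrow> eqn set \<Rightarrow> pred \<Rightarrow> bool"
  where "provable_from n \<Psi> A \<longleftrightarrow> pred_sequent A \<in> seq_provable n (eqn_sequents n \<Psi>)"

abbreviation provable :: "nat \<Rightarrow> pred \<Rightarrow> bool"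
  where "provable n A \<equiv> provable_from n {} A"

text \<open>\<open>obtained n S s\<close>: \<open>s\<close> is an axiom of the \<open>n\<close>-variable calculus or the conclusion of one of its
  rules applied to \<open>n\<close>-sequents in \<open>S\<close>.\<close>

definition obtained :: "nat \<Rightarrow> sequent set \<Rightarrow> sequent \<Rightarrow> bool"
  where "obtained n S s \<longleftrightarrow>
    s \<in> sequents n \<and> (s \<in> seq_axioms n \<or> (\<exists>P \<subseteq> S \<inter> sequents n. seq_rule P s))"

definition is_proof :: "nat \<Rightarrow> sequent set \<Rightarrow> sequent list \<Rightarrow> bool"
  where "is_proof n \<Theta> p \<longleftrightarrow>
    (\<forall>k < length p. p ! k \<in> \<Theta> \<or> obtained n (set (take k p)) (p ! k))"

text \<open>The proof \<open>p\<close> to be extended may use any number \<open>m\<close> of variables and any set \<open>\<Theta>\<close> of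
  hypotheses, so provability of a rule is derivability of its conclusion, not merely
  admissibility over the proofs from no hypotheses. Only the extension \<open>q\<close> is confined to the
  pure \<open>n\<close>-variable calculus.\<close>

definition rule_provable :: "nat \<Rightarrow> pred set \<Rightarrow> pred \<Rightarrow> bool"
  where "rule_provable n As B \<longleftrightarrow>
    (\<forall>m \<Theta> p. \<Theta> \<subseteq> sequents m \<and> is_proof m \<Theta> p \<and> pred_sequent ` As \<subseteq> set p \<longrightarrow>
      (\<exists>q. (\<forall>k < length q. obtained n (set (p @ take k q)) (q ! k)) \<and>
           pred_sequent B \<in> set (p @ q)))"

datatype form =
    Rel var pred var
  | Equation eqn
  | Imp form form  (infixr "\<^bold>\<Rightarrow>" 25)
  | Neg form
  | All var form

abbreviation Or :: "form \<Rightarrow> form \<Rightarrow> form"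
  where "Or \<phi> \<psi> \<equiv> (Neg \<phi> \<^bold>\<Rightarrow> \<psi>)"

abbreviation And :: "form \<Rightarrow> form \<Rightarrow> form"
  where "And \<phi> \<psi> \<equiv> Neg (\<phi> \<^bold>\<Rightarrow> Neg \<psi>)"

abbreviation Iff :: "form \<Rightarrow> form \<Rightarrow> form"  (infix "\<^bold>\<Leftrightarrow>" 25)
  where "\<phi> \<^bold>\<Leftrightarrow> \<psi> \<equiv> And (\<phi> \<^bold>\<Rightarrow> \<psi>) (\<psi> \<^bold>\<Rightarrow> \<phi>)"

abbreviation Ex :: "var \<Rightarrow> form \<Rightarrow> form"
  where "Ex x \<phi> \<equiv> Neg (All x (Neg \<phi>))"

primrec vars :: "form \<Rightarrow> var set" where
  "vars (Rel x A y) = {x, y}"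
| "vars (Equation e) = {}"
| "vars (\<phi> \<^bold>\<Rightarrow> \<psi>) = vars \<phi> \<union> vars \<psi>"
| "vars (Neg \<phi>) = vars \<phi>"
| "vars (All x \<phi>) = insert x (vars \<phi>)"

primrec free :: "form \<Rightarrow> var set" where
  "free (Rel x A y) = {x, y}"
| "free (Equation e) = {}"
| "free (\<phi> \<^bold>\<Rightarrow> \<psi>) = free \<phi> \<union> free \<psi>"
| "free (Neg \<phi>) = free \<phi>"
| "free (All x \<phi>) = free \<phi> - {x}"

definition forms :: "nat \<Rightarrow> form set"
  where "forms n = {\<phi>. vars \<phi> \<subseteq> {..<n}}"

primrec interchange :: "var \<Rightarrow> var \<Rightarrow> form \<Rightarrow> form" where
  "interchange x y (Rel u A w) = Rel (transpose x y u) A (transpose x y w)"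
| "interchange x y (Equation e) = Equation e"
| "interchange x y (\<phi> \<^bold>\<Rightarrow> \<psi>) = (interchange x y \<phi> \<^bold>\<Rightarrow> interchange x y \<psi>)"
| "interchange x y (Neg \<phi>) = Neg (interchange x y \<phi>)"
| "interchange x y (All u \<phi>) = All (transpose x y u) (interchange x y \<phi>)"

text \<open>In the universal closure the variable with the smallest index is quantified outermost.\<close>

definition closure :: "form \<Rightarrow> form"
  where "closure \<phi> = foldr All (sorted_list_of_set (free \<phi>)) \<phi>"

inductive_set form_axioms :: "nat \<Rightarrow> form set" for n where
  "\<lbrakk>\<phi> \<in> forms n; \<psi> \<in> forms n; \<xi> \<in> forms n\<rbrakk> \<Longrightarrow>
    closure ((\<phi> \<^bold>\<Rightarrow> \<psi>) \<^bold>\<Rightarrow> ((\<psi> \<^bold>\<Rightarrow> \<xi>) \<^bold>\<Rightarrow> (\<phi> \<^bold>\<Rightarrow> \<xi>))) \<in> form_axioms n"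
| "\<phi> \<in> forms n \<Longrightarrow> closure ((Neg \<phi> \<^bold>\<Rightarrow> \<phi>) \<^bold>\<Rightarrow> \<phi>) \<in> form_axioms n"
| "\<lbrakk>\<phi> \<in> forms n; \<psi> \<in> forms n\<rbrakk> \<Longrightarrow> closure (\<phi> \<^bold>\<Rightarrow> (Neg \<phi> \<^bold>\<Rightarrow> \<psi>)) \<in> form_axioms n"
| "\<lbrakk>\<phi> \<in> forms n; x < n; y < n\<rbrakk> \<Longrightarrow>
    closure (All x (All y \<phi>) \<^bold>\<Rightarrow> All y (All x \<phi>)) \<in> form_axioms n"
| "\<lbrakk>\<phi> \<in> forms n; \<psi> \<in> forms n; x < n\<rbrakk> \<Longrightarrow>
    closure (All x (\<phi> \<^bold>\<Rightarrow> \<psi>) \<^bold>\<Rightarrow> (All x \<phi> \<^bold>\<Rightarrow> All x \<psi>)) \<in> form_axioms n"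
| "\<lbrakk>\<phi> \<in> forms n; x < n\<rbrakk> \<Longrightarrow> closure (All x \<phi> \<^bold>\<Rightarrow> \<phi>) \<in> form_axioms n"
| "\<lbrakk>\<phi> \<in> forms n; x < n; x \<notin> free \<phi>\<rbrakk> \<Longrightarrow> closure (\<phi> \<^bold>\<Rightarrow> All x \<phi>) \<in> form_axioms n"
| "\<lbrakk>x < n; y < n; x \<noteq> y\<rbrakk> \<Longrightarrow> closure (Ex x (Rel x Ident y)) \<in> form_axioms n"
| "\<lbrakk>\<phi> \<in> forms n; x < n; y < n\<rbrakk> \<Longrightarrow>
    closure (Rel x Ident y \<^bold>\<Rightarrow> (\<phi> \<^bold>\<Rightarrow> interchange x y \<phi>)) \<in> form_axioms n"
| "closure (Rel 0 (A \<^bold>+ B) 1 \<^bold>\<Leftrightarrow> Or (Rel 0 A 1) (Rel 0 B 1)) \<in> form_axioms n"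
| "closure (Rel 0 (Compl A) 1 \<^bold>\<Leftrightarrow> Neg (Rel 0 A 1)) \<in> form_axioms n"
| "closure (Rel 0 (A \<^bold>; B) 1 \<^bold>\<Leftrightarrow> Ex 2 (And (Rel 0 A 2) (Rel 2 B 1))) \<in> form_axioms n"
| "closure (Rel 0 (A\<^sup>\<smile>) 1 \<^bold>\<Leftrightarrow> Rel 1 A 0) \<in> form_axioms n"
| "(Equation (A \<doteq> B) \<^bold>\<Leftrightarrow> closure (Rel 0 A 1 \<^bold>\<Leftrightarrow> Rel 0 B 1)) \<in> form_axioms n"

text \<open>The calculus is only used for \<open>n \<ge> 3\<close>; the axioms above that mention the variables 0, 1 and 2
  are then formulas in \<open>n\<close> variables.\<close>

inductive_set form_provable :: "nat \<Rightarrow> eqn set \<Rightarrow> form set" for n \<Psi> where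
  hyp: "e \<in> \<Psi> \<Longrightarrow> Equation e \<in> form_provable n \<Psi>"
| ax: "\<phi> \<in> form_axioms n \<Longrightarrow> \<phi> \<in> form_provable n \<Psi>"
| mp: "\<lbrakk>\<phi> \<in> form_provable n \<Psi>; (\<phi> \<^bold>\<Rightarrow> \<psi>) \<in> form_provable n \<Psi>\<rbrakk> \<Longrightarrow> \<psi> \<in> form_provable n \<Psi>"

definition CT3 :: "pred set"
  where "CT3 = {A. Equation (Ident \<lesssim> A) \<in> form_provable 3 {}}"

definition CT4 :: "pred set"
  where "CT4 = {A. Equation (Ident \<lesssim> A) \<in> form_provable 4 {}}"

definition TR :: "pred set"
  where "TR = {A. Equation (Ident \<lesssim> A) \<in> form_provable 4 (density \<union> commutativity)}"

end

theory Submission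
  imports Defs
begin

text \<open>Both calculi are handled semantically. A frame is a family of sets of atoms over \<open>n\<close> variables
  that decide the boolean operators and converse atomwise, respect identity, and are closed under relative
  product; whenever \<open>xA;Bz\<close> holds in a member and \<open>y\<close> differs from \<open>x\<close> and \<open>z\<close>, some member that
  agrees with it away from \<open>y\<close> has \<open>xAy\<close> and \<open>yBz\<close>. The maximal consistent sets of atoms of the sequent
  calculus form a frame, and so do the atoms true in the maximal consistent theories of the
  \<open>n\<close>-variable predicate calculus. Provability in either calculus therefore follows from validity in all
  frames, where \<open>A \<rightarrow> B\<close> is valid exactly if \<open>A\<close> lies below \<open>B\<close>, relative product is residuated by
  \<open>\<rightarrow>\<close> from three variables on, and it is associative from four variables on.\<close>

section \<open>Frames\<close>

text \<open>A member of a frame may be read as a matrix: its entry at (x, y) is the set of all A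
  with xAy in it, and \<open>prod_witness\<close> re-chooses only the row and the column of y. This
  is the shape of Maddux's relational bases. Naming a new point costs a variable whose old meaning
  is lost, so the variable counts in the theorem are the numbers of points that have to be named
  simultaneously. Three obstacles shape the proof. The rules of the sequent calculus do not include
  weakening, and its sequents may be infinite; hence weakening is derived and consistency looks at
  finite sets only. The predicate calculus says nothing about xAx directly, so this atom is read off
  a formula with a bound variable, and a further variable serves as a second name of x. Finally, a
  predicate is tested at v_0 alone, as in the sequent |v_0 A v_0, and its truth has to be spread to
  the other variables inside the frame.\<close>

definition agree :: "var \<Rightarrow> atom set \<Rightarrow> atom set \<Rightarrow> bool"
  where "agree y M M' \<longleftrightarrow> (\<forall>u C w. u \<noteq> y \<longrightarrow> w \<noteq> y \<longrightarrow> (u, C, w) \<in> M' \<longleftrightarrow> (u, C, w) \<in> M)"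

locale frame =
  fixes n :: nat and F :: "atom set set"
  assumes sum_iff: "\<lbrakk>M \<in> F; x < n; y < n\<rbrakk> \<Longrightarrow> (x, A \<^bold>+ B, y) \<in> M \<longleftrightarrow> (x, A, y) \<in> M \<or> (x, B, y) \<in> M"
    and compl_iff: "\<lbrakk>M \<in> F; x < n; y < n\<rbrakk> \<Longrightarrow> (x, Compl A, y) \<in> M \<longleftrightarrow> (x, A, y) \<notin> M"
    and conv_iff: "\<lbrakk>M \<in> F; x < n; y < n\<rbrakk> \<Longrightarrow> (x, A\<^sup>\<smile>, y) \<in> M \<longleftrightarrow> (y, A, x) \<in> M"
    and ident_refl: "\<lbrakk>M \<in> F; x < n\<rbrakk> \<Longrightarrow> (x, Ident, x) \<in> M"
    and ident_subst: "\<lbrakk>M \<in> F; x < n; y < n; z < n; (x, A, z) \<in> M; (z, Ident, y) \<in> M\<rbrakk>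
      \<Longrightarrow> (x, A, y) \<in> M"
    and prodI: "\<lbrakk>M \<in> F; x < n; y < n; z < n; (x, A, y) \<in> M; (y, B, z) \<in> M\<rbrakk>
      \<Longrightarrow> (x, A \<^bold>; B, z) \<in> M"
    and prod_witness: "\<lbrakk>M \<in> F; x < n; y < n; z < n; (x, A \<^bold>; B, z) \<in> M; y \<noteq> x; y \<noteq> z\<rbrakk>
      \<Longrightarrow> \<exists>M' \<in> F. agree y M M' \<and> (x, A, y) \<in> M' \<and> (y, B, z) \<in> M'"
begin

lemmas atom_iff = sum_iff compl_iff conv_iff

lemma prodE:
  assumes "(x, A \<^bold>; B, z) \<in> M" "M \<in> F" "x < n" "y < n" "z < n" "y \<noteq> x" "y \<noteq> z"
  obtains M' where "M' \<in> F" "(x, A, y) \<in> M'" "(y, B, z) \<in> M'"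
    "\<And>u C w. u \<noteq> y \<Longrightarrow> w \<noteq> y \<Longrightarrow> (u, C, w) \<in> M' \<longleftrightarrow> (u, C, w) \<in> M"
  using prod_witness[of M x y z A B] assms unfolding agree_def by metis

text \<open>Unfolded, x(A \<rightarrow> B)z says that no y has yAx and not yBz. Since
  \<open>prodI\<close> has no distinctness conditions, y may coincide with x or z; with a single
  variable this is modus ponens.\<close>

lemma imp_elim:
  assumes "(x, A \<^bold>\<rightarrow> B, z) \<in> M" "(y, A, x) \<in> M" "M \<in> F" "x < n" "y < n" "z < n"
  shows "(y, B, z) \<in> M"
  using assms prodI[of M x y z "A\<^sup>\<smile>" "Compl B"] by (auto simp: atom_iff)

text \<open>Only a variable other than x and z can be re-chosen as the middle point of the product
  under the complement. Whatever does not mention y remains available in \<open>M'\<close>.\<close>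

lemma imp_intro:
  assumes "M \<in> F" "x < n" "y < n" "z < n" "y \<noteq> x" "y \<noteq> z"
    and "\<And>M'. M' \<in> F \<Longrightarrow> \<forall>u C w. u \<noteq> y \<longrightarrow> w \<noteq> y \<longrightarrow> ((u, C, w) \<in> M' \<longleftrightarrow> (u, C, w) \<in> M)
      \<Longrightarrow> (y, A, x) \<in> M' \<Longrightarrow> (y, B, z) \<in> M'"
  shows "(x, A \<^bold>\<rightarrow> B, z) \<in> M"
proof (rule ccontr)
  assume "(x, A \<^bold>\<rightarrow> B, z) \<notin> M"
  then have "(x, A\<^sup>\<smile> \<^bold>; Compl B, z) \<in> M"
    using assms by (simp add: atom_iff)
  then obtain M' where "M' \<in> F" "(x, A\<^sup>\<smile>, y) \<in> M'" "(y, Compl B, z) \<in> M'"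
    "\<And>u C w. u \<noteq> y \<Longrightarrow> w \<noteq> y \<Longrightarrow> (u, C, w) \<in> M' \<longleftrightarrow> (u, C, w) \<in> M"
    using prodE[of x "A\<^sup>\<smile>" "Compl B" z M y] assms by blast
  then show False
    using assms(7)[of M'] assms by (simp add: atom_iff)
qed

lemma ident_sym:
  assumes "(x, Ident, y) \<in> M" "M \<in> F" "x < n" "y < n"
  shows "(y, Ident, x) \<in> M"
  \<comment> \<open>Replacing the second x in \<open>(x, Ident\<^sup>\<smile>, x)\<close> by y gives
    \<open>(x, Ident\<^sup>\<smile>, y)\<close>.\<close>
  using assms ident_subst[of M x y x "Ident\<^sup>\<smile>"] by (simp add: conv_iff ident_refl)

lemma ident_subst_left:
  assumes "(z, Ident, x) \<in> M" "(x, A, y) \<in> M" "M \<in> F" "x < n" "y < n" "z < n"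
  shows "(z, A, y) \<in> M"
  using assms ident_subst[of M y z x "A\<^sup>\<smile>"] ident_sym by (simp add: conv_iff)

text \<open>Only v_0 is inspected, to match \<open>pred_sequent\<close>.\<close>

definition valid :: "pred \<Rightarrow> bool"
  where "valid P \<longleftrightarrow> (\<forall>M \<in> F. (0, P, 0) \<in> M)"

definition below :: "pred \<Rightarrow> pred \<Rightarrow> bool"  (infix "\<sqsubseteq>" 50)
  where "A \<sqsubseteq> B \<longleftrightarrow> (\<forall>M \<in> F. \<forall>x < n. \<forall>y < n. (x, A, y) \<in> M \<longrightarrow> (x, B, y) \<in> M)"

lemma belowD: "\<lbrakk>A \<sqsubseteq> B; (x, A, y) \<in> M; M \<in> F; x < n; y < n\<rbrakk> \<Longrightarrow> (x, B, y) \<in> M"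
  by (simp add: below_def)

text \<open>A frame in which \<open>x\<not>Ax\<close> held at some \<open>x \<noteq> 0\<close> would also satisfy
  \<open>x((\<one> + \<not>\<one>);(\<one> \<and> \<not>A))x\<close>, and naming the middle point \<open>0\<close> refutes \<open>0A0\<close>.\<close>

lemma valid_diag:
  assumes "valid P" and M: "M \<in> F" and x: "x < n"
  shows "(x, P, x) \<in> M"
proof (rule ccontr)
  let ?Q = "Compl P \<^bold>\<and> Ident" and ?T = "Ident \<^bold>+ Compl Ident"
  assume P: "(x, P, x) \<notin> M"
  have valid: "(0, P, 0) \<in> M'" if "M' \<in> F" for M'
    using assms that by (simp add: valid_def)
  then have "x \<noteq> 0"
    using P M by metis
  then have n: "0 < n"
    using x by simp
  have "(x, ?T, x) \<in> M" "(x, ?Q, x) \<in> M"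
    using P M x by (simp_all add: atom_iff ident_refl)
  with M x have "(x, ?T \<^bold>; ?Q, x) \<in> M"
    by (blast intro: prodI)
  from this M x n x obtain M' where M': "M' \<in> F" "(0, ?Q, x) \<in> M'"
    by (rule prodE) (use \<open>x \<noteq> 0\<close> in simp_all)
  then have "(0, Compl P, x) \<in> M'" "(x, Ident, 0) \<in> M'"
    using x n ident_sym by (simp_all add: atom_iff)
  then have "(0, Compl P, 0) \<in> M'"
    using ident_subst M'(1) x n by blast
  then show False
    using valid M'(1) n by (simp add: compl_iff)
qed

text \<open>An atom yAx is carried to yBx by x(A \<rightarrow> B)x, the implication on the diagonal
  at the right end. One direction therefore needs \<open>valid_diag\<close>; for the other, v_1
  names an arbitrary y against v_0, which takes two variables.\<close>

lemma valid_imp_iff: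
  assumes "2 \<le> n"
  shows "valid (A \<^bold>\<rightarrow> B) \<longleftrightarrow> A \<sqsubseteq> B"
proof
  assume "valid (A \<^bold>\<rightarrow> B)"
  then show "A \<sqsubseteq> B"
    unfolding below_def by (metis imp_elim valid_diag)
next
  have n: "0 < n" "1 < n" using assms by simp_all
  assume "A \<sqsubseteq> B"
  then show "valid (A \<^bold>\<rightarrow> B)"
    unfolding valid_def by (intro ballI imp_intro[where y = 1]) (use n in \<open>simp_all add: belowD\<close>)
qed

lemma valid_impI:
  assumes "2 \<le> n" "\<And>M. M \<in> F \<Longrightarrow> (1, A, 0) \<in> M \<Longrightarrow> (1, B, 0) \<in> M"
  shows "valid (A \<^bold>\<rightarrow> B)"
  unfolding valid_def by (intro ballI imp_intro[where y = 1]) (use assms in simp_all)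

text \<open>Checking one pair of distinct variables in all members is enough: it makes A
  \<rightarrow> B valid, and \<open>valid_imp_iff\<close> spreads this to all pairs, diagonal ones
  included.\<close>

lemma belowI:
  assumes "2 \<le> n" "\<And>M. M \<in> F \<Longrightarrow> (1, A, 0) \<in> M \<Longrightarrow> (1, B, 0) \<in> M"
  shows "A \<sqsubseteq> B"
  using valid_impI assms valid_imp_iff by metis

end

section \<open>The predicates and rules of the theorem as named sets\<close>

definition preds1 :: "pred \<Rightarrow> pred set"
  where "preds1 A = {
        \<^bold>t,
        A \<^bold>\<or> \<^bold>\<not> A,
        A \<^bold>\<or> \<^bold>\<sim> A}"

definition preds2 :: "pred \<Rightarrow> pred \<Rightarrow> pred \<Rightarrow> pred set"
  where "preds2 A B C = {
        A \<^bold>\<rightarrow> A,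
        ((A \<^bold>\<rightarrow> A) \<^bold>\<rightarrow> B) \<^bold>\<rightarrow> B,
        A \<^bold>\<or> A \<^bold>\<rightarrow> A,
        A \<^bold>\<rightarrow> A \<^bold>\<or> B,
        B \<^bold>\<rightarrow> A \<^bold>\<or> B,
        A \<^bold>\<or> B \<^bold>\<rightarrow> B \<^bold>\<or> A,
        A \<^bold>\<rightarrow> A \<^bold>\<and> A,
        A \<^bold>\<and> B \<^bold>\<rightarrow> A,
        A \<^bold>\<and> B \<^bold>\<rightarrow> B,
        A \<^bold>\<and> B \<^bold>\<rightarrow> B \<^bold>\<and> A,
        (A \<^bold>\<or> B) \<^bold>\<or> C \<^bold>\<rightarrow> A \<^bold>\<or> (B \<^bold>\<or> C),
        (A \<^bold>\<and> B) \<^bold>\<and> C \<^bold>\<rightarrow> A \<^bold>\<and> (B \<^bold>\<and> C),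
        (A \<^bold>\<or> B) \<^bold>\<and> C \<^bold>\<rightarrow> (A \<^bold>\<and> C) \<^bold>\<or> (B \<^bold>\<and> C),
        (A \<^bold>\<and> B) \<^bold>\<or> C \<^bold>\<rightarrow> (A \<^bold>\<or> C) \<^bold>\<and> (B \<^bold>\<or> C),
        \<^bold>\<sim> \<^bold>\<sim> A \<^bold>\<rightarrow> A,
        A \<^bold>\<rightarrow> \<^bold>\<sim> \<^bold>\<sim> A,
        \<^bold>\<sim> (A \<^bold>\<or> B) \<^bold>\<rightarrow> \<^bold>\<sim> A \<^bold>\<and> \<^bold>\<sim> B,
        \<^bold>\<sim> (A \<^bold>\<and> B) \<^bold>\<rightarrow> \<^bold>\<sim> A \<^bold>\<or> \<^bold>\<sim> B,
        \<^bold>\<sim> A \<^bold>\<and> \<^bold>\<sim> B \<^bold>\<rightarrow> \<^bold>\<sim> (A \<^bold>\<or> B),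
        \<^bold>\<sim> A \<^bold>\<or> \<^bold>\<sim> B \<^bold>\<rightarrow> \<^bold>\<sim> (A \<^bold>\<and> B),
        \<^bold>\<not> \<^bold>\<not> A \<^bold>\<rightarrow> A,
        A \<^bold>\<rightarrow> \<^bold>\<not> \<^bold>\<not> A,
        \<^bold>\<not> (A \<^bold>\<or> B) \<^bold>\<rightarrow> \<^bold>\<not> A \<^bold>\<and> \<^bold>\<not> B,
        \<^bold>\<not> (A \<^bold>\<and> B) \<^bold>\<rightarrow> \<^bold>\<not> A \<^bold>\<or> \<^bold>\<not> B,
        \<^bold>\<not> A \<^bold>\<and> \<^bold>\<not> B \<^bold>\<rightarrow> \<^bold>\<not> (A \<^bold>\<or> B),
        \<^bold>\<not> A \<^bold>\<or> \<^bold>\<not> B \<^bold>\<rightarrow> \<^bold>\<not> (A \<^bold>\<and> B),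
        A \<^bold>\<rightarrow> B \<^bold>\<or> \<^bold>\<not> B,
        \<^bold>\<not> A \<^bold>\<and> A \<^bold>\<rightarrow> B}"

definition preds3 :: "pred \<Rightarrow> pred \<Rightarrow> pred \<Rightarrow> pred \<Rightarrow> pred set"
  where "preds3 A B C D = {
        (A \<^bold>\<rightarrow> B) \<^bold>\<and> (A \<^bold>\<rightarrow> C) \<^bold>\<rightarrow> (A \<^bold>\<rightarrow> B \<^bold>\<and> C),
        (A \<^bold>\<rightarrow> C) \<^bold>\<and> (B \<^bold>\<rightarrow> C) \<^bold>\<rightarrow> (A \<^bold>\<or> B \<^bold>\<rightarrow> C),
        (A \<^bold>\<rightarrow> B) \<^bold>\<and> (C \<^bold>\<rightarrow> D) \<^bold>\<rightarrow> (A \<^bold>\<and> C \<^bold>\<rightarrow> B \<^bold>\<and> D),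
        (A \<^bold>\<rightarrow> B) \<^bold>\<and> (C \<^bold>\<rightarrow> D) \<^bold>\<rightarrow> (A \<^bold>\<or> C \<^bold>\<rightarrow> B \<^bold>\<or> D),
        (A \<^bold>\<rightarrow> B) \<^bold>\<or> (C \<^bold>\<rightarrow> D) \<^bold>\<rightarrow> (A \<^bold>\<and> C \<^bold>\<rightarrow> B \<^bold>\<or> D),
        A \<^bold>\<circ> B \<^bold>\<rightarrow> \<^bold>\<sim> (A \<^bold>\<rightarrow> \<^bold>\<sim> B),
        \<^bold>\<sim> (A \<^bold>\<rightarrow> \<^bold>\<sim> B) \<^bold>\<rightarrow> A \<^bold>\<circ> B,
        (A \<^bold>\<rightarrow> B) \<^bold>\<circ> A \<^bold>\<rightarrow> B,
        A \<^bold>\<rightarrow> (B \<^bold>\<rightarrow> A \<^bold>\<circ> B),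
        A \<^bold>\<rightarrow> ((B \<^bold>\<rightarrow> \<^bold>\<sim> A) \<^bold>\<rightarrow> \<^bold>\<sim> B),
        A \<^bold>\<circ> B \<^bold>\<and> C \<^bold>\<rightarrow> A \<^bold>\<circ> (B \<^bold>\<and> \<^bold>\<sim> D) \<^bold>\<or> (A \<^bold>\<and> C \<^bold>\<circ> D) \<^bold>\<circ> B,
        A \<^bold>\<circ> B \<^bold>\<and> C \<^bold>\<rightarrow> (A \<^bold>\<and> \<^bold>\<sim> D) \<^bold>\<circ> B \<^bold>\<or> A \<^bold>\<circ> (B \<^bold>\<and> D \<^bold>\<circ> C),
        A \<^bold>\<circ> B \<^bold>\<and> C \<^bold>\<rightarrow> (A \<^bold>\<and> C \<^bold>\<circ> B\<^sup>\<star>) \<^bold>\<circ> (B \<^bold>\<and> A\<^sup>\<star> \<^bold>\<circ> C),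
        \<^bold>t \<^bold>\<circ> A \<^bold>\<rightarrow> A,
        A \<^bold>\<circ> \<^bold>t \<^bold>\<rightarrow> A,
        A \<^bold>\<rightarrow> A \<^bold>\<circ> \<^bold>t\<^sup>\<star>,
        \<^bold>t \<^bold>\<rightarrow> \<^bold>t\<^sup>\<star>,
        \<^bold>t\<^sup>\<star> \<^bold>\<rightarrow> \<^bold>t,
        \<^bold>t \<^bold>\<and> \<^bold>\<sim> \<^bold>t \<^bold>\<rightarrow> A}"

definition preds4 :: "pred \<Rightarrow> pred \<Rightarrow> pred \<Rightarrow> pred set"
  where "preds4 A B C = {
        (A \<^bold>\<rightarrow> B) \<^bold>\<rightarrow> ((C \<^bold>\<rightarrow> A) \<^bold>\<rightarrow> (C \<^bold>\<rightarrow> B)),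
        (A \<^bold>\<rightarrow> (B \<^bold>\<rightarrow> C)) \<^bold>\<rightarrow> (A \<^bold>\<circ> B \<^bold>\<rightarrow> C),
        (A \<^bold>\<circ> B \<^bold>\<rightarrow> C) \<^bold>\<rightarrow> (A \<^bold>\<rightarrow> (B \<^bold>\<rightarrow> C)),
        (A \<^bold>\<rightarrow> B) \<^bold>\<rightarrow> (A \<^bold>\<circ> C \<^bold>\<rightarrow> B \<^bold>\<circ> C),
        (A \<^bold>\<circ> B) \<^bold>\<circ> C \<^bold>\<rightarrow> A \<^bold>\<circ> (B \<^bold>\<circ> C),
        A \<^bold>\<circ> (B \<^bold>\<circ> C) \<^bold>\<rightarrow> (A \<^bold>\<circ> B) \<^bold>\<circ> C}"

definition rules1 :: "pred \<Rightarrow> pred \<Rightarrow> (pred set \<times> pred) set"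
  where "rules1 A B = {
        ({A, B}, A \<^bold>\<and> B),
        ({A \<^bold>\<rightarrow> B, A}, B),
        ({A \<^bold>\<or> B, \<^bold>\<sim> A}, B),
        ({A}, A\<^sup>\<star>)}"

definition rules2 :: "pred \<Rightarrow> pred \<Rightarrow> pred \<Rightarrow> (pred set \<times> pred) set"
  where "rules2 A B C = {
        ({A \<^bold>\<rightarrow> B, B \<^bold>\<rightarrow> C}, A \<^bold>\<rightarrow> C),
        ({A \<^bold>\<rightarrow> B}, \<^bold>\<sim> B \<^bold>\<rightarrow> \<^bold>\<sim> A),
        ({A \<^bold>\<rightarrow> \<^bold>\<sim> B}, B \<^bold>\<rightarrow> \<^bold>\<sim> A),
        ({A \<^bold>\<and> B \<^bold>\<rightarrow> C, B \<^bold>\<rightarrow> C \<^bold>\<or> A}, B \<^bold>\<rightarrow> C),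
        ({A}, (A \<^bold>\<rightarrow> B) \<^bold>\<rightarrow> B),
        ({A \<^bold>\<and> B \<^bold>\<rightarrow> \<^bold>\<not> C}, A \<^bold>\<and> C \<^bold>\<rightarrow> \<^bold>\<not> B),
        ({B \<^bold>\<and> \<^bold>\<not> C \<^bold>\<rightarrow> A \<^bold>\<and> \<^bold>\<not> A}, B \<^bold>\<rightarrow> C),
        ({B \<^bold>\<and> C\<^sup>\<star> \<^bold>\<rightarrow> A \<^bold>\<and> \<^bold>\<not> A}, B \<^bold>\<rightarrow> \<^bold>\<sim> C)}"

definition rules3 :: "pred \<Rightarrow> pred \<Rightarrow> pred \<Rightarrow> pred \<Rightarrow> (pred set \<times> pred) set"
  where "rules3 A B C D = {
        ({A \<^bold>\<rightarrow> B}, (B \<^bold>\<rightarrow> C) \<^bold>\<rightarrow> (A \<^bold>\<rightarrow> C)),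
        ({A \<^bold>\<rightarrow> B}, (C \<^bold>\<rightarrow> A) \<^bold>\<rightarrow> (C \<^bold>\<rightarrow> B)),
        ({A \<^bold>\<rightarrow> B, C \<^bold>\<rightarrow> D}, (B \<^bold>\<rightarrow> C) \<^bold>\<rightarrow> (A \<^bold>\<rightarrow> D)),
        ({A \<^bold>\<rightarrow> B, C \<^bold>\<rightarrow> D}, A \<^bold>\<circ> C \<^bold>\<rightarrow> B \<^bold>\<circ> D),
        ({A \<^bold>\<rightarrow> (B \<^bold>\<rightarrow> C)}, B \<^bold>\<rightarrow> (\<^bold>\<sim> C \<^bold>\<rightarrow> \<^bold>\<sim> A))}"

definition dens3 :: "pred \<Rightarrow> pred \<Rightarrow> pred set"
  where "dens3 A B = {
        (A \<^bold>\<rightarrow> \<^bold>\<sim> A) \<^bold>\<rightarrow> \<^bold>\<sim> A,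
        A \<^bold>\<and> B \<^bold>\<rightarrow> A \<^bold>\<circ> B,
        (A \<^bold>\<rightarrow> B) \<^bold>\<rightarrow> \<^bold>\<sim> A \<^bold>\<or> B}"

definition dens4 :: "pred \<Rightarrow> pred \<Rightarrow> pred \<Rightarrow> pred set"
  where "dens4 A B C = {
        (A \<^bold>\<rightarrow> (A \<^bold>\<rightarrow> B)) \<^bold>\<rightarrow> (A \<^bold>\<rightarrow> B),
        (A \<^bold>\<rightarrow> (B \<^bold>\<rightarrow> C)) \<^bold>\<rightarrow> (A \<^bold>\<and> B \<^bold>\<rightarrow> C)}"

definition comm3 :: "pred \<Rightarrow> pred \<Rightarrow> pred set"
  where "comm3 A B = {
        A \<^bold>\<rightarrow> ((A \<^bold>\<rightarrow> B) \<^bold>\<rightarrow> B),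
        (A \<^bold>\<rightarrow> \<^bold>\<sim> B) \<^bold>\<rightarrow> (B \<^bold>\<rightarrow> \<^bold>\<sim> A)}"

definition comm4 :: "pred \<Rightarrow> pred \<Rightarrow> pred \<Rightarrow> pred set"
  where "comm4 A B C = {
        (A \<^bold>\<rightarrow> (B \<^bold>\<rightarrow> C)) \<^bold>\<rightarrow> (B \<^bold>\<rightarrow> (A \<^bold>\<rightarrow> C)),
        (A \<^bold>\<rightarrow> B) \<^bold>\<rightarrow> ((B \<^bold>\<rightarrow> C) \<^bold>\<rightarrow> (A \<^bold>\<rightarrow> C))}"

section \<open>Laws valid in all frames with enough variables\<close>

context frame begin

lemma below_refl [simp]: "A \<sqsubseteq> A"
  by (simp add: below_def)

lemma below_trans [trans]: "\<lbrakk>A \<sqsubseteq> B; B \<sqsubseteq> C\<rbrakk> \<Longrightarrow> A \<sqsubseteq> C"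
  by (simp add: below_def)

text \<open>The pattern of most arguments on products: v_2 names the middle point between v_1 and
  v_0, and the conclusion, which does not mention v_2, is carried back from \<open>M'\<close> to
  \<open>M\<close> by agreement.\<close>

lemma below_RProd:
  assumes "3 \<le> n" "A \<sqsubseteq> A'" "B \<sqsubseteq> B'"
  shows "A \<^bold>; B \<sqsubseteq> A' \<^bold>; B'"
proof (rule belowI)
  have n: "0 < n" "1 < n" "2 < n" using assms(1) by simp_all
  fix M assume M: "M \<in> F" "(1, A \<^bold>; B, 0) \<in> M"
  obtain M' where M': "M' \<in> F" "(1, A, 2) \<in> M'" "(2, B, 0) \<in> M'"
    "\<And>u C w. u \<noteq> 2 \<Longrightarrow> w \<noteq> 2 \<Longrightarrow> (u, C, w) \<in> M' \<longleftrightarrow> (u, C, w) \<in> M"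
    by (rule prodE[OF M(2) M(1), of 2]) (use n in simp_all)
  have "(1, A' \<^bold>; B', 0) \<in> M'"
    using M' prodI belowD assms(2,3) n by blast
  then show "(1, A' \<^bold>; B', 0) \<in> M"
    using M'(4) by simp
qed (use assms in simp)

text \<open>The order of the factors comes from the path 2 B 1 A 0: the antecedent B ends where the
  implication, and hence A, begins.\<close>

lemma below_imp_iff:
  assumes "3 \<le> n"
  shows "A \<sqsubseteq> B \<^bold>\<rightarrow> C \<longleftrightarrow> B \<^bold>; A \<sqsubseteq> C"
proof
  have n: "0 < n" "1 < n" "2 < n" using assms(1) by simp_all
  {
    assume L: "A \<sqsubseteq> B \<^bold>\<rightarrow> C"
    show "B \<^bold>; A \<sqsubseteq> C"
    proof (rule belowI)
      fix M assume M: "M \<in> F" "(1, B \<^bold>; A, 0) \<in> M"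
      obtain M' where M': "M' \<in> F" "(1, B, 2) \<in> M'" "(2, A, 0) \<in> M'"
        "\<And>u C w. u \<noteq> 2 \<Longrightarrow> w \<noteq> 2 \<Longrightarrow> (u, C, w) \<in> M' \<longleftrightarrow> (u, C, w) \<in> M"
        by (rule prodE[OF M(2) M(1), of 2]) (use n in simp_all)
      have "(1, C, 0) \<in> M'"
        using imp_elim[OF belowD[OF L M'(3,1)] M'(2,1)] n by blast
      then show "(1, C, 0) \<in> M"
        using M'(4) by simp
    qed (use assms in simp)
  next
    assume R: "B \<^bold>; A \<sqsubseteq> C"
    show "A \<sqsubseteq> B \<^bold>\<rightarrow> C"
    proof (rule belowI)
      fix M assume M: "M \<in> F" "(1, A, 0) \<in> M"
      show "(1, B \<^bold>\<rightarrow> C, 0) \<in> M"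
      proof (rule imp_intro[where y = 2])
        fix M' assume M': "M' \<in> F" "(2, B, 1) \<in> M'"
          "\<forall>u C w. u \<noteq> 2 \<longrightarrow> w \<noteq> 2 \<longrightarrow> ((u, C, w) \<in> M' \<longleftrightarrow> (u, C, w) \<in> M)"
        then have "(1, A, 0) \<in> M'" using M by simp
        then show "(2, C, 0) \<in> M'"
          using prodI[of M' 2 1 0 B A] belowD[OF R] M' n by blast
      qed (use n M in simp_all)
    qed (use assms in simp)
  }
qed

lemma valid_preds1: "0 < n \<Longrightarrow> \<forall>P \<in> preds1 A. valid P"
  unfolding preds1_def valid_def by (auto simp: atom_iff ident_refl)

lemma valid_preds2:
  assumes "2 \<le> n"
  shows "\<forall>P \<in> preds2 A B C. valid P"
proof -
  have n: "0 < n" "1 < n" "Suc 0 < n" using assms by simp_all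
  have "(1, B, 0) \<in> M" if M: "M \<in> F" "(1, (A \<^bold>\<rightarrow> A) \<^bold>\<rightarrow> B, 0) \<in> M" for M
  proof -
    \<comment> \<open>At the diagonal pair (1, 1) every other variable is fresh, so v_0 can be
      reused and two variables suffice.\<close>
    have "(1, A \<^bold>\<rightarrow> A, 1) \<in> M"
      by (rule imp_intro[where y = 0]) (use n M in simp_all)
    then show ?thesis
      using imp_elim that n by metis
  qed
  then have *: "valid (((A \<^bold>\<rightarrow> A) \<^bold>\<rightarrow> B) \<^bold>\<rightarrow> B)"
    by (rule valid_impI[OF assms(1)])
  show ?thesis
    unfolding preds2_def ball_simps
    by (intro conjI TrueI; (rule * | (rule valid_impI[OF assms(1)]; simp add: atom_iff n; blast?)))
qed

text \<open>The two antecedents form a path 2 B 1 A 0, so a nested implication costs three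
  variables.\<close>

lemma valid_impI2:
  assumes n: "3 \<le> n"
    and *: "\<And>M. \<lbrakk>M \<in> F; (1, A, 0) \<in> M; (2, B, 1) \<in> M\<rbrakk> \<Longrightarrow> (2, C, 0) \<in> M"
  shows "valid (A \<^bold>\<rightarrow> (B \<^bold>\<rightarrow> C))"
proof (rule valid_impI)
  fix M assume M: "M \<in> F" "(1, A, 0) \<in> M"
  show "(1, B \<^bold>\<rightarrow> C, 0) \<in> M"
    by (rule imp_intro[where y = 2]) (use n M in \<open>simp_all add: *\<close>)
qed (use n in simp)

text \<open>The side atom C at (1, 0) survives the choice of v_2 as middle point, so all three sides
  of the triangle 1, 2, 0 can be used together.\<close>

lemma RProd_belowI:
  assumes n: "3 \<le> n"
    and *: "\<And>M. \<lbrakk>M \<in> F; (1, A, 2) \<in> M; (2, B, 0) \<in> M; (1, C, 0) \<in> M\<rbrakk> \<Longrightarrow> (1, D, 0) \<in> M"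
  shows "(A \<^bold>; B) \<^bold>\<and> C \<sqsubseteq> D"
proof (rule belowI)
  have n': "0 < n" "1 < n" "2 < n" using n by simp_all
  fix M assume M: "M \<in> F" "(1, (A \<^bold>; B) \<^bold>\<and> C, 0) \<in> M"
  then have AB: "(1, A \<^bold>; B, 0) \<in> M" and C: "(1, C, 0) \<in> M"
    using n' by (simp_all add: atom_iff)
  obtain M' where M': "M' \<in> F" "(1, A, 2) \<in> M'" "(2, B, 0) \<in> M'"
    "\<And>u C w. u \<noteq> 2 \<Longrightarrow> w \<noteq> 2 \<Longrightarrow> (u, C, w) \<in> M' \<longleftrightarrow> (u, C, w) \<in> M"
    by (rule prodE[OF AB M(1), of 2]) (use n' in simp_all)
  have "(1, D, 0) \<in> M'"
    using * M'(1-3) M'(4)[of 1 0 C] C by simp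
  then show "(1, D, 0) \<in> M"
    using M'(4) by simp
qed (use n in simp)

lemma RProd_belowI':
  assumes n: "3 \<le> n"
    and *: "\<And>M. \<lbrakk>M \<in> F; (1, A, 2) \<in> M; (2, B, 0) \<in> M\<rbrakk> \<Longrightarrow> (1, D, 0) \<in> M"
  shows "A \<^bold>; B \<sqsubseteq> D"
proof -
  have "A \<^bold>; B \<sqsubseteq> (A \<^bold>; B) \<^bold>\<and> (A \<^bold>; B)"
    by (auto simp: below_def atom_iff)
  also have "\<dots> \<sqsubseteq> D"
    using RProd_belowI[OF n] * by blast
  finally show ?thesis .
qed

lemma valid_preds3:
  assumes n: "3 \<le> n"
  shows "\<forall>P \<in> preds3 A B C D. valid P"
proof -
  have n': "2 \<le> n" "0 < n" "1 < n" "Suc 0 < n" "2 < n" using n by simp_all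
  note imp2 = valid_impI2[OF n]
  note imp = valid_impI[OF n'(1)]
  note prod = valid_imp_iff[OF n'(1), THEN iffD2, OF RProd_belowI'[OF n]]
  note prod' = valid_imp_iff[OF n'(1), THEN iffD2, OF RProd_belowI[OF n]]
  note e = imp_elim[where x = 1 and y = 2 and z = 0]
  show ?thesis
    unfolding preds3_def ball_simps
  proof (intro conjI TrueI)
    show "valid ((A \<^bold>\<rightarrow> B) \<^bold>\<and> (A \<^bold>\<rightarrow> C) \<^bold>\<rightarrow> (A \<^bold>\<rightarrow> B \<^bold>\<and> C))"
      by (rule imp2) (use e n' in \<open>auto simp: atom_iff\<close>)
  next
    show "valid ((A \<^bold>\<rightarrow> C) \<^bold>\<and> (B \<^bold>\<rightarrow> C) \<^bold>\<rightarrow> (A \<^bold>\<or> B \<^bold>\<rightarrow> C))"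
      by (rule imp2) (use e n' in \<open>auto simp: atom_iff\<close>)
  next
    show "valid ((A \<^bold>\<rightarrow> B) \<^bold>\<and> (C \<^bold>\<rightarrow> D) \<^bold>\<rightarrow> (A \<^bold>\<and> C \<^bold>\<rightarrow> B \<^bold>\<and> D))"
      by (rule imp2) (use e n' in \<open>auto simp: atom_iff\<close>)
  next
    show "valid ((A \<^bold>\<rightarrow> B) \<^bold>\<and> (C \<^bold>\<rightarrow> D) \<^bold>\<rightarrow> (A \<^bold>\<or> C \<^bold>\<rightarrow> B \<^bold>\<or> D))"
      by (rule imp2) (use e n' in \<open>auto simp: atom_iff\<close>)
  next
    show "valid ((A \<^bold>\<rightarrow> B) \<^bold>\<or> (C \<^bold>\<rightarrow> D) \<^bold>\<rightarrow> (A \<^bold>\<and> C \<^bold>\<rightarrow> B \<^bold>\<or> D))"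
      by (rule imp2) (use e n' in \<open>auto simp: atom_iff\<close>)
  next
    show "valid (A \<^bold>\<circ> B \<^bold>\<rightarrow> \<^bold>\<sim> (A \<^bold>\<rightarrow> \<^bold>\<sim> B))"
      by (rule prod) (use n' in \<open>auto simp: atom_iff intro: prodI[where y = 2]\<close>)
  next
    show "valid (\<^bold>\<sim> (A \<^bold>\<rightarrow> \<^bold>\<sim> B) \<^bold>\<rightarrow> A \<^bold>\<circ> B)"
    proof -
      \<comment> \<open>Up to double complements, \<sim>(A \<rightarrow> \<sim>B) is the converse of
        this product, so it is bounded by the converse of the goal.\<close>
      have "A\<^sup>\<smile> \<^bold>; Compl (\<^bold>\<sim> B) \<sqsubseteq> (A \<^bold>\<circ> B)\<^sup>\<smile>"
        by (rule RProd_belowI'[OF n]) (use n' in \<open>auto simp: atom_iff intro: prodI[where y = 2]\<close>)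
      then show ?thesis
        using n' by (auto simp: valid_imp_iff below_def atom_iff)
    qed
  next
    show "valid ((A \<^bold>\<rightarrow> B) \<^bold>\<circ> A \<^bold>\<rightarrow> B)"
      by (rule prod) (use imp_elim[where x = 2 and y = 1 and z = 0] n' in auto)
  next
    show "valid (A \<^bold>\<rightarrow> (B \<^bold>\<rightarrow> A \<^bold>\<circ> B))"
      by (rule imp2) (use n' in \<open>auto intro: prodI[where y = 1]\<close>)
  next
    show "valid (A \<^bold>\<rightarrow> ((B \<^bold>\<rightarrow> \<^bold>\<sim> A) \<^bold>\<rightarrow> \<^bold>\<sim> B))"
      by (rule imp2) (use imp_elim[of 2 B "\<^bold>\<sim> A" 1 _ 0] n' in \<open>auto simp: atom_iff\<close>)
  next
    show "valid (A \<^bold>\<circ> B \<^bold>\<and> C \<^bold>\<rightarrow> A \<^bold>\<circ> (B \<^bold>\<and> \<^bold>\<sim> D) \<^bold>\<or> (A \<^bold>\<and> C \<^bold>\<circ> D) \<^bold>\<circ> B)"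
    proof (rule prod')
      fix M assume M: "M \<in> F" "(1, B, 2) \<in> M" "(2, A, 0) \<in> M" "(1, C, 0) \<in> M"
      \<comment> \<open>If 2D1 fails, then \<sim>D joins B at (1, 2). If it holds, the path 2 D 1 C
        0 provides the product that joins A at (2, 0).\<close>
      have "(2, D \<^bold>; C, 0) \<in> M" if "(2, D, 1) \<in> M"
        using prodI M n' that by blast
      then show "(1, A \<^bold>\<circ> (B \<^bold>\<and> \<^bold>\<sim> D) \<^bold>\<or> (A \<^bold>\<and> C \<^bold>\<circ> D) \<^bold>\<circ> B, 0) \<in> M"
        using prodI[of M 1 2 0 "B \<^bold>\<and> \<^bold>\<sim> D" A] prodI[of M 1 2 0 B "A \<^bold>\<and> C \<^bold>\<circ> D"] M n'
        by (cases "(2, D, 1) \<in> M") (simp_all add: atom_iff)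
    qed
  next
    show "valid (A \<^bold>\<circ> B \<^bold>\<and> C \<^bold>\<rightarrow> (A \<^bold>\<and> \<^bold>\<sim> D) \<^bold>\<circ> B \<^bold>\<or> A \<^bold>\<circ> (B \<^bold>\<and> D \<^bold>\<circ> C))"
    proof (rule prod')
      fix M assume M: "M \<in> F" "(1, B, 2) \<in> M" "(2, A, 0) \<in> M" "(1, C, 0) \<in> M"
      \<comment> \<open>Symmetric to the previous law, with the cases taken on 0D2: \<sim>D joins A
        at (2, 0), or the path 1 C 0 D 2 provides the product that joins B.\<close>
      have "(1, C \<^bold>; D, 2) \<in> M" if "(0, D, 2) \<in> M"
        using prodI M n' that by blast
      then show "(1, (A \<^bold>\<and> \<^bold>\<sim> D) \<^bold>\<circ> B \<^bold>\<or> A \<^bold>\<circ> (B \<^bold>\<and> D \<^bold>\<circ> C), 0) \<in> M"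
        using prodI[of M 1 2 0 B "A \<^bold>\<and> \<^bold>\<sim> D"] prodI[of M 1 2 0 "B \<^bold>\<and> D \<^bold>\<circ> C" A] M n'
        by (cases "(0, D, 2) \<in> M") (simp_all add: atom_iff)
    qed
  next
    show "valid (A \<^bold>\<circ> B \<^bold>\<and> C \<^bold>\<rightarrow> (A \<^bold>\<and> C \<^bold>\<circ> B\<^sup>\<star>) \<^bold>\<circ> (B \<^bold>\<and> A\<^sup>\<star> \<^bold>\<circ> C))"
    proof (rule prod')
      fix M assume M: "M \<in> F" "(1, B, 2) \<in> M" "(2, A, 0) \<in> M" "(1, C, 0) \<in> M"
      \<comment> \<open>This is Dedekind's modular law: each of the sides (2, 0) and (1, 2) of the
        triangle is also the detour along the two other sides.\<close>
      have "(2, B\<^sup>\<smile> \<^bold>; C, 0) \<in> M" "(1, C \<^bold>; A\<^sup>\<smile>, 2) \<in> M"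
        using prodI[of M 2 1 0 "B\<^sup>\<smile>" C] prodI[of M 1 0 2 C "A\<^sup>\<smile>"] M n' by (simp_all add: conv_iff)
      then show "(1, (A \<^bold>\<and> C \<^bold>\<circ> B\<^sup>\<star>) \<^bold>\<circ> (B \<^bold>\<and> A\<^sup>\<star> \<^bold>\<circ> C), 0) \<in> M"
        using M n' by (intro prodI[where y = 2]) (simp_all add: atom_iff)
    qed
  next
    show "valid (\<^bold>t \<^bold>\<circ> A \<^bold>\<rightarrow> A)"
      by (rule prod) (metis ident_subst n')
  next
    show "valid (A \<^bold>\<circ> \<^bold>t \<^bold>\<rightarrow> A)"
      by (rule prod) (metis ident_subst_left n')
  next
    show "valid (A \<^bold>\<rightarrow> A \<^bold>\<circ> \<^bold>t\<^sup>\<star>)"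
      by (rule imp, rule prodI[where y = 1]) (use n' in \<open>simp_all add: conv_iff ident_refl\<close>)
  next
    show "valid (\<^bold>t \<^bold>\<rightarrow> \<^bold>t\<^sup>\<star>)" "valid (\<^bold>t\<^sup>\<star> \<^bold>\<rightarrow> \<^bold>t)" "valid (\<^bold>t \<^bold>\<and> \<^bold>\<sim> \<^bold>t \<^bold>\<rightarrow> A)"
      by (rule imp; use ident_sym n' in \<open>auto simp: atom_iff\<close>)+
  qed
qed

text \<open>A product of three factors is a path through four points, all of which have to be named
  at once. Splitting the inner product at v_3 leaves the atoms between v_0, v_1 and v_2
  intact.\<close>

lemma below_assoc:
  assumes n: "4 \<le> n"
  shows "A \<^bold>; (B \<^bold>; C) \<sqsubseteq> (A \<^bold>; B) \<^bold>; C" and "(A \<^bold>; B) \<^bold>; C \<sqsubseteq> A \<^bold>; (B \<^bold>; C)"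
proof -
  have n': "3 \<le> n" "0 < n" "1 < n" "2 < n" "3 < n" using n by simp_all
  show "A \<^bold>; (B \<^bold>; C) \<sqsubseteq> (A \<^bold>; B) \<^bold>; C"
  proof (rule RProd_belowI'[OF n'(1)])
    fix M assume M: "M \<in> F" "(1, A, 2) \<in> M" "(2, B \<^bold>; C, 0) \<in> M"
    obtain M' where M': "M' \<in> F" "(2, B, 3) \<in> M'" "(3, C, 0) \<in> M'"
      "\<And>u C w. u \<noteq> 3 \<Longrightarrow> w \<noteq> 3 \<Longrightarrow> (u, C, w) \<in> M' \<longleftrightarrow> (u, C, w) \<in> M"
      by (rule prodE[OF M(3,1), of 3]) (use n' in simp_all)
    have "(1, A \<^bold>; B, 3) \<in> M'"
      using prodI[of M' 1 2 3 A B] M'(1,2) M'(4)[of 1 2 A] M(2) n' by simp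
    then have "(1, (A \<^bold>; B) \<^bold>; C, 0) \<in> M'"
      using prodI M' n' by blast
    then show "(1, (A \<^bold>; B) \<^bold>; C, 0) \<in> M"
      using M'(4) by simp
  qed
  show "(A \<^bold>; B) \<^bold>; C \<sqsubseteq> A \<^bold>; (B \<^bold>; C)"
  proof (rule RProd_belowI'[OF n'(1)])
    fix M assume M: "M \<in> F" "(1, A \<^bold>; B, 2) \<in> M" "(2, C, 0) \<in> M"
    obtain M' where M': "M' \<in> F" "(1, A, 3) \<in> M'" "(3, B, 2) \<in> M'"
      "\<And>u C w. u \<noteq> 3 \<Longrightarrow> w \<noteq> 3 \<Longrightarrow> (u, C, w) \<in> M' \<longleftrightarrow> (u, C, w) \<in> M"
      by (rule prodE[OF M(2,1), of 3]) (use n' in simp_all)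
    have "(3, B \<^bold>; C, 0) \<in> M'"
      using prodI[of M' 3 2 0 B C] M'(1,3) M'(4)[of 2 0 C] M(3) n' by simp
    then have "(1, A \<^bold>; (B \<^bold>; C), 0) \<in> M'"
      using prodI M' n' by blast
    then show "(1, A \<^bold>; (B \<^bold>; C), 0) \<in> M"
      using M'(4) by simp
  qed
qed

lemma below_imp_app: "3 \<le> n \<Longrightarrow> A \<^bold>; (A \<^bold>\<rightarrow> B) \<sqsubseteq> B"
  using below_imp_iff below_refl by blast

text \<open>Residuation moves every antecedent to the left as a factor. Associativity then brings
  some X next to an X \<rightarrow> Y, where \<open>app\<close> contracts the pair.\<close>

lemma valid_preds4:
  assumes n: "4 \<le> n"
  shows "\<forall>P \<in> preds4 A B C. valid P"
proof -
  have n': "3 \<le> n" "2 \<le> n" using n by simp_all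
  note assoc = below_assoc[OF n] and imp = below_imp_iff[OF n'(1)] and app = below_imp_app[OF n'(1)]
  note left = below_RProd[OF n'(1) _ below_refl] and right = below_RProd[OF n'(1) below_refl]
  show ?thesis
    unfolding preds4_def ball_simps valid_imp_iff[OF n'(2)] imp
  proof (intro conjI TrueI)
    show "C \<^bold>; ((C \<^bold>\<rightarrow> A) \<^bold>; (A \<^bold>\<rightarrow> B)) \<sqsubseteq> B"
      by (rule below_trans[OF assoc(1) below_trans[OF left[OF app] app]])
    show "(B \<^bold>; A) \<^bold>; (A \<^bold>\<rightarrow> (B \<^bold>\<rightarrow> C)) \<sqsubseteq> C"
      by (rule below_trans[OF assoc(2) below_trans[OF right[OF app] app]])
    show "B \<^bold>; (A \<^bold>; (A \<^bold>\<circ> B \<^bold>\<rightarrow> C)) \<sqsubseteq> C"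
      by (rule below_trans[OF assoc(1) app])
    show "(A \<^bold>\<circ> C) \<^bold>; (A \<^bold>\<rightarrow> B) \<sqsubseteq> B \<^bold>\<circ> C"
      by (rule below_trans[OF assoc(2) right[OF app]])
  qed (rule assoc)+
qed

text \<open>One variable suffices because \<open>imp_elim\<close> may be used with all three points
  equal to v_0.\<close>

lemma rules1_valid:
  assumes n: "0 < n"
  shows "\<forall>(Ps, Q) \<in> rules1 A B. (\<forall>P \<in> Ps. valid P) \<longrightarrow> valid Q"
  unfolding rules1_def valid_def
  using n imp_elim[where x = 0 and y = 0 and z = 0] by (auto simp: atom_iff)

lemma rules2_valid:
  assumes n: "2 \<le> n"
  shows "\<forall>(Ps, Q) \<in> rules2 A B C. (\<forall>P \<in> Ps. valid P) \<longrightarrow> valid Q"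
proof -
  have n': "0 < n" "1 < n" using n by simp_all
  have "valid ((A \<^bold>\<rightarrow> B) \<^bold>\<rightarrow> B)" if "valid A"
  proof (rule valid_impI[OF n])
    fix M assume "M \<in> F" "(1, A \<^bold>\<rightarrow> B, 0) \<in> M"
    \<comment> \<open>The antecedent required is 1A1, the validity of A at a variable other than
      v_0.\<close>
    then show "(1, B, 0) \<in> M"
      using valid_diag[OF that] imp_elim n' by metis
  qed
  then show ?thesis
    unfolding rules2_def ball_simps prod.case
    by (intro conjI TrueI; simp only: valid_imp_iff[OF n] simp_thms;
        (unfold below_def, metis atom_iff)?)
qed

lemma rules3_valid:
  assumes n: "3 \<le> n"
  shows "\<forall>(Ps, Q) \<in> rules3 A B C D. (\<forall>P \<in> Ps. valid P) \<longrightarrow> valid Q"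
proof -
  have n': "2 \<le> n" "0 < n" "1 < n" "2 < n" using n by simp_all
  note imp = below_imp_iff[OF n] and app = below_imp_app[OF n]
  note mono = below_RProd[OF n]
  have "valid (B \<^bold>\<rightarrow> (\<^bold>\<sim> C \<^bold>\<rightarrow> \<^bold>\<sim> A))" if "valid (A \<^bold>\<rightarrow> (B \<^bold>\<rightarrow> C))"
  proof (rule valid_impI2[OF n])
    fix M assume M: "M \<in> F" "(1, B, 0) \<in> M" "(2, \<^bold>\<sim> C, 1) \<in> M"
    have "A \<sqsubseteq> B \<^bold>\<rightarrow> C" using that valid_imp_iff n' by simp
    \<comment> \<open>From 0A2 one gets 0(B \<rightarrow> C)2, hence 1C2 by 1B0, against 2 \<sim>C
      1.\<close>
    then have "(0, A, 2) \<notin> M"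
      using belowD[of A "B \<^bold>\<rightarrow> C" 0 2 M] imp_elim[of 0 B C 2 M 1] M n'
      by (auto simp: compl_iff conv_iff)
    then show "(2, \<^bold>\<sim> A, 0) \<in> M"
      using M n' by (simp add: atom_iff)
  qed
  moreover have "valid ((B \<^bold>\<rightarrow> C) \<^bold>\<rightarrow> (A \<^bold>\<rightarrow> C))" "valid ((C \<^bold>\<rightarrow> A) \<^bold>\<rightarrow> (C \<^bold>\<rightarrow> B))" if "A \<sqsubseteq> B"
    unfolding valid_imp_iff[OF n'(1)] imp
    by (rule below_trans[OF mono[OF that below_refl] app]) (rule below_trans[OF app that])
  moreover have "valid ((B \<^bold>\<rightarrow> C) \<^bold>\<rightarrow> (A \<^bold>\<rightarrow> D))" "valid (A \<^bold>\<circ> C \<^bold>\<rightarrow> B \<^bold>\<circ> D)"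
    if "A \<sqsubseteq> B" "C \<sqsubseteq> D"
    unfolding valid_imp_iff[OF n'(1)] imp
    by (rule below_trans[OF mono[OF that(1) below_refl] below_trans[OF app that(2)]])
      (rule mono[OF that(2,1)])
  ultimately show ?thesis
    unfolding rules3_def ball_simps prod.case valid_imp_iff[OF n'(1)] by blast
qed

section \<open>Density, commutativity and symmetry in frames\<close>

definition models :: "eqn set \<Rightarrow> bool"
  where "models \<Psi> \<longleftrightarrow> (\<forall>A B. (A \<doteq> B) \<in> \<Psi> \<longrightarrow> A \<sqsubseteq> B \<and> B \<sqsubseteq> A)"

lemma models_density:
  assumes "models \<Psi>" "density \<subseteq> \<Psi>"
  shows "A \<sqsubseteq> A \<^bold>; A"
proof -
  have "A \<^bold>+ A \<^bold>; A \<sqsubseteq> A \<^bold>; A"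
    using assms unfolding models_def density_def by blast
  then show ?thesis
    by (simp add: below_def sum_iff)
qed

lemma models_commutativity: "\<lbrakk>models \<Psi>; commutativity \<subseteq> \<Psi>\<rbrakk> \<Longrightarrow> A \<^bold>; B \<sqsubseteq> B \<^bold>; A"
  unfolding models_def commutativity_def by blast

lemma models_symmetry: "models symmetry \<Longrightarrow> A \<sqsubseteq> A\<^sup>\<smile>"
  unfolding models_def symmetry_def by blast

text \<open>Density is applied to meets: X lies below X;X, and each copy of X may then be enlarged
  to one of its conjuncts. The meet of A and B gives the second predicate. The meet of the converse
  of A with the complement of B gives the third by contraposition, and the first is the instance of
  the third at \<sim>A.\<close>

lemma valid_dens3:
  assumes n: "3 \<le> n" and dens: "\<And>A. A \<sqsubseteq> A \<^bold>; A"
  shows "\<forall>P \<in> dens3 A B. valid P"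
proof -
  have n': "2 \<le> n" "0 < n" "1 < n" "2 < n" using n by simp_all
  note mono = below_RProd[OF n]
  note iff = valid_imp_iff[OF n'(1)]
  have "A \<^bold>\<and> B \<sqsubseteq> (A \<^bold>\<and> B) \<^bold>; (A \<^bold>\<and> B)"
    by (rule dens)
  also have "\<dots> \<sqsubseteq> B \<^bold>; A"
    by (rule mono) (auto simp: below_def atom_iff)
  finally have 2: "valid (A \<^bold>\<and> B \<^bold>\<rightarrow> A \<^bold>\<circ> B)"
    unfolding iff .
  have "A\<^sup>\<smile> \<^bold>\<and> Compl B \<sqsubseteq> (A\<^sup>\<smile> \<^bold>\<and> Compl B) \<^bold>; (A\<^sup>\<smile> \<^bold>\<and> Compl B)" for A B
    by (rule dens)
  also have "\<dots> A B \<sqsubseteq> A\<^sup>\<smile> \<^bold>; Compl B" for A B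
    by (rule mono) (auto simp: below_def atom_iff)
  finally have 3: "valid ((A \<^bold>\<rightarrow> B) \<^bold>\<rightarrow> \<^bold>\<sim> A \<^bold>\<or> B)" for A B
    unfolding iff below_def by (metis atom_iff)
  moreover have "valid ((A \<^bold>\<rightarrow> \<^bold>\<sim> A) \<^bold>\<rightarrow> \<^bold>\<sim> A)"
    using 3[of A "\<^bold>\<sim> A"] unfolding iff by (simp add: below_def sum_iff)
  ultimately show ?thesis
    using 2 by (simp add: dens3_def)
qed

lemma valid_dens4:
  assumes n: "4 \<le> n" and dens: "\<And>A. A \<sqsubseteq> A \<^bold>; A"
  shows "\<forall>P \<in> dens4 A B C. valid P"
proof -
  have n': "3 \<le> n" "2 \<le> n" using n by simp_all
  note assoc = below_assoc[OF n] and imp = below_imp_iff[OF n'(1)] and app = below_imp_app[OF n'(1)]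
  note left = below_RProd[OF n'(1) _ below_refl] and right = below_RProd[OF n'(1) below_refl]
  have "A \<^bold>\<and> B \<sqsubseteq> B \<^bold>; A"
    using valid_dens3[OF n'(1) dens, of A B] unfolding dens3_def valid_imp_iff[OF n'(2), symmetric] by blast
  \<comment> \<open>After residuation one left factor has to serve two nested implications. It is
    first doubled, A to A;A by density and the meet of A and B to B;A by the fact just shown, and
    then applied twice.\<close>
  from below_trans[OF left[OF this] below_trans[OF assoc(2) below_trans[OF right[OF app] app]]]
    and below_trans[OF left[OF dens] below_trans[OF assoc(2) below_trans[OF right[OF app] app]]]
  show ?thesis
    unfolding dens4_def ball_simps valid_imp_iff[OF n'(2)] imp by blast
qed

lemma valid_comm3:
  assumes n: "3 \<le> n" and comm: "\<And>A B. A \<^bold>; B \<sqsubseteq> B \<^bold>; A"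
  shows "\<forall>P \<in> comm3 A B. valid P"
proof -
  have n': "2 \<le> n" "0 < n" "1 < n" "2 < n" using n by simp_all
  have "B \<^bold>; (A \<^bold>\<rightarrow> \<^bold>\<sim> B) \<sqsubseteq> \<^bold>\<sim> A"
  proof (rule RProd_belowI'[OF n])
    fix M assume M: "M \<in> F" "(1, B, 2) \<in> M" "(2, A \<^bold>\<rightarrow> \<^bold>\<sim> B, 0) \<in> M"
    have "(2, A \<^bold>\<rightarrow> \<^bold>\<sim> B, 0) \<notin> M" if "(0, A, 1) \<in> M"
    proof -
      have "(0, B \<^bold>; A, 2) \<in> M"
        using prodI[of M 0 1 2 A B] comm[of A B] belowD that M n' by blast
      \<comment> \<open>The middle point of the commuted product is again called v_1. The atom 2(A
        \<rightarrow> \<sim>B)0 does not mention v_1 and survives, so three variables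
        suffice.\<close>
      then obtain M' where M': "M' \<in> F" "(0, B, 1) \<in> M'" "(1, A, 2) \<in> M'"
        "\<And>u C w. u \<noteq> 1 \<Longrightarrow> w \<noteq> 1 \<Longrightarrow> (u, C, w) \<in> M' \<longleftrightarrow> (u, C, w) \<in> M"
        by (rule prodE[of 0 B A 2 M 1]) (use n' M in simp_all)
      then have "(2, A \<^bold>\<rightarrow> \<^bold>\<sim> B, 0) \<notin> M'"
        using imp_elim[of 2 A "\<^bold>\<sim> B" 0 M' 1] n' M' by (auto simp: compl_iff conv_iff)
      then show ?thesis
        using M'(4) by simp
    qed
    then show "(1, \<^bold>\<sim> A, 0) \<in> M"
      using M n' by (auto simp: compl_iff conv_iff)
  qed
  with below_trans[OF comm below_imp_app[OF n]] show ?thesis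
    unfolding comm3_def ball_simps valid_imp_iff[OF n'(1)] below_imp_iff[OF n] by blast
qed

text \<open>After residuation both goals concern products of three factors, and exchanging two
  adjacent ones puts each implication behind its antecedent.\<close>

lemma valid_comm4:
  assumes n: "4 \<le> n" and comm: "\<And>A B. A \<^bold>; B \<sqsubseteq> B \<^bold>; A"
  shows "\<forall>P \<in> comm4 A B C. valid P"
proof -
  have n': "3 \<le> n" "2 \<le> n" using n by simp_all
  note assoc = below_assoc[OF n] and imp = below_imp_iff[OF n'(1)] and app = below_imp_app[OF n'(1)]
  note left = below_RProd[OF n'(1) _ below_refl] and right = below_RProd[OF n'(1) below_refl]
  have "A \<^bold>; (B \<^bold>; (A \<^bold>\<rightarrow> (B \<^bold>\<rightarrow> C))) \<sqsubseteq> (A \<^bold>; B) \<^bold>; (A \<^bold>\<rightarrow> (B \<^bold>\<rightarrow> C))"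
    by (rule assoc)
  also have "\<dots> \<sqsubseteq> (B \<^bold>; A) \<^bold>; (A \<^bold>\<rightarrow> (B \<^bold>\<rightarrow> C))"
    by (rule left[OF comm])
  also have "\<dots> \<sqsubseteq> C"
    by (rule below_trans[OF assoc(2) below_trans[OF right[OF app] app]])
  finally have 1: "A \<^bold>; (B \<^bold>; (A \<^bold>\<rightarrow> (B \<^bold>\<rightarrow> C))) \<sqsubseteq> C" .
  have "A \<^bold>; ((B \<^bold>\<rightarrow> C) \<^bold>; (A \<^bold>\<rightarrow> B)) \<sqsubseteq> A \<^bold>; ((A \<^bold>\<rightarrow> B) \<^bold>; (B \<^bold>\<rightarrow> C))"
    by (rule right[OF comm])
  then have "A \<^bold>; ((B \<^bold>\<rightarrow> C) \<^bold>; (A \<^bold>\<rightarrow> B)) \<sqsubseteq> C"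
    by (rule below_trans[OF _ below_trans[OF assoc(1) below_trans[OF left[OF app] app]]])
  with 1 show ?thesis
    unfolding comm4_def ball_simps valid_imp_iff[OF n'(2)] imp by blast
qed

text \<open>The combinator S: density duplicates A, commutativity moves one copy past A
  \<rightarrow> B, and each copy then meets its own implication.\<close>

lemma valid_denscomm4:
  assumes n: "4 \<le> n" and dens: "\<And>A. A \<sqsubseteq> A \<^bold>; A" and comm: "\<And>A B. A \<^bold>; B \<sqsubseteq> B \<^bold>; A"
  shows "valid ((A \<^bold>\<rightarrow> (B \<^bold>\<rightarrow> C)) \<^bold>\<rightarrow> ((A \<^bold>\<rightarrow> B) \<^bold>\<rightarrow> (A \<^bold>\<rightarrow> C)))"
proof -
  have n': "3 \<le> n" "2 \<le> n" using n by simp_all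
  note assoc = below_assoc[OF n] and imp = below_imp_iff[OF n'(1)] and app = below_imp_app[OF n'(1)]
  note left = below_RProd[OF n'(1) _ below_refl] and right = below_RProd[OF n'(1) below_refl]
  let ?P = "A \<^bold>\<rightarrow> (B \<^bold>\<rightarrow> C)" and ?Q = "A \<^bold>\<rightarrow> B"
  have "A \<^bold>; (?Q \<^bold>; ?P) \<sqsubseteq> (A \<^bold>; A) \<^bold>; (?Q \<^bold>; ?P)"
    by (rule left[OF dens])
  also have "\<dots> \<sqsubseteq> A \<^bold>; (A \<^bold>; (?Q \<^bold>; ?P))"
    by (rule assoc)
  also have "\<dots> \<sqsubseteq> A \<^bold>; ((A \<^bold>; ?Q) \<^bold>; ?P)"
    by (rule right[OF assoc(1)])
  also have "\<dots> \<sqsubseteq> A \<^bold>; ((?Q \<^bold>; A) \<^bold>; ?P)"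
    by (rule right[OF left[OF comm]])
  also have "\<dots> \<sqsubseteq> A \<^bold>; (?Q \<^bold>; (A \<^bold>; ?P))"
    by (rule right[OF assoc(2)])
  also have "\<dots> \<sqsubseteq> (A \<^bold>; ?Q) \<^bold>; (A \<^bold>; ?P)"
    by (rule assoc)
  also have "\<dots> \<sqsubseteq> B \<^bold>; (B \<^bold>\<rightarrow> C)"
    by (rule below_RProd[OF n'(1) app app])
  also have "\<dots> \<sqsubseteq> C"
    by (rule app)
  finally show ?thesis
    unfolding valid_imp_iff[OF n'(2)] imp .
qed

lemma valid_sym2:
  assumes n: "2 \<le> n" and sym: "\<And>A. A \<sqsubseteq> A\<^sup>\<smile>"
  shows "valid (A \<^bold>\<and> \<^bold>\<sim> A \<^bold>\<rightarrow> B)"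
  unfolding valid_imp_iff[OF n] using sym[of A] unfolding below_def by (metis atom_iff)

lemma valid_sym3:
  assumes n: "3 \<le> n" and sym: "\<And>A. A \<sqsubseteq> A\<^sup>\<smile>"
  shows "valid (A \<^bold>\<circ> B \<^bold>\<rightarrow> B \<^bold>\<circ> A)"
proof -
  have n': "2 \<le> n" "0 < n" "1 < n" "2 < n" using n by simp_all
  \<comment> \<open>Symmetry of the two factors reverses the path, which proves the goal up to a
    converse. Symmetry of the reversed product itself then removes that converse.\<close>
  have "A \<^bold>\<circ> B \<sqsubseteq> (B \<^bold>\<circ> A)\<^sup>\<smile>"
  proof (rule RProd_belowI'[OF n])
    fix M assume M: "M \<in> F" "(1, B, 2) \<in> M" "(2, A, 0) \<in> M"
    then have "(1, B\<^sup>\<smile>, 2) \<in> M" "(2, A\<^sup>\<smile>, 0) \<in> M"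
      using belowD[OF sym] n' by metis+
    then have "(2, B, 1) \<in> M" "(0, A, 2) \<in> M"
      using M n' by (simp_all add: conv_iff)
    then show "(1, (B \<^bold>\<circ> A)\<^sup>\<smile>, 0) \<in> M"
      using prodI[of M 0 2 1 A B] M n' by (simp add: conv_iff)
  qed
  moreover have "(B \<^bold>\<circ> A)\<^sup>\<smile> \<sqsubseteq> ((B \<^bold>\<circ> A)\<^sup>\<smile>)\<^sup>\<smile>"
    by (rule sym)
  moreover have "((B \<^bold>\<circ> A)\<^sup>\<smile>)\<^sup>\<smile> \<sqsubseteq> B \<^bold>\<circ> A"
    by (simp add: below_def conv_iff)
  ultimately show ?thesis
    unfolding valid_imp_iff[OF n'(1)] by (blast intro: below_trans)
qed

end

section \<open>The sequent calculus\<close>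

text \<open>The Teichmueller-Tukey lemma: a finite part of the union of a nonempty chain lies in a
  single link, so Q passes to the union. It provides the maximal sets for both calculi.\<close>

lemma finite_character_maximal:
  assumes X: "Q X" and fin: "\<And>X. Q X \<longleftrightarrow> (\<forall>Y \<subseteq> X. finite Y \<longrightarrow> Q Y)"
  obtains M where "X \<subseteq> M" "Q M" "\<And>N. \<lbrakk>M \<subseteq> N; Q N\<rbrakk> \<Longrightarrow> N = M"
proof -
  let ?Z = "{Y. X \<subseteq> Y \<and> Q Y}"
  have "\<Union>C \<in> ?Z" if C: "C \<noteq> {}" "subset.chain ?Z C" for C
  proof -
    have "Q Y" if Y: "Y \<subseteq> \<Union>C" "finite Y" for Y
    proof -
      obtain B where "B \<in> C" "Y \<subseteq> B"
        using finite_subset_Union_chain[OF Y(2,1) C] by blast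
      then show ?thesis
        using C(2) fin[of B] \<open>finite Y\<close> unfolding subset.chain_def by blast
    qed
    then have "Q (\<Union>C)"
      using fin by blast
    moreover have "X \<subseteq> \<Union>C"
      using C unfolding subset.chain_def by blast
    ultimately show ?thesis by simp
  qed
  then obtain M where "M \<in> ?Z" "\<forall>Y \<in> ?Z. M \<subseteq> Y \<longrightarrow> Y = M"
    using subset_Zorn_nonempty[of ?Z] X by blast
  then show thesis
    using that[of M] by blast
qed

text \<open>Every premise of every rule displays a formula, so the empty sequent can never be used
  as a premise. As a hypothesis it would be inert and weakening would fail, which is why it is
  excluded.\<close>

locale sequent_theory =
  fixes n :: nat and \<Theta> :: "sequent set"
  assumes hyp_sequents: "\<Theta> \<subseteq> sequents n" and hyp_nonempty: "({}, {}) \<notin> \<Theta>"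
begin

abbreviation prov :: "atom set \<Rightarrow> atom set \<Rightarrow> bool"  (infix "\<turnstile>" 50)
  where "\<Gamma> \<turnstile> \<Delta> \<equiv> (\<Gamma>, \<Delta>) \<in> seq_provable n \<Theta>"

section \<open>Derived rules and weakening in the sequent calculus\<close>

lemma mem_sequents: "(\<Gamma>, \<Delta>) \<in> sequents n \<longleftrightarrow> \<Gamma> \<subseteq> atoms n \<and> \<Delta> \<subseteq> atoms n"
  by (simp add: sequents_def)

lemma mem_atoms [simp]: "(x, A, y) \<in> atoms n \<longleftrightarrow> x < n \<and> y < n"
  by (simp add: atoms_def)

lemma prov_sequents: "\<Gamma> \<turnstile> \<Delta> \<Longrightarrow> \<Gamma> \<subseteq> atoms n \<and> \<Delta> \<subseteq> atoms n"
  unfolding mem_sequents[symmetric]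
  by (erule seq_provable.cases) (use hyp_sequents in \<open>auto simp: seq_axioms_def\<close>)

lemma axiom: "\<lbrakk>a \<in> \<Gamma>; a \<in> \<Delta>; \<Gamma> \<subseteq> atoms n; \<Delta> \<subseteq> atoms n\<rbrakk> \<Longrightarrow> \<Gamma> \<turnstile> \<Delta>"
  by (rule seq_provable.ax) (auto simp: seq_axioms_def mem_sequents)

lemma rule1: "\<lbrakk>seq_rule {p} (\<Gamma>, \<Delta>); p \<in> seq_provable n \<Theta>; \<Gamma> \<subseteq> atoms n; \<Delta> \<subseteq> atoms n\<rbrakk> \<Longrightarrow> \<Gamma> \<turnstile> \<Delta>"
  by (erule seq_provable.rule) (auto simp: mem_sequents)

lemma rule2: "\<lbrakk>seq_rule {p, q} (\<Gamma>, \<Delta>); p \<in> seq_provable n \<Theta>; q \<in> seq_provable n \<Theta>;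
    \<Gamma> \<subseteq> atoms n; \<Delta> \<subseteq> atoms n\<rbrakk> \<Longrightarrow> \<Gamma> \<turnstile> \<Delta>"
  by (erule seq_provable.rule) (auto simp: mem_sequents)

lemma cut:
  assumes "\<Gamma> \<turnstile> insert a \<Delta>" "insert a \<Gamma>' \<turnstile> \<Delta>'"
  shows "\<Gamma> \<union> \<Gamma>' \<turnstile> \<Delta> \<union> \<Delta>'"
proof -
  obtain x A y where "a = (x, A, y)" by (cases a)
  then show ?thesis
    using rule2[OF seq_rule.Cut] assms prov_sequents[OF assms(1)] prov_sequents[OF assms(2)] by simp
qed

text \<open>The calculus has no weakening rule, but a nonempty sequent can be cut against an axiom with a
  larger context.\<close>

lemma weaken_nonempty:
  assumes "\<Gamma> \<turnstile> \<Delta>" "\<Gamma> \<subseteq> \<Gamma>'" "\<Delta> \<subseteq> \<Delta>'" "\<Gamma>' \<subseteq> atoms n" "\<Delta>' \<subseteq> atoms n" "\<Gamma> \<union> \<Delta> \<noteq> {}"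
  shows "\<Gamma>' \<turnstile> \<Delta>'"
proof -
  consider a where "a \<in> \<Delta>" | a where "a \<in> \<Gamma>" using assms(6) by blast
  then show ?thesis
  proof cases
    case 1
    then have "\<Gamma> \<turnstile> insert a \<Delta>" "insert a \<Gamma>' \<turnstile> \<Delta>'"
      using assms axiom[of a "insert a \<Gamma>'" \<Delta>'] by (auto simp: insert_absorb)
    then have "\<Gamma> \<union> \<Gamma>' \<turnstile> \<Delta> \<union> \<Delta>'" by (rule cut)
    then show ?thesis using assms by (simp add: Un_absorb1)
  next
    case 2
    then have "\<Gamma>' \<turnstile> insert a \<Delta>'" "insert a \<Gamma> \<turnstile> \<Delta>"
      using assms axiom[of a \<Gamma>' "insert a \<Delta>'"] by (auto simp: insert_absorb)
    then have "\<Gamma>' \<union> \<Gamma> \<turnstile> \<Delta>' \<union> \<Delta>" by (rule cut)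
    then show ?thesis using assms by (simp add: Un_absorb2)
  qed
qed

text \<open>All rules but Cut leave a principal formula in the conclusion, so a proof of the empty
  sequent ends with a cut of |a against a|. Both of these are nonempty and can be weakened before
  they are cut again.\<close>

lemma empty_imp_prov:
  assumes "{} \<turnstile> {}" "\<Gamma> \<subseteq> atoms n" "\<Delta> \<subseteq> atoms n" "\<Gamma> \<union> \<Delta> \<noteq> {}"
  shows "\<Gamma> \<turnstile> \<Delta>"
proof -
  obtain a where "{} \<turnstile> {a}" "{a} \<turnstile> {}"
    using assms(1)
  proof (cases rule: seq_provable.cases)
    case (rule P)
    from rule(1) show ?thesis
      by (cases rule: seq_rule.cases) (use rule(2) in \<open>simp_all, blast intro: that\<close>)
  qed (use hyp_nonempty in \<open>auto simp: seq_axioms_def\<close>)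
  moreover from this have "{a} \<subseteq> atoms n"
    using prov_sequents by blast
  ultimately have "\<Gamma> \<turnstile> insert a \<Delta>" "insert a \<Gamma> \<turnstile> \<Delta>"
    using assms(2,3) by (auto intro: weaken_nonempty[of _ "{a}"] weaken_nonempty[of "{a}"])
  from cut[OF this] show ?thesis
    by simp
qed

lemma weaken:
  assumes "\<Gamma> \<turnstile> \<Delta>" "\<Gamma> \<subseteq> \<Gamma>'" "\<Delta> \<subseteq> \<Delta>'" "\<Gamma>' \<subseteq> atoms n" "\<Delta>' \<subseteq> atoms n"
  shows "\<Gamma>' \<turnstile> \<Delta>'"
proof (cases "\<Gamma> \<union> \<Delta> = {}")
  case True
  then show ?thesis
    using assms empty_imp_prov by (cases "\<Gamma>' \<union> \<Delta>' = {}") auto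
next
  case False
  then show ?thesis
    using weaken_nonempty[OF assms] by blast
qed

section \<open>Maximal consistent sets of atoms\<close>

definition consistent :: "atom set \<Rightarrow> bool"
  where "consistent M \<longleftrightarrow> M \<subseteq> atoms n \<and> (\<forall>\<Gamma> \<subseteq> M. finite \<Gamma> \<longrightarrow> \<not> \<Gamma> \<turnstile> {})"

definition worlds :: "atom set set"
  where "worlds = {M. consistent M \<and> (\<forall>N. M \<subseteq> N \<longrightarrow> consistent N \<longrightarrow> N = M)}"

lemma consistent_extend:
  assumes "consistent X"
  obtains M where "M \<in> worlds" "X \<subseteq> M"
proof -
  \<comment> \<open>Although sequents may be infinite, consistency only tests finite left sides, and
    so it has finite character.\<close>
  have "consistent X \<longleftrightarrow> (\<forall>Y \<subseteq> X. finite Y \<longrightarrow> consistent Y)" for X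
  proof
    assume R: "\<forall>Y \<subseteq> X. finite Y \<longrightarrow> consistent Y"
    have "a \<in> atoms n" if "a \<in> X" for a
      using R[rule_format, of "{a}"] that by (simp add: consistent_def)
    then show "consistent X"
      using R by (auto simp: consistent_def)
  qed (auto simp: consistent_def)
  from finite_character_maximal[of consistent, OF assms this]
  show thesis
    using that unfolding worlds_def by (smt (verit) mem_Collect_eq)
qed

lemma inconsistent_insert:
  assumes "consistent M" "\<not> consistent (insert a M)" "a \<in> atoms n"
  obtains \<Gamma> where "\<Gamma> \<subseteq> M" "finite \<Gamma>" "insert a \<Gamma> \<turnstile> {}"
proof -
  obtain \<Gamma> where \<Gamma>: "\<Gamma> \<subseteq> insert a M" "finite \<Gamma>" "\<Gamma> \<turnstile> {}"
    using assms unfolding consistent_def by blast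
  \<comment> \<open>The refuted set need not contain a; weakening puts it there.\<close>
  have "insert a (\<Gamma> - {a}) \<turnstile> {}"
    using \<Gamma>(3) by (rule weaken) (use \<Gamma> assms in \<open>auto simp: consistent_def\<close>)
  with \<Gamma> show thesis
    using that[of "\<Gamma> - {a}"] by blast
qed

lemma worlds_atoms: "M \<in> worlds \<Longrightarrow> M \<subseteq> atoms n"
  by (simp add: worlds_def consistent_def)

lemma world_compl_iff:
  assumes M: "M \<in> worlds" and xy: "x < n" "y < n"
  shows "(x, Compl A, y) \<in> M \<longleftrightarrow> (x, A, y) \<notin> M"
proof
  let ?a = "(x, A, y)" and ?c = "(x, Compl A, y)"
  have con: "consistent M" using M by (simp add: worlds_def)
  {
    assume "?c \<in> M"
    moreover have "{?c, ?a} \<turnstile> {}"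
      by (rule rule1[OF seq_rule.ComplL axiom[of ?a]]) (use xy in auto)
    ultimately show "?a \<notin> M"
      using con unfolding consistent_def by auto
  next
    assume "?a \<notin> M"
    show "?c \<in> M"
    proof (rule ccontr)
      assume "?c \<notin> M"
      with \<open>?a \<notin> M\<close> have "\<not> consistent (insert ?a M)" "\<not> consistent (insert ?c M)"
        using M unfolding worlds_def by blast+
      with con xy obtain \<Gamma> \<Gamma>' where \<Gamma>: "\<Gamma> \<subseteq> M" "finite \<Gamma>" "insert ?a \<Gamma> \<turnstile> {}"
        and \<Gamma>': "\<Gamma>' \<subseteq> M" "finite \<Gamma>'" "insert ?c \<Gamma>' \<turnstile> {}"
        using inconsistent_insert[of M] by (metis mem_atoms)
      \<comment> \<open>The refutation of \<open>?a\<close> becomes a proof of \<open>?c\<close>, to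
        be cut against the refutation of \<open>?c\<close>.\<close>
      have "\<Gamma> \<turnstile> {?c}"
        by (rule rule1[OF seq_rule.ComplR \<Gamma>(3)]) (use \<Gamma> worlds_atoms[OF M] xy in auto)
      then have "\<Gamma> \<union> \<Gamma>' \<turnstile> {}"
        using cut[OF _ \<Gamma>'(3)] by fastforce
      then show False
        using con \<Gamma> \<Gamma>' unfolding consistent_def by (metis Un_least finite_UnI)
    qed
  }
qed

text \<open>A formula on the right that is missing from M has its complement in M and can be moved
  to the left as that complement. With an empty right side the sequent would contradict
  consistency.\<close>

lemma world_sequent:
  assumes "finite \<Delta>" "\<Gamma> \<turnstile> \<Delta>" "finite \<Gamma>" "\<Gamma> \<subseteq> M" and M: "M \<in> worlds"
  shows "\<exists>a \<in> \<Delta>. a \<in> M"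
  using assms(1-4)
proof (induction \<Delta> arbitrary: \<Gamma> rule: finite_induct)
  case empty
  then show ?case using M by (auto simp: worlds_def consistent_def)
next
  case (insert a \<Delta>)
  obtain x A y where a: "a = (x, A, y)" by (cases a)
  have xy: "x < n" "y < n" "\<Delta> \<subseteq> atoms n" "\<Gamma> \<subseteq> atoms n"
    using prov_sequents[OF insert.prems(1)] a by auto
  show ?case
  proof (cases "a \<in> M")
    case False
    then have "(x, Compl A, y) \<in> M"
      using a xy world_compl_iff[OF M] by simp
    moreover have "insert (x, Compl A, y) \<Gamma> \<turnstile> \<Delta>"
      by (rule rule1[OF seq_rule.ComplL insert.prems(1)[unfolded a]]) (use xy in auto)
    ultimately show ?thesis
      using insert.IH[of "insert (x, Compl A, y) \<Gamma>"] insert.prems by blast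
  qed blast
qed

text \<open>The set \<open>?X\<close> retains exactly the atoms of M without y, so the freshness
  proviso of \<open>RProdL\<close> is met by every context drawn from them. That rule turns a
  refutation of \<open>?X\<close> into a refutation of a finite part of M.\<close>

lemma world_prod_witness:
  assumes M: "M \<in> worlds" and xyz: "x < n" "y < n" "z < n" "y \<noteq> x" "y \<noteq> z" and AB: "(x, A \<^bold>; B, z) \<in> M"
  obtains M' where "M' \<in> worlds" "agree y M M'" "(x, A, y) \<in> M'" "(y, B, z) \<in> M'"
proof -
  let ?N = "{(u, C, w). (u, C, w) \<in> M \<and> u \<noteq> y \<and> w \<noteq> y}"
  let ?X = "insert (x, A, y) (insert (y, B, z) ?N)"
  have "\<not> \<Gamma> \<turnstile> {}" if \<Gamma>: "\<Gamma> \<subseteq> ?X" "finite \<Gamma>" for \<Gamma>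
  proof
    assume *: "\<Gamma> \<turnstile> {}"
    have "insert (x, A, y) (insert (y, B, z) (\<Gamma> \<inter> ?N)) \<turnstile> {}"
      by (rule weaken[OF *]) (use \<Gamma> worlds_atoms[OF M] xyz in auto)
    then have "insert (x, A \<^bold>; B, z) (\<Gamma> \<inter> ?N) \<turnstile> {}"
      by (intro rule1[OF seq_rule.RProdL]) (use xyz worlds_atoms[OF M] in auto)
    moreover have "insert (x, A \<^bold>; B, z) (\<Gamma> \<inter> ?N) \<subseteq> M" "finite (insert (x, A \<^bold>; B, z) (\<Gamma> \<inter> ?N))"
      using AB \<Gamma> by auto
    ultimately show False
      using M unfolding worlds_def consistent_def by blast
  qed
  moreover have "?X \<subseteq> atoms n"
    using worlds_atoms[OF M] xyz by auto
  ultimately have "consistent ?X"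
    unfolding consistent_def by simp
  then obtain M' where M': "M' \<in> worlds" "?X \<subseteq> M'"
    by (rule consistent_extend)
  then have in_M': "(u, C, w) \<in> M'" if "(u, C, w) \<in> M" "u \<noteq> y" "w \<noteq> y" for u C w
    using that by (simp add: subset_iff)
  have "(u, C, w) \<in> M' \<longleftrightarrow> (u, C, w) \<in> M" if "u \<noteq> y" "w \<noteq> y" for u C w
  \<comment> \<open>Complements turn the inclusion into an equivalence, but only for variables below
    n; \<open>agree\<close> does not bound its variables, and beyond n neither world has any
    atom.\<close>
  proof (cases "u < n \<and> w < n")
    case True
    then show ?thesis
      using in_M'[OF _ that] world_compl_iff[OF M, of u w C] world_compl_iff[OF M'(1), of u w C] by metis
  next
    case False
    then show ?thesis
      using worlds_atoms[OF M] worlds_atoms[OF M'(1)] by (metis mem_atoms subsetD)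
  qed
  then have "agree y M M'"
    by (simp add: agree_def)
  then show thesis
    using that[OF M'(1)] M'(2) by simp
qed

lemma world_sequent1: "\<lbrakk>\<Gamma> \<turnstile> {a}; finite \<Gamma>; \<Gamma> \<subseteq> M; M \<in> worlds\<rbrakk> \<Longrightarrow> a \<in> M"
  using world_sequent[of "{a}"] by blast

sublocale frame n worlds
proof
  fix M x y A B assume M: "M \<in> worlds" and xy: "x < n" "y < n"
  have "{(x, A \<^bold>+ B, y)} \<turnstile> {(x, A, y), (x, B, y)}"
    by (rule rule2[OF seq_rule.SumL[where \<Gamma> = "{}" and \<Gamma>' = "{}" and \<Delta> = "{(x, A, y), (x, B, y)}"
          and \<Delta>' = "{(x, A, y), (x, B, y)}", simplified]])
      (use xy in \<open>auto intro: axiom\<close>)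
  from world_sequent[OF _ this _ _ M]
  have "(x, A, y) \<in> M \<or> (x, B, y) \<in> M" if "(x, A \<^bold>+ B, y) \<in> M"
    using that by auto
  moreover have "{(x, A, y)} \<turnstile> {(x, A \<^bold>+ B, y)}" "{(x, B, y)} \<turnstile> {(x, A \<^bold>+ B, y)}"
    by (rule rule1[OF seq_rule.SumR axiom[of "(x, A, y)"]]; use xy in simp)
      (rule rule1[OF seq_rule.SumR axiom[of "(x, B, y)"]]; use xy in simp)
  then have "(x, A \<^bold>+ B, y) \<in> M" if "(x, A, y) \<in> M \<or> (x, B, y) \<in> M"
    using that world_sequent1[OF _ _ _ M] by blast
  ultimately show "(x, A \<^bold>+ B, y) \<in> M \<longleftrightarrow> (x, A, y) \<in> M \<or> (x, B, y) \<in> M"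
    by blast
next
  fix M x y A assume M: "M \<in> worlds" and xy: "x < n" "y < n"
  then show "(x, Compl A, y) \<in> M \<longleftrightarrow> (x, A, y) \<notin> M"
    by (rule world_compl_iff)
  have "{(y, A, x)} \<turnstile> {(x, A\<^sup>\<smile>, y)}"
    by (rule rule1[OF seq_rule.ConvR axiom]) (use xy in auto)
  moreover have "{(x, A\<^sup>\<smile>, y)} \<turnstile> {(y, A, x)}"
    by (rule rule1[OF seq_rule.ConvL axiom]) (use xy in auto)
  ultimately show "(x, A\<^sup>\<smile>, y) \<in> M \<longleftrightarrow> (y, A, x) \<in> M"
    using world_sequent1[OF _ _ _ M] by blast
next
  fix M x assume M: "M \<in> worlds" and x: "x < n"
  have "{} \<turnstile> {(x, Ident, x)}"
    by (rule seq_provable.ax) (use x in \<open>auto simp: seq_axioms_def mem_sequents\<close>)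
  then show "(x, Ident, x) \<in> M"
    using world_sequent1 M by blast
next
  fix M x y z A
  assume M: "M \<in> worlds" and xyz: "x < n" "y < n" "z < n" and *: "(x, A, z) \<in> M" "(z, Ident, y) \<in> M"
  have "{(x, A, z), (z, Ident, y)} \<turnstile> {(x, A, y)}"
    by (rule rule1[OF seq_rule.Equality axiom]) (use xyz in auto)
  then show "(x, A, y) \<in> M"
    by (rule world_sequent1) (use M * in auto)
next
  fix M x y z A B
  assume M: "M \<in> worlds" and xyz: "x < n" "y < n" "z < n" and *: "(x, A, y) \<in> M" "(y, B, z) \<in> M"
  have "{(x, A, y)} \<turnstile> {(x, A, y)}" "{(y, B, z)} \<turnstile> {(y, B, z)}"
    using xyz by (auto intro: axiom)
  then have "{(x, A, y)} \<union> {(y, B, z)} \<turnstile> insert (x, A \<^bold>; B, z) ({} \<union> {})"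
    by (rule rule2[OF seq_rule.RProdR]) (use xyz in auto)
  then show "(x, A \<^bold>; B, z) \<in> M"
    by (intro world_sequent1) (use M * in auto)
next
  fix M x y z A B
  assume "M \<in> worlds" "x < n" "y < n" "z < n" "(x, A \<^bold>; B, z) \<in> M" "y \<noteq> x" "y \<noteq> z"
  then show "\<exists>M' \<in> worlds. agree y M M' \<and> (x, A, y) \<in> M' \<and> (y, B, z) \<in> M'"
    using world_prod_witness by metis
qed

text \<open>If x \<not>A y| were provable, a cut against |xAy, x \<not>A y would prove |xAy. So an
  unprovable |xAy makes the complement consistent, and some world extends it.\<close>

lemma complete:
  assumes "\<And>M. M \<in> worlds \<Longrightarrow> (x, A, y) \<in> M" "x < n" "y < n"
  shows "{} \<turnstile> {(x, A, y)}"
proof (rule ccontr)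
  assume *: "\<not> {} \<turnstile> {(x, A, y)}"
  let ?c = "(x, Compl A, y)"
  have "{} \<turnstile> {(x, A, y), ?c}"
    by (rule rule1[OF seq_rule.ComplR axiom[of "(x, A, y)" "{(x, A, y)}" "{(x, A, y)}"], simplified insert_commute])
      (use assms in auto)
  then have "\<not> {?c} \<turnstile> {}"
    using cut[of "{}" ?c "{(x, A, y)}" "{}" "{}"] * by (auto simp: insert_commute)
  moreover have "\<not> {} \<turnstile> {}"
    using * weaken[of "{}" "{}" "{}" "{(x, A, y)}"] assms by auto
  ultimately have "consistent {?c}"
    using assms unfolding consistent_def by (auto simp: subset_singleton_iff)
  then obtain M where "M \<in> worlds" "{?c} \<subseteq> M"
    by (rule consistent_extend)
  then show False
    using assms compl_iff by blast
qed

end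

lemma eqn_sequents_sequents: "eqn_sequents n \<Psi> \<subseteq> sequents n"
  unfolding eqn_sequents_def sequents_def atoms_def by auto

text \<open>The frame to which the assumption is applied consists of the worlds over the hypotheses
  themselves. The sequents of an equation, taken with empty contexts, force both inclusions in each
  world.\<close>

lemma provable_fromI:
  assumes n: "0 < n"
    and valid: "\<And>F. \<lbrakk>frame n F; frame.models n F \<Psi>\<rbrakk> \<Longrightarrow> frame.valid F P"
  shows "provable_from n \<Psi> P"
proof -
  interpret sequent_theory n "eqn_sequents n \<Psi>"
    by unfold_locales (rule eqn_sequents_sequents, simp add: eqn_sequents_def)
  have hyp: "({(x, A, y)}, {(x, B, y)}) \<in> eqn_sequents n \<Psi>"
    if "(A \<doteq> B) \<in> \<Psi> \<or> (B \<doteq> A) \<in> \<Psi>" "x < n" "y < n" for A B x y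
    unfolding eqn_sequents_def
    by (intro CollectI exI[of _ x] exI[of _ y] exI[of _ A] exI[of _ B] exI[of _ "{}"])
      (use that in \<open>simp add: sequents_def\<close>)
  have "(x, B, y) \<in> M"
    if "(A \<doteq> B) \<in> \<Psi> \<or> (B \<doteq> A) \<in> \<Psi>" "M \<in> worlds" "x < n" "y < n" "(x, A, y) \<in> M" for A B M x y
    using world_sequent1[OF seq_provable.hyp[OF hyp[OF that(1,3,4)]]] that by simp
  then have "models \<Psi>"
    unfolding models_def below_def by blast
  then have "valid P"
    using assms(2)[of worlds] frame_axioms by blast
  then have "({}, {(0, P, 0)}) \<in> seq_provable n (eqn_sequents n \<Psi>)"
    using complete n unfolding valid_def by blast
  then show ?thesis
    by (simp add: provable_from_def pred_sequent_def)
qed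

section \<open>Extending a given proof\<close>

lemma obtained_mono: "\<lbrakk>obtained n S s; S \<subseteq> T\<rbrakk> \<Longrightarrow> obtained n T s"
  unfolding obtained_def by blast

definition extends_proof :: "nat \<Rightarrow> sequent list \<Rightarrow> sequent list \<Rightarrow> bool"
  where "extends_proof n p q \<longleftrightarrow> (\<forall>k < length q. obtained n (set (p @ take k q)) (q ! k))"

text \<open>What r obtains from p alone is still obtained when q stands in between.\<close>

lemma extends_proof_append:
  assumes "extends_proof n p q" "extends_proof n p r"
  shows "extends_proof n p (q @ r)"
  unfolding extends_proof_def
proof (intro allI impI)
  fix k assume k: "k < length (q @ r)"
  show "obtained n (set (p @ take k (q @ r))) ((q @ r) ! k)"
  proof (cases "k < length q")
    case True
    then show ?thesis
      using assms(1) unfolding extends_proof_def by (simp add: nth_append)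
  next
    case False
    then have "obtained n (set (p @ take (k - length q) r)) (r ! (k - length q))"
      using assms(2) k unfolding extends_proof_def by simp
    then show ?thesis
      using False by (simp add: nth_append) (erule obtained_mono, auto)
  qed
qed

lemma finite_seq_rule_premises: "seq_rule P s \<Longrightarrow> finite P"
  by (erule seq_rule.cases) simp_all

text \<open>A derivation is turned into a list. Each rule has finitely many premises, so the
  extensions for the premises can be concatenated and the conclusion appended.\<close>

lemma seq_provable_extends_proof:
  assumes "s \<in> seq_provable n \<Theta>" "\<Theta> \<subseteq> set p" "\<Theta> \<subseteq> sequents n"
  shows "s \<in> sequents n \<and> (\<exists>q. extends_proof n p q \<and> s \<in> set (p @ q))"
  using assms(1)
proof induction
  case (hyp s)
  moreover have "extends_proof n p []"
    by (simp add: extends_proof_def)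
  ultimately show ?case
    using assms by force
next
  case (ax s)
  then have "s \<in> sequents n"
    unfolding seq_axioms_def by blast
  moreover have "extends_proof n p [s]"
    using ax calculation by (simp add: extends_proof_def obtained_def)
  ultimately show ?case
    by force
next
  case (rule P s)
  have "\<exists>q. extends_proof n p q \<and> P' \<subseteq> set (p @ q)" if "finite P'" "P' \<subseteq> P" for P'
    using that
  proof (induction P' rule: finite_induct)
    case empty
    have "extends_proof n p []"
      by (simp add: extends_proof_def)
    then show ?case by blast
  next
    case (insert t P')
    then obtain q r where "extends_proof n p q" "P' \<subseteq> set (p @ q)" "extends_proof n p r" "t \<in> set (p @ r)"
      using rule.IH[of t] by blast
    then have "extends_proof n p (q @ r) \<and> insert t P' \<subseteq> set (p @ q @ r)"
      using extends_proof_append by auto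
    then show ?case by blast
  qed
  then obtain q where q: "extends_proof n p q" "P \<subseteq> set (p @ q)"
    using finite_seq_rule_premises[OF rule.hyps(1)] by blast
  then have "obtained n (set (p @ q)) s"
    using rule.IH rule.hyps(1) \<open>s \<in> sequents n\<close> unfolding obtained_def by blast
  then have "extends_proof n p (q @ [s])"
    using q(1) unfolding extends_proof_def by (auto simp: nth_append less_Suc_eq)
  moreover have "s \<in> set (p @ q @ [s])"
    by simp
  ultimately show ?case
    using \<open>s \<in> sequents n\<close> by blast
qed

text \<open>The premises of the rule become the hypotheses of the calculus. A derivation from them
  refers to nothing else in the given proof, so it extends any proof that contains them.\<close>

lemma rule_provableI:
  assumes n: "0 < n"
    and valid: "\<And>F. \<lbrakk>frame n F; \<forall>A \<in> As. frame.valid F A\<rbrakk> \<Longrightarrow> frame.valid F B"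
  shows "rule_provable n As B"
proof -
  have sub: "pred_sequent ` As \<subseteq> sequents n"
    using n by (auto simp: pred_sequent_def sequents_def atoms_def)
  interpret sequent_theory n "pred_sequent ` As"
    by unfold_locales (rule sub, auto simp: pred_sequent_def)
  have "(0, A, 0) \<in> M" if "A \<in> As" "M \<in> worlds" for A M
  proof -
    have "({}, {(0, A, 0)}) \<in> seq_provable n (pred_sequent ` As)"
      using that by (intro seq_provable.hyp) (auto simp: pred_sequent_def)
    then show ?thesis
      using world_sequent1 that by blast
  qed
  then have "valid B"
    using assms(2)[of worlds] frame_axioms by (simp add: valid_def)
  then have "pred_sequent B \<in> seq_provable n (pred_sequent ` As)"
    using complete n unfolding valid_def pred_sequent_def by blast
  from seq_provable_extends_proof[OF this _ sub] show ?thesis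
    unfolding rule_provable_def extends_proof_def by blast
qed

section \<open>The predicate calculus\<close>

lemma finite_free [simp]: "finite (free \<phi>)"
  by (induction \<phi>) auto

lemma free_foldr_All [simp]: "free (foldr All xs \<phi>) = free \<phi> - set xs"
  by (induction xs) auto

lemma free_subset_vars: "free \<phi> \<subseteq> vars \<phi>"
  by (induction \<phi>) auto

lemma forms_simps [simp]:
  "Rel x A y \<in> forms n \<longleftrightarrow> x < n \<and> y < n"
  "Equation e \<in> forms n"
  "(\<phi> \<^bold>\<Rightarrow> \<psi>) \<in> forms n \<longleftrightarrow> \<phi> \<in> forms n \<and> \<psi> \<in> forms n"
  "Neg \<phi> \<in> forms n \<longleftrightarrow> \<phi> \<in> forms n"
  "All x \<phi> \<in> forms n \<longleftrightarrow> x < n \<and> \<phi> \<in> forms n"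
  by (auto simp: forms_def)

lemma forms_foldr_All [simp]: "foldr All xs \<phi> \<in> forms n \<longleftrightarrow> set xs \<subseteq> {..<n} \<and> \<phi> \<in> forms n"
  by (induction xs) auto

lemma free_less: "\<lbrakk>\<phi> \<in> forms n; x \<in> free \<phi>\<rbrakk> \<Longrightarrow> x < n"
  using free_subset_vars[of \<phi>] by (auto simp: forms_def)

lemma closure_eq: "\<lbrakk>sorted us; distinct us; set us = free \<phi>\<rbrakk> \<Longrightarrow> closure \<phi> = foldr All us \<phi>"
  unfolding closure_def using sorted_list_of_set.idem_if_sorted_distinct[of us] by simp

lemma closure_closed [simp]: "free \<phi> = {} \<Longrightarrow> closure \<phi> = \<phi>"
  by (simp add: closure_def)

lemma closure_forms [simp]: "closure \<phi> \<in> forms n \<longleftrightarrow> \<phi> \<in> forms n"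
  using free_less[of \<phi> n] by (auto simp: closure_def)

lemma free_closure [simp]: "free (closure \<phi>) = {}"
  by (simp add: closure_def)

lemma transpose_less: "\<lbrakk>x < n; y < n; u < n\<rbrakk> \<Longrightarrow> transpose x y u < (n :: nat)"
  by (simp add: transpose_def)

lemma interchange_forms: "\<lbrakk>\<phi> \<in> forms n; x < n; y < n\<rbrakk> \<Longrightarrow> interchange x y \<phi> \<in> forms n"
  by (induction \<phi>) (auto simp: transpose_less)

lemma interchange_involutory [simp]: "interchange x y (interchange x y \<phi>) = \<phi>"
  by (induction \<phi>) auto

lemma interchange_commute: "interchange x y \<phi> = interchange y x \<phi>"
  by (induction \<phi>) (auto simp: transpose_commute)

lemma interchange_same [simp]: "interchange x x \<phi> = \<phi>"
  by (induction \<phi>) auto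

lemma free_interchange: "free (interchange x y \<phi>) = transpose x y ` free \<phi>"
  by (induction \<phi>) (auto simp: image_Un image_set_diff[OF inj_transpose])

text \<open>The transposition of x and y as a product of three, with z as a parking place. If x and
  y are exactly the free variables, each of the three steps moves a variable into an unoccupied
  place.\<close>

lemma interchange_via:
  assumes "z \<noteq> x" "z \<noteq> y"
  shows "interchange x y \<phi> = interchange z y (interchange y x (interchange x z \<phi>))"
  using assms by (induction \<phi>) (auto simp: transpose_def)

lemma upt_split: "k < m \<Longrightarrow> [0..<m] = [0..<k] @ k # [Suc k..<m]"
  using upt_add_eq_append[of 0 k "m - k"] by (simp add: upt_conv_Cons)

locale form_theory =
  fixes n :: nat and \<Psi> :: "eqn set"
  assumes n: "3 \<le> n"
begin

section \<open>Modus ponens and generalization under a quantifier prefix\<close>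

abbreviation sentences :: "form set"  where "sentences \<equiv> form_provable n \<Psi>"

text \<open>Modus ponens is available for whole sentences only. The innermost variable is peeled off
  because the closure of its distribution axiom has exactly the remaining variables as
  prefix.\<close>

lemma closure_distrib:
  assumes "sorted us" "distinct us" "set us = free (\<alpha> \<^bold>\<Rightarrow> \<beta>)" "(\<alpha> \<^bold>\<Rightarrow> \<beta>) \<in> forms n"
    "foldr All us (\<alpha> \<^bold>\<Rightarrow> \<beta>) \<in> sentences" "foldr All us \<alpha> \<in> sentences"
  shows "foldr All us \<beta> \<in> sentences"
  using assms
proof (induction us arbitrary: \<alpha> \<beta> rule: rev_induct)
  case Nil
  then show ?case by (auto intro: form_provable.mp)
next
  case (snoc u us)
  let ?\<chi> = "All u (\<alpha> \<^bold>\<Rightarrow> \<beta>) \<^bold>\<Rightarrow> (All u \<alpha> \<^bold>\<Rightarrow> All u \<beta>)"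
  have u: "u < n"
    using snoc.prems(3,4) free_less[of _ n u] by fastforce
  have us: "sorted us" "distinct us" "u \<notin> set us"
    using snoc.prems(1,2) by (auto simp: sorted_append)
  then have fr: "set us = free \<alpha> \<union> free \<beta> - {u}"
    using snoc.prems(3) by auto
  have "closure ?\<chi> = foldr All us ?\<chi>"
    by (rule closure_eq) (use us fr in auto)
  then have \<chi>: "foldr All us ?\<chi> \<in> sentences"
    using form_axioms.intros(5)[of \<alpha> n \<beta> u] snoc.prems(4) u form_provable.ax[of _ n \<Psi>] by simp
  have "foldr All us (All u \<alpha> \<^bold>\<Rightarrow> All u \<beta>) \<in> sentences"
    by (rule snoc.IH[OF us(1,2) _ _ \<chi>]) (use snoc.prems fr u in auto)
  from snoc.IH[OF us(1,2) _ _ this] have "foldr All us (All u \<beta>) \<in> sentences"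
    using snoc.prems fr u by auto
  then show ?case by simp
qed

text \<open>Vacuous quantifiers are inserted from the largest index downwards. When k is inserted,
  every free variable of the formula already prefixed lies below k, so the closure of the vacuous
  quantification axiom has precisely the outer part of the prefix.\<close>

lemma closure_lift_aux:
  assumes \<phi>: "\<phi> \<in> forms n" "closure \<phi> \<in> sentences" "free \<phi> \<subseteq> {..<m}" and "m \<le> n" and "k \<le> m"
  shows "foldr All (filter (\<lambda>i. i \<in> free \<phi> \<or> k \<le> i) [0..<m]) \<phi> \<in> sentences"
  using \<open>k \<le> m\<close>
proof (induction k rule: inc_induct)
  case base
  have "closure \<phi> = foldr All (filter (\<lambda>i. i \<in> free \<phi> \<or> m \<le> i) [0..<m]) \<phi>"
    by (rule closure_eq) (use \<phi> in \<open>auto simp: sorted_wrt_filter\<close>)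
  then show ?case using \<phi> by simp
next
  case (step k)
  show ?case
  proof (cases "k \<in> free \<phi>")
    case True
    then have "(i \<in> free \<phi> \<or> k \<le> i) \<longleftrightarrow> (i \<in> free \<phi> \<or> Suc k \<le> i)" for i
      by (auto simp: le_less)
    then show ?thesis
      using step.IH by simp
  next
    case False
    let ?us = "filter (\<lambda>i. i \<in> free \<phi>) [0..<k]" and ?vs = "[Suc k..<m]"
    let ?\<alpha> = "foldr All ?vs \<phi>"
    have split: "[0..<m] = [0..<k] @ k # [Suc k..<m]"
      using \<open>k < m\<close> by (rule upt_split)
    have "filter (\<lambda>i. i \<in> free \<phi> \<or> Suc k \<le> i) [0..<m] = ?us @ ?vs"
      "filter (\<lambda>i. i \<in> free \<phi> \<or> k \<le> i) [0..<m] = ?us @ k # ?vs"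
      unfolding split using False by (auto intro!: filter_cong)
    note lists = this
    have "x < k" if "x \<in> free \<phi>" "x \<notin> set ?vs" for x
      using that False \<phi>(3) by (cases x k rule: linorder_cases) auto
    then have us: "free \<alpha> = set ?us" if "free \<alpha> = free \<phi> - set ?vs" for \<alpha>
      using that by auto
    have "closure (?\<alpha> \<^bold>\<Rightarrow> All k ?\<alpha>) = foldr All ?us (?\<alpha> \<^bold>\<Rightarrow> All k ?\<alpha>)"
      by (rule closure_eq) (use us[of "?\<alpha> \<^bold>\<Rightarrow> All k ?\<alpha>"] False in \<open>auto simp: sorted_wrt_filter\<close>)
    moreover have "closure (?\<alpha> \<^bold>\<Rightarrow> All k ?\<alpha>) \<in> form_axioms n"
      by (rule form_axioms.intros(7)) (use False \<phi> step \<open>m \<le> n\<close> in auto)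
    ultimately have ax: "foldr All ?us (?\<alpha> \<^bold>\<Rightarrow> All k ?\<alpha>) \<in> sentences"
      using form_provable.ax by metis
    have "foldr All ?us (All k ?\<alpha>) \<in> sentences"
    proof (rule closure_distrib[OF _ _ _ _ ax])
      show "set ?us = free (?\<alpha> \<^bold>\<Rightarrow> All k ?\<alpha>)"
        by (rule us[symmetric]) (use False in auto)
      show "(?\<alpha> \<^bold>\<Rightarrow> All k ?\<alpha>) \<in> forms n"
        using \<phi>(1) \<open>k < m\<close> \<open>m \<le> n\<close> by auto
      show "foldr All ?us ?\<alpha> \<in> sentences"
        using step.IH lists(1) by simp
    qed (simp_all add: sorted_wrt_filter)
    then show ?thesis
      using lists by simp
  qed
qed

lemma closure_lift:
  assumes "\<phi> \<in> forms n" "closure \<phi> \<in> sentences" "free \<phi> \<subseteq> {..<m}" "m \<le> n"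
  shows "foldr All [0..<m] \<phi> \<in> sentences"
  using closure_lift_aux[OF assms, of 0] by simp

text \<open>Unlike in \<open>closure_distrib\<close>, the prefix may contain vacuous variables. The
  distribution axiom reaches this prefix through \<open>closure_lift\<close>.\<close>

lemma prefix_distrib:
  assumes "m \<le> n" "free (\<alpha> \<^bold>\<Rightarrow> \<beta>) \<subseteq> {..<m}" "(\<alpha> \<^bold>\<Rightarrow> \<beta>) \<in> forms n"
    "foldr All [0..<m] (\<alpha> \<^bold>\<Rightarrow> \<beta>) \<in> sentences" "foldr All [0..<m] \<alpha> \<in> sentences"
  shows "foldr All [0..<m] \<beta> \<in> sentences"
  using assms
proof (induction m arbitrary: \<alpha> \<beta>)
  case 0
  then show ?case by (auto intro: form_provable.mp)
next
  case (Suc m)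
  let ?\<chi> = "All m (\<alpha> \<^bold>\<Rightarrow> \<beta>) \<^bold>\<Rightarrow> (All m \<alpha> \<^bold>\<Rightarrow> All m \<beta>)"
  have fr: "free ?\<chi> \<subseteq> {..<m}"
    using Suc.prems(2) by (auto simp: less_Suc_eq)
  have \<chi>: "foldr All [0..<m] ?\<chi> \<in> sentences"
    by (rule closure_lift[OF _ form_provable.ax[OF form_axioms.intros(5)] fr]) (use Suc.prems in auto)
  have "foldr All [0..<m] (All m \<alpha> \<^bold>\<Rightarrow> All m \<beta>) \<in> sentences"
    by (rule Suc.IH[OF _ fr _ \<chi>]) (use Suc.prems in auto)
  from Suc.IH[OF _ _ _ this] have "foldr All [0..<m] (All m \<beta>) \<in> sentences"
    using Suc.prems fr by auto
  then show ?case by simp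
qed

text \<open>The calculus proves sentences, and the closure prefix varies with the free variables.
  One common prefix for all formulas makes modus ponens independent of which variables
  occur.\<close>

definition thm_form :: "form \<Rightarrow> bool"  ("\<tturnstile> _" [20] 20)
  where "thm_form \<phi> \<longleftrightarrow> \<phi> \<in> forms n \<and> foldr All [0..<n] \<phi> \<in> sentences"

lemma thm_forms: "\<tturnstile> \<phi> \<Longrightarrow> \<phi> \<in> forms n"
  by (simp add: thm_form_def)

lemma thm_closure: "\<lbrakk>\<phi> \<in> forms n; closure \<phi> \<in> sentences\<rbrakk> \<Longrightarrow> \<tturnstile> \<phi>"
  unfolding thm_form_def using closure_lift free_less by blast

lemmas thm_axiom = thm_closure[OF _ form_provable.ax]

lemma thm_mp: "\<lbrakk>\<tturnstile> \<phi> \<^bold>\<Rightarrow> \<psi>; \<tturnstile> \<phi>\<rbrakk> \<Longrightarrow> \<tturnstile> \<psi>"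
  unfolding thm_form_def using prefix_distrib[of n \<phi> \<psi>] free_less[of "\<phi> \<^bold>\<Rightarrow> \<psi>" n] by auto

lemma thm_All_D: "\<tturnstile> All x \<phi> \<Longrightarrow> \<tturnstile> \<phi>"
  using thm_mp[OF thm_axiom[OF _ form_axioms.intros(6)[of \<phi> n x]]] thm_forms[of "All x \<phi>"] by simp

lemma thm_foldr_All_D: "\<tturnstile> foldr All xs \<phi> \<Longrightarrow> \<tturnstile> \<phi>"
  by (induction xs) (auto dest: thm_All_D)

text \<open>The common prefix already quantifies x. The quantifiers outside it are stripped by
  instantiation; those inside are first exchanged with it and then stripped.\<close>

lemma thm_gen:
  assumes "\<tturnstile> \<phi>" "x < n"
  shows "\<tturnstile> All x \<phi>"
proof -
  have split: "[0..<n] = [0..<x] @ x # [Suc x..<n]"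
    using assms(2) by (rule upt_split)
  have drop: "\<tturnstile> All x \<phi>" if "\<tturnstile> All x (foldr All ys \<phi>)" for ys
    using that
  proof (induction ys)
    case (Cons y ys)
    then have "\<tturnstile> All x (All y (foldr All ys \<phi>))" by simp
    moreover have "\<tturnstile> All x (All y (foldr All ys \<phi>)) \<^bold>\<Rightarrow> All y (All x (foldr All ys \<phi>))"
      by (rule thm_axiom[OF _ form_axioms.intros(4)]) (use thm_forms[OF Cons.prems] in auto)
    ultimately show ?case
      using Cons.IH thm_mp thm_All_D by blast
  qed simp
  let ?\<sigma> = "foldr All [0..<n] \<phi>"
  have "\<tturnstile> ?\<sigma>"
  proof (rule thm_closure)
    have "free ?\<sigma> = {}"
      using thm_forms[OF assms(1)] free_less by auto
    then show "closure ?\<sigma> \<in> sentences"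
      using assms(1) by (simp add: thm_form_def)
  qed (use thm_forms[OF assms(1)] in auto)
  then have "\<tturnstile> foldr All [0..<x] (All x (foldr All [Suc x..<n] \<phi>))"
    by (simp add: split)
  then show ?thesis
    using thm_foldr_All_D drop by blast
qed

text \<open>For closed \<sigma> the instantiation axioms along the prefix are closed, so they apply
  without a prefix of their own.\<close>

lemma thm_sentence:
  assumes "\<tturnstile> \<sigma>" "free \<sigma> = {}"
  shows "\<sigma> \<in> sentences"
proof -
  have "\<sigma> \<in> sentences" if "foldr All xs \<sigma> \<in> sentences" "set xs \<subseteq> {..<n}" for xs
    using that
  proof (induction xs)
    case (Cons x xs)
    let ?\<tau> = "foldr All xs \<sigma>"
    have "closure (All x ?\<tau> \<^bold>\<Rightarrow> ?\<tau>) \<in> form_axioms n"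
      by (rule form_axioms.intros(6)) (use Cons.prems thm_forms[OF assms(1)] in auto)
    then have "(All x ?\<tau> \<^bold>\<Rightarrow> ?\<tau>) \<in> form_axioms n"
      using assms(2) by simp
    then have "?\<tau> \<in> sentences"
      using form_provable.mp[OF _ form_provable.ax] Cons.prems by simp
    then show ?case
      using Cons by simp
  qed simp
  then show ?thesis
    using assms(1) unfolding thm_form_def by fastforce
qed

section \<open>Propositional logic from Lukasiewicz's three axioms\<close>

lemma luk1: "\<lbrakk>\<phi> \<in> forms n; \<psi> \<in> forms n; \<chi> \<in> forms n\<rbrakk> \<Longrightarrow> \<tturnstile> (\<phi> \<^bold>\<Rightarrow> \<psi>) \<^bold>\<Rightarrow> (\<psi> \<^bold>\<Rightarrow> \<chi>) \<^bold>\<Rightarrow> \<phi> \<^bold>\<Rightarrow> \<chi>"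
  by (rule thm_axiom[OF _ form_axioms.intros(1)]) auto

lemma luk2: "\<phi> \<in> forms n \<Longrightarrow> \<tturnstile> (Neg \<phi> \<^bold>\<Rightarrow> \<phi>) \<^bold>\<Rightarrow> \<phi>"
  by (rule thm_axiom[OF _ form_axioms.intros(2)]) auto

lemma luk3: "\<lbrakk>\<phi> \<in> forms n; \<psi> \<in> forms n\<rbrakk> \<Longrightarrow> \<tturnstile> \<phi> \<^bold>\<Rightarrow> Neg \<phi> \<^bold>\<Rightarrow> \<psi>"
  by (rule thm_axiom[OF _ form_axioms.intros(3)]) auto

lemma thm_syl: "\<lbrakk>\<tturnstile> \<phi> \<^bold>\<Rightarrow> \<psi>; \<tturnstile> \<psi> \<^bold>\<Rightarrow> \<chi>\<rbrakk> \<Longrightarrow> \<tturnstile> \<phi> \<^bold>\<Rightarrow> \<chi>"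
  by (rule thm_mp[OF thm_mp[OF luk1]]; (assumption | force dest: thm_forms))

lemma luk4:
  assumes "\<phi> \<in> forms n" "\<psi> \<in> forms n" "\<chi> \<in> forms n" "\<theta> \<in> forms n"
  shows "\<tturnstile> (\<phi> \<^bold>\<Rightarrow> Neg \<psi>) \<^bold>\<Rightarrow> ((\<phi> \<^bold>\<Rightarrow> \<chi>) \<^bold>\<Rightarrow> \<theta>) \<^bold>\<Rightarrow> \<psi> \<^bold>\<Rightarrow> \<theta>"
proof -
  have 1: "\<tturnstile> (\<phi> \<^bold>\<Rightarrow> Neg \<psi>) \<^bold>\<Rightarrow> (Neg \<psi> \<^bold>\<Rightarrow> \<chi>) \<^bold>\<Rightarrow> \<phi> \<^bold>\<Rightarrow> \<chi>"
    by (rule luk1) (use assms in simp_all)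
  have 2: "\<tturnstile> ((Neg \<psi> \<^bold>\<Rightarrow> \<chi>) \<^bold>\<Rightarrow> \<phi> \<^bold>\<Rightarrow> \<chi>) \<^bold>\<Rightarrow> \<psi> \<^bold>\<Rightarrow> \<phi> \<^bold>\<Rightarrow> \<chi>"
    by (rule thm_mp[OF luk1 luk3]) (use assms in simp_all)
  have 3: "\<tturnstile> (\<psi> \<^bold>\<Rightarrow> \<phi> \<^bold>\<Rightarrow> \<chi>) \<^bold>\<Rightarrow> ((\<phi> \<^bold>\<Rightarrow> \<chi>) \<^bold>\<Rightarrow> \<theta>) \<^bold>\<Rightarrow> \<psi> \<^bold>\<Rightarrow> \<theta>"
    by (rule luk1) (use assms in simp_all)
  show ?thesis
    by (rule thm_syl[OF thm_syl[OF 1 2] 3])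
qed

lemma luk5:
  assumes "\<phi> \<in> forms n" "\<psi> \<in> forms n" "\<chi> \<in> forms n" "\<theta> \<in> forms n"
  shows "\<tturnstile> \<phi> \<^bold>\<Rightarrow> ((Neg \<phi> \<^bold>\<Rightarrow> \<psi>) \<^bold>\<Rightarrow> \<chi>) \<^bold>\<Rightarrow> \<theta> \<^bold>\<Rightarrow> \<chi>"
  by (rule thm_syl[OF luk3[of \<phi> "Neg \<theta>"] luk4]) (use assms in simp_all)

text \<open>Before K is available, a theorem cannot simply be prefixed by Neg \<psi>. For Clavius'
  law \<open>?X\<close> this is possible through \<open>luk5\<close>, since the further antecedent
  that it asks for is the same law for \<open>?X\<close>.\<close>

lemma luk6:
  assumes "\<phi> \<in> forms n" "\<psi> \<in> forms n"
  shows "\<tturnstile> (((Neg \<phi> \<^bold>\<Rightarrow> \<phi>) \<^bold>\<Rightarrow> \<phi>) \<^bold>\<Rightarrow> \<psi>) \<^bold>\<Rightarrow> \<psi>"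
proof -
  let ?X = "(Neg \<phi> \<^bold>\<Rightarrow> \<phi>) \<^bold>\<Rightarrow> \<phi>"
  have "\<tturnstile> ((Neg ?X \<^bold>\<Rightarrow> ?X) \<^bold>\<Rightarrow> ?X) \<^bold>\<Rightarrow> Neg \<psi> \<^bold>\<Rightarrow> ?X"
    by (rule thm_mp[OF luk5 luk2]) (use assms in simp_all)
  then have "\<tturnstile> Neg \<psi> \<^bold>\<Rightarrow> ?X"
    by (rule thm_mp) (rule luk2, use assms in simp)
  then have "\<tturnstile> (?X \<^bold>\<Rightarrow> \<psi>) \<^bold>\<Rightarrow> Neg \<psi> \<^bold>\<Rightarrow> \<psi>"
    by (rule thm_mp[OF luk1, rotated 3]) (use assms in simp_all)
  then show ?thesis
    by (rule thm_syl) (rule luk2, use assms in simp)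
qed

lemma imp_K: "\<lbrakk>\<phi> \<in> forms n; \<psi> \<in> forms n\<rbrakk> \<Longrightarrow> \<tturnstile> \<phi> \<^bold>\<Rightarrow> \<psi> \<^bold>\<Rightarrow> \<phi>"
  by (rule thm_syl[OF luk5[of \<phi> \<phi> \<phi> \<psi>] luk6]) simp_all

text \<open>Contraction is reduced by \<open>luk1\<close> to Peirce's law for \<open>?X\<close> and
  \<psi>. Peirce's law follows from \<open>luk2\<close>, because Neg \<open>?X\<close> makes
  \<open>?X\<close> imply \<psi>.\<close>

lemma imp_W:
  assumes "\<phi> \<in> forms n" "\<psi> \<in> forms n"
  shows "\<tturnstile> (\<phi> \<^bold>\<Rightarrow> \<phi> \<^bold>\<Rightarrow> \<psi>) \<^bold>\<Rightarrow> \<phi> \<^bold>\<Rightarrow> \<psi>"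
proof -
  let ?X = "\<phi> \<^bold>\<Rightarrow> \<psi>"
  have 1: "\<tturnstile> (\<phi> \<^bold>\<Rightarrow> ?X) \<^bold>\<Rightarrow> (?X \<^bold>\<Rightarrow> \<psi>) \<^bold>\<Rightarrow> ?X"
    by (rule luk1) (use assms in simp_all)
  have "\<tturnstile> Neg ?X \<^bold>\<Rightarrow> ((Neg \<psi> \<^bold>\<Rightarrow> \<psi>) \<^bold>\<Rightarrow> \<psi>) \<^bold>\<Rightarrow> ?X \<^bold>\<Rightarrow> \<psi>"
    by (rule thm_syl[OF imp_K[of _ "Neg \<psi>"] luk4]) (use assms in simp_all)
  then have "\<tturnstile> Neg ?X \<^bold>\<Rightarrow> ?X \<^bold>\<Rightarrow> \<psi>"
    by (rule thm_syl) (rule luk6, use assms in simp_all)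
  then have "\<tturnstile> ((?X \<^bold>\<Rightarrow> \<psi>) \<^bold>\<Rightarrow> ?X) \<^bold>\<Rightarrow> Neg ?X \<^bold>\<Rightarrow> ?X"
    by (rule thm_mp[OF luk1, rotated 3]) (use assms in simp_all)
  then have "\<tturnstile> ((?X \<^bold>\<Rightarrow> \<psi>) \<^bold>\<Rightarrow> ?X) \<^bold>\<Rightarrow> ?X"
    by (rule thm_syl) (rule luk2, use assms in simp)
  then show ?thesis
    by (rule thm_syl[OF 1])
qed

lemma imp_C:
  assumes "\<phi> \<in> forms n" "\<psi> \<in> forms n" "\<chi> \<in> forms n"
  shows "\<tturnstile> (\<phi> \<^bold>\<Rightarrow> \<psi> \<^bold>\<Rightarrow> \<chi>) \<^bold>\<Rightarrow> \<psi> \<^bold>\<Rightarrow> \<phi> \<^bold>\<Rightarrow> \<chi>"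
proof -
  have 1: "\<tturnstile> (\<phi> \<^bold>\<Rightarrow> \<psi> \<^bold>\<Rightarrow> \<chi>) \<^bold>\<Rightarrow> ((\<psi> \<^bold>\<Rightarrow> \<chi>) \<^bold>\<Rightarrow> \<chi>) \<^bold>\<Rightarrow> \<phi> \<^bold>\<Rightarrow> \<chi>"
    by (rule luk1) (use assms in simp_all)
  have "\<tturnstile> \<psi> \<^bold>\<Rightarrow> (\<psi> \<^bold>\<Rightarrow> \<chi>) \<^bold>\<Rightarrow> (\<psi> \<^bold>\<Rightarrow> \<chi>) \<^bold>\<Rightarrow> \<chi>"
    by (rule thm_syl[OF imp_K luk1]) (use assms in simp_all)
  then have "\<tturnstile> \<psi> \<^bold>\<Rightarrow> (\<psi> \<^bold>\<Rightarrow> \<chi>) \<^bold>\<Rightarrow> \<chi>"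
    by (rule thm_syl) (rule imp_W, use assms in simp_all)
  then have "\<tturnstile> (((\<psi> \<^bold>\<Rightarrow> \<chi>) \<^bold>\<Rightarrow> \<chi>) \<^bold>\<Rightarrow> \<phi> \<^bold>\<Rightarrow> \<chi>) \<^bold>\<Rightarrow> \<psi> \<^bold>\<Rightarrow> \<phi> \<^bold>\<Rightarrow> \<chi>"
    by (rule thm_mp[OF luk1, rotated 3]) (use assms in simp_all)
  then show ?thesis
    by (rule thm_syl[OF 1])
qed

lemma imp_B:
  assumes "\<phi> \<in> forms n" "\<psi> \<in> forms n" "\<chi> \<in> forms n"
  shows "\<tturnstile> (\<psi> \<^bold>\<Rightarrow> \<chi>) \<^bold>\<Rightarrow> (\<phi> \<^bold>\<Rightarrow> \<psi>) \<^bold>\<Rightarrow> \<phi> \<^bold>\<Rightarrow> \<chi>"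
  by (rule thm_mp[OF imp_C luk1]) (use assms in simp_all)

lemma imp_S:
  assumes "\<phi> \<in> forms n" "\<psi> \<in> forms n" "\<chi> \<in> forms n"
  shows "\<tturnstile> (\<phi> \<^bold>\<Rightarrow> \<psi> \<^bold>\<Rightarrow> \<chi>) \<^bold>\<Rightarrow> (\<phi> \<^bold>\<Rightarrow> \<psi>) \<^bold>\<Rightarrow> \<phi> \<^bold>\<Rightarrow> \<chi>"
proof -
  have 1: "\<tturnstile> (\<phi> \<^bold>\<Rightarrow> \<psi> \<^bold>\<Rightarrow> \<chi>) \<^bold>\<Rightarrow> (\<phi> \<^bold>\<Rightarrow> \<psi>) \<^bold>\<Rightarrow> \<phi> \<^bold>\<Rightarrow> \<phi> \<^bold>\<Rightarrow> \<chi>"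
    by (rule thm_syl[OF imp_C imp_B]) (use assms in simp_all)
  have 2: "\<tturnstile> ((\<phi> \<^bold>\<Rightarrow> \<psi>) \<^bold>\<Rightarrow> \<phi> \<^bold>\<Rightarrow> \<phi> \<^bold>\<Rightarrow> \<chi>) \<^bold>\<Rightarrow> (\<phi> \<^bold>\<Rightarrow> \<psi>) \<^bold>\<Rightarrow> \<phi> \<^bold>\<Rightarrow> \<chi>"
    by (rule thm_mp[OF imp_B imp_W]) (use assms in simp_all)
  show ?thesis
    by (rule thm_syl[OF 1 2])
qed

lemma Neg_NegD: "\<phi> \<in> forms n \<Longrightarrow> \<tturnstile> Neg (Neg \<phi>) \<^bold>\<Rightarrow> \<phi>"
  by (rule thm_syl[OF thm_mp[OF imp_C luk3] luk2]) simp_all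

lemma imp_refl: "\<phi> \<in> forms n \<Longrightarrow> \<tturnstile> \<phi> \<^bold>\<Rightarrow> \<phi>"
  by (rule thm_mp[OF imp_W imp_K]) simp_all

section \<open>Derivations and maximal theories\<close>

inductive_set derives :: "form set \<Rightarrow> form set" for S where
  hyp: "\<phi> \<in> S \<Longrightarrow> \<phi> \<in> derives S"
| thm_form: "\<tturnstile> \<phi> \<Longrightarrow> \<phi> \<in> derives S"
| mp: "\<lbrakk>(\<phi> \<^bold>\<Rightarrow> \<psi>) \<in> derives S; \<phi> \<in> derives S\<rbrakk> \<Longrightarrow> \<psi> \<in> derives S"

lemma derives_forms:
  assumes "\<phi> \<in> derives S" "S \<subseteq> forms n"
  shows "\<phi> \<in> forms n"
  using assms by (induction) (auto dest: thm_forms)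

lemma derives_cut:
  assumes "\<phi> \<in> derives S" "S \<subseteq> derives T"
  shows "\<phi> \<in> derives T"
  using assms by (induction) (auto intro: derives.intros)

lemma derives_finite:
  assumes "\<phi> \<in> derives S"
  shows "\<exists>T \<subseteq> S. finite T \<and> \<phi> \<in> derives T"
  using assms
proof induction
  case (hyp \<phi>)
  have "\<phi> \<in> derives {\<phi>}" by (rule derives.hyp) simp
  then show ?case using hyp by (intro exI[of _ "{\<phi>}"]) simp
next
  case (thm_form \<phi>)
  then show ?case by (intro exI[of _ "{}"]) (simp add: derives.thm_form)
next
  case (mp \<phi> \<psi>)
  then obtain T U where T: "T \<subseteq> S" "finite T" "(\<phi> \<^bold>\<Rightarrow> \<psi>) \<in> derives T"
    and U: "U \<subseteq> S" "finite U" "\<phi> \<in> derives U" by blast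
  have "(\<phi> \<^bold>\<Rightarrow> \<psi>) \<in> derives (T \<union> U)" "\<phi> \<in> derives (T \<union> U)"
    by (rule derives_cut[OF T(3)] derives_cut[OF U(3)]; blast intro: derives.hyp)+
  then have "\<psi> \<in> derives (T \<union> U)" by (rule derives.mp)
  then show ?case using T U by (intro exI[of _ "T \<union> U"]) simp
qed

text \<open>Generalization is not a rule of \<open>derives\<close> and acts on theorems only, so the
  free variables of \<psi> impose no condition.\<close>

lemma deduction:
  assumes "\<phi> \<in> derives (insert \<psi> S)" "insert \<psi> S \<subseteq> forms n"
  shows "(\<psi> \<^bold>\<Rightarrow> \<phi>) \<in> derives S"
  using assms(1)
proof induction
  case (hyp \<phi>)
  show ?case
  proof (cases "\<phi> = \<psi>")
    case True
    then show ?thesis using imp_refl assms by (simp add: derives.thm_form)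
  next
    case False
    then have "(\<phi> \<^bold>\<Rightarrow> \<psi> \<^bold>\<Rightarrow> \<phi>) \<in> derives S" "\<phi> \<in> derives S"
      using hyp assms derives.thm_form[OF imp_K] by (auto intro: derives.hyp)
    then show ?thesis by (rule derives.mp)
  qed
next
  case (thm_form \<phi>)
  then have "(\<phi> \<^bold>\<Rightarrow> \<psi> \<^bold>\<Rightarrow> \<phi>) \<in> derives S" "\<phi> \<in> derives S"
    using assms by (auto intro!: imp_K derives.intros(2) dest: thm_forms)
  then show ?case by (rule derives.mp)
next
  case (mp \<phi> \<chi>)
  have "\<phi> \<in> forms n" "\<chi> \<in> forms n" "\<psi> \<in> forms n"
    using derives_forms[OF mp.hyps(1)] assms by auto
  then have "((\<psi> \<^bold>\<Rightarrow> \<phi> \<^bold>\<Rightarrow> \<chi>) \<^bold>\<Rightarrow> (\<psi> \<^bold>\<Rightarrow> \<phi>) \<^bold>\<Rightarrow> \<psi> \<^bold>\<Rightarrow> \<chi>) \<in> derives S"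
    by (intro derives.thm_form imp_S)
  then show ?case
    using mp.IH derives.mp by blast
qed

text \<open>Without a falsum, consistency means that some \<chi> is not derivable. Maximality for a
  single \<chi> already decides every formula.\<close>

definition theories :: "form set set"
  where "theories = {W. W \<subseteq> forms n \<and> (\<exists>\<chi> \<in> forms n. \<chi> \<notin> derives W \<and>
    (\<forall>N. W \<subseteq> N \<longrightarrow> N \<subseteq> forms n \<longrightarrow> \<chi> \<notin> derives N \<longrightarrow> N = W))}"

lemma theory_extend:
  assumes S: "S \<subseteq> forms n" and \<chi>: "\<chi> \<in> forms n" "\<chi> \<notin> derives S"
  obtains W where "W \<in> theories" "S \<subseteq> W" "\<chi> \<notin> W"
proof -
  let ?Q = "\<lambda>X. X \<subseteq> forms n \<and> \<chi> \<notin> derives X"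
  have fin: "?Q X \<longleftrightarrow> (\<forall>Y \<subseteq> X. finite Y \<longrightarrow> ?Q Y)" for X
  proof
    assume L: "?Q X"
    then show "\<forall>Y \<subseteq> X. finite Y \<longrightarrow> ?Q Y"
      using derives_cut[of \<chi> _ X] derives.hyp by blast
  next
    assume R: "\<forall>Y \<subseteq> X. finite Y \<longrightarrow> ?Q Y"
    have "\<phi> \<in> forms n" if "\<phi> \<in> X" for \<phi>
      using R[rule_format, of "{\<phi>}"] that by simp
    moreover have "\<chi> \<notin> derives X"
      using R derives_finite by blast
    ultimately show "?Q X" by blast
  qed
  obtain W where W: "S \<subseteq> W" "?Q W" "\<And>N. \<lbrakk>W \<subseteq> N; ?Q N\<rbrakk> \<Longrightarrow> N = W"
    by (rule finite_character_maximal[of ?Q S, OF _ fin]) (use S \<chi> in auto)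
  then have "W \<in> theories"
    using \<chi>(1) unfolding theories_def by blast
  moreover have "\<chi> \<notin> W"
    using W(2) derives.hyp by blast
  ultimately show thesis
    using that W(1) by blast
qed

lemma theory_forms: "\<lbrakk>W \<in> theories; \<phi> \<in> W\<rbrakk> \<Longrightarrow> \<phi> \<in> forms n"
  by (auto simp: theories_def)

lemma theory_derives:
  assumes W: "W \<in> theories" and \<phi>: "\<phi> \<in> derives W"
  shows "\<phi> \<in> W"
proof -
  obtain \<chi> where \<chi>: "\<chi> \<notin> derives W" and
    max: "\<And>N. \<lbrakk>W \<subseteq> N; N \<subseteq> forms n; \<chi> \<notin> derives N\<rbrakk> \<Longrightarrow> N = W"
    using W unfolding theories_def by blast
  have "insert \<phi> W = W"
  proof (rule max)
    show "insert \<phi> W \<subseteq> forms n"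
      using W derives_forms[OF \<phi>] unfolding theories_def by auto
    show "\<chi> \<notin> derives (insert \<phi> W)"
      using derives_cut[of \<chi> "insert \<phi> W" W] \<chi> \<phi> derives.hyp by blast
  qed blast
  then show ?thesis by blast
qed

lemma theory_thm: "\<lbrakk>W \<in> theories; \<tturnstile> \<phi>\<rbrakk> \<Longrightarrow> \<phi> \<in> W"
  by (blast intro: theory_derives derives.thm_form)

lemma theory_mp: "\<lbrakk>W \<in> theories; (\<phi> \<^bold>\<Rightarrow> \<psi>) \<in> W; \<phi> \<in> W\<rbrakk> \<Longrightarrow> \<psi> \<in> W"
  by (blast intro: theory_derives derives.mp derives.hyp)

lemma theory_Neg:
  assumes W: "W \<in> theories" and \<phi>: "\<phi> \<in> forms n"
  shows "Neg \<phi> \<in> W \<longleftrightarrow> \<phi> \<notin> W"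
proof -
  obtain \<chi> where \<chi>: "\<chi> \<in> forms n" "\<chi> \<notin> derives W" and
    max: "\<And>N. \<lbrakk>W \<subseteq> N; N \<subseteq> forms n; \<chi> \<notin> derives N\<rbrakk> \<Longrightarrow> N = W"
    using W unfolding theories_def by blast
  have Wf: "W \<subseteq> forms n" using W by (simp add: theories_def)
  have \<chi>W: "\<chi> \<notin> W" using \<chi> derives.hyp by blast
  \<comment> \<open>By maximality a missing formula derives \<chi>, which plays the part of
    falsum.\<close>
  have imp: "(\<psi> \<^bold>\<Rightarrow> \<chi>) \<in> W" if "\<psi> \<in> forms n" "\<psi> \<notin> W" for \<psi>
  proof (rule theory_derives[OF W deduction])
    show "\<chi> \<in> derives (insert \<psi> W)"
      using max[of "insert \<psi> W"] that Wf by blast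
  qed (use that Wf in simp)
  \<comment> \<open>Otherwise Clavius' law would put \<chi> into W. By \<open>imp\<close> this
    forces Neg \<chi> into W.\<close>
  have "(Neg \<chi> \<^bold>\<Rightarrow> \<chi>) \<notin> W"
    using theory_mp[OF W theory_thm[OF W luk2[OF \<chi>(1)]]] \<chi>W by blast
  then have n\<chi>: "Neg \<chi> \<in> W"
    using imp[of "Neg \<chi>"] \<chi>(1) by auto
  show ?thesis
  proof
    assume "Neg \<phi> \<in> W"
    then show "\<phi> \<notin> W"
      using theory_mp[OF W theory_mp[OF W theory_thm[OF W luk3]]] \<phi> \<chi> \<chi>W by blast
  next
    assume "\<phi> \<notin> W"
    then have "(\<phi> \<^bold>\<Rightarrow> \<chi>) \<in> W" using imp \<phi> by blast
    \<comment> \<open>Under Neg (Neg \<phi>) one derives \<phi>, hence \<chi>, and \<chi> with Neg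
      \<chi> gives Neg \<phi>. \<open>luk2\<close> removes the assumption.\<close>
    let ?D = "derives (insert (Neg (Neg \<phi>)) W)"
    have sub: "W \<subseteq> ?D" using derives.hyp by blast
    have th: "\<psi> \<in> ?D" if "\<tturnstile> \<psi>" for \<psi> using that by (rule derives.thm_form)
    have "\<phi> \<in> ?D"
      by (rule derives.mp[OF th[OF Neg_NegD[OF \<phi>]]]) (simp add: derives.hyp)
    then have "\<chi> \<in> ?D"
      using derives.mp \<open>(\<phi> \<^bold>\<Rightarrow> \<chi>) \<in> W\<close> sub by blast
    have "Neg \<phi> \<in> ?D"
      by (rule derives.mp[OF derives.mp[OF th[OF luk3[of \<chi>]]]])
        (use \<open>\<chi> \<in> ?D\<close> n\<chi> sub \<phi> \<chi> in auto)
    then have "(Neg (Neg \<phi>) \<^bold>\<Rightarrow> Neg \<phi>) \<in> W"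
      by (intro theory_derives[OF W] deduction) (use \<phi> Wf in auto)
    then show "Neg \<phi> \<in> W"
      by (rule theory_mp[OF W theory_thm[OF W luk2], rotated]) (use \<phi> in simp)
  qed
qed

lemma theory_Imp:
  assumes W: "W \<in> theories" and "\<phi> \<in> forms n" "\<psi> \<in> forms n"
  shows "(\<phi> \<^bold>\<Rightarrow> \<psi>) \<in> W \<longleftrightarrow> (\<phi> \<in> W \<longrightarrow> \<psi> \<in> W)"
proof
  assume *: "\<phi> \<in> W \<longrightarrow> \<psi> \<in> W"
  show "(\<phi> \<^bold>\<Rightarrow> \<psi>) \<in> W"
  proof (cases "\<phi> \<in> W")
    case True
    then show ?thesis
      using * theory_mp[OF W theory_thm[OF W imp_K]] assms by blast
  next
    case False
    then have "Neg \<phi> \<in> W" using theory_Neg[OF W] assms by simp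
    moreover have "(Neg \<phi> \<^bold>\<Rightarrow> \<phi> \<^bold>\<Rightarrow> \<psi>) \<in> W"
      by (rule theory_thm[OF W thm_mp[OF imp_C luk3]]) (use assms in simp_all)
    ultimately show ?thesis
      using theory_mp[OF W] by blast
  qed
qed (use theory_mp[OF W] in blast)

section \<open>Quantifiers and equality in maximal theories\<close>

definition similar :: "var \<Rightarrow> form set \<Rightarrow> form set \<Rightarrow> bool"
  where "similar y W W' \<longleftrightarrow> (\<forall>\<phi> \<in> forms n. y \<notin> free \<phi> \<longrightarrow> (\<phi> \<in> W' \<longleftrightarrow> \<phi> \<in> W))"

lemma similar_refl: "similar y W W"
  by (simp add: similar_def)

text \<open>Hypotheses without y may be quantified vacuously, theorems by \<open>thm_gen\<close>,
  and the distribution axiom handles modus ponens.\<close>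

lemma derives_All:
  assumes "\<phi> \<in> derives {\<psi> \<in> W. y \<notin> free \<psi>}" "W \<in> theories" "y < n"
  shows "All y \<phi> \<in> W"
  using assms(1)
proof induction
  case (hyp \<phi>)
  then have "\<tturnstile> \<phi> \<^bold>\<Rightarrow> All y \<phi>"
    by (intro thm_axiom[OF _ form_axioms.intros(7)]) (use assms theory_forms in auto)
  then show ?case
    using hyp theory_mp theory_thm assms(2) by blast
next
  case (thm_form \<phi>)
  then show ?case using theory_thm thm_gen assms by blast
next
  case (mp \<phi> \<psi>)
  have "(\<phi> \<^bold>\<Rightarrow> \<psi>) \<in> forms n"
    using mp.IH(1) assms(2) theory_forms by fastforce
  then have "\<tturnstile> All y (\<phi> \<^bold>\<Rightarrow> \<psi>) \<^bold>\<Rightarrow> (All y \<phi> \<^bold>\<Rightarrow> All y \<psi>)"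
    by (intro thm_axiom[OF _ form_axioms.intros(5)]) (use assms in auto)
  then show ?case
    using mp.IH theory_mp theory_thm assms(2) by blast
qed

text \<open>With n variables there is no supply of fresh witnesses. Instead y itself is
  reinterpreted in another theory that keeps every formula without free y.\<close>

lemma theory_All:
  assumes W: "W \<in> theories" and \<phi>: "\<phi> \<in> forms n" and y: "y < n"
  shows "All y \<phi> \<in> W \<longleftrightarrow> (\<forall>W' \<in> theories. similar y W W' \<longrightarrow> \<phi> \<in> W')"
proof
  assume "All y \<phi> \<in> W"
  show "\<forall>W' \<in> theories. similar y W W' \<longrightarrow> \<phi> \<in> W'"
  proof (intro ballI impI)
    fix W' assume W': "W' \<in> theories" "similar y W W'"
    then have "All y \<phi> \<in> W'"
      using \<open>All y \<phi> \<in> W\<close> \<phi> y by (simp add: similar_def)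
    moreover have "\<tturnstile> All y \<phi> \<^bold>\<Rightarrow> \<phi>"
      by (rule thm_axiom[OF _ form_axioms.intros(6)]) (use \<phi> y in auto)
    ultimately show "\<phi> \<in> W'"
      using theory_mp theory_thm W'(1) by blast
  qed
next
  assume *: "\<forall>W' \<in> theories. similar y W W' \<longrightarrow> \<phi> \<in> W'"
  let ?S = "{\<psi> \<in> W. y \<notin> free \<psi>}"
  show "All y \<phi> \<in> W"
  proof (rule ccontr)
    assume "All y \<phi> \<notin> W"
    then have not_derived: "\<phi> \<notin> derives ?S"
      using derives_All W y by blast
    have "?S \<subseteq> forms n"
      using theory_forms W by blast
    then obtain W' where W': "W' \<in> theories" "?S \<subseteq> W'" "\<phi> \<notin> W'"
      using \<phi> not_derived by (rule theory_extend)
    have "\<psi> \<in> W' \<longleftrightarrow> \<psi> \<in> W" if "\<psi> \<in> forms n" "y \<notin> free \<psi>" for \<psi>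
    proof (cases "\<psi> \<in> W")
      case False
      then have "Neg \<psi> \<in> ?S" using that theory_Neg[OF W] by simp
      then have "Neg \<psi> \<in> W'" using W'(2) by blast
      then show ?thesis using False that theory_Neg[OF W'(1)] by simp
    qed (use that W'(2) in auto)
    then show False
      using * W' by (simp add: similar_def)
  qed
qed

lemma theory_Ex:
  assumes "W \<in> theories" "\<phi> \<in> forms n" "y < n"
  shows "Ex y \<phi> \<in> W \<longleftrightarrow> (\<exists>W' \<in> theories. similar y W W' \<and> \<phi> \<in> W')"
  using assms by (auto simp: theory_Neg theory_All)

lemma theory_And:
  assumes "W \<in> theories" "\<phi> \<in> forms n" "\<psi> \<in> forms n"
  shows "And \<phi> \<psi> \<in> W \<longleftrightarrow> \<phi> \<in> W \<and> \<psi> \<in> W"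
  using assms by (simp add: theory_Neg theory_Imp)

lemma theory_ExI: "\<lbrakk>W \<in> theories; \<phi> \<in> W; y < n\<rbrakk> \<Longrightarrow> Ex y \<phi> \<in> W"
  using theory_Ex theory_forms similar_refl by blast

lemma thm_iff: "(\<tturnstile> \<phi>) \<longleftrightarrow> \<phi> \<in> forms n \<and> (\<forall>W \<in> theories. \<phi> \<in> W)"
proof
  assume R: "\<phi> \<in> forms n \<and> (\<forall>W \<in> theories. \<phi> \<in> W)"
  have "\<phi> \<in> derives {}"
    using theory_extend[of "{}" \<phi>] R by blast
  then show "\<tturnstile> \<phi>"
    by induction (auto intro: thm_mp)
qed (use theory_thm thm_forms in blast)

lemma thm_closure_iff: "(\<tturnstile> closure \<phi>) \<longleftrightarrow> (\<tturnstile> \<phi>)"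
proof -
  have "\<tturnstile> foldr All xs \<phi>" if "\<tturnstile> \<phi>" "set xs \<subseteq> {..<n}" for xs
    using that by (induction xs) (auto intro: thm_gen)
  moreover have "free \<phi> \<subseteq> {..<n}" if "\<tturnstile> \<phi>"
    using thm_forms[OF that] free_less by blast
  ultimately show ?thesis
    unfolding closure_def using thm_foldr_All_D by fastforce
qed

lemma similar_trans_free:
  assumes "similar y W W'" "\<phi> \<in> forms n" "y \<notin> free \<phi>"
  shows "\<phi> \<in> W' \<longleftrightarrow> \<phi> \<in> W"
  using assms by (simp add: similar_def)

text \<open>The equality axiom swaps x and y everywhere instead of replacing one by the other.
  Applied to the swapped formula it returns the original, which gives the converse
  direction.\<close>

lemma leibniz:
  assumes W: "W \<in> theories" and e: "Rel x Ident y \<in> W" and \<phi>: "\<phi> \<in> forms n"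
  shows "interchange x y \<phi> \<in> W \<longleftrightarrow> \<phi> \<in> W"
proof -
  have xy: "x < n" "y < n" using theory_forms[OF W e] by simp_all
  have "interchange x y \<psi> \<in> W" if "\<psi> \<in> forms n" "\<psi> \<in> W" for \<psi>
  proof -
    have "\<tturnstile> Rel x Ident y \<^bold>\<Rightarrow> \<psi> \<^bold>\<Rightarrow> interchange x y \<psi>"
      by (rule thm_axiom[OF _ form_axioms.intros(9)]) (use that xy interchange_forms in simp_all)
    then show ?thesis
      using theory_mp[OF W theory_mp[OF W theory_thm[OF W]]] e that by blast
  qed
  from this[of \<phi>] this[of "interchange x y \<phi>"] show ?thesis
    using \<phi> xy interchange_forms by auto
qed

lemma exists_equal:
  assumes W: "W \<in> theories" and xy: "x < n" "y < n" "x \<noteq> y"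
  obtains W' where "W' \<in> theories" "similar x W W'" "Rel x Ident y \<in> W'" "Rel y Ident x \<in> W'"
proof -
  have "\<tturnstile> Ex x (Rel x Ident y)"
    by (rule thm_axiom[OF _ form_axioms.intros(8)]) (use xy in simp_all)
  then have "Ex x (Rel x Ident y) \<in> W"
    by (rule theory_thm[OF W])
  then obtain W' where W': "W' \<in> theories" "similar x W W'" "Rel x Ident y \<in> W'"
    using xy by (subst (asm) theory_Ex[OF W]) auto
  moreover have "Rel y Ident x \<in> W'"
    using leibniz[OF W'(1,3), of "Rel x Ident y"] W'(3) xy by simp
  ultimately show thesis by (rule that)
qed

section \<open>Renaming variables\<close>

lemma exists_third: "\<exists>z < n. z \<noteq> x \<and> z \<noteq> y"
proof -
  have "0 < n" "1 < n" "2 < n" using n by simp_all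
  moreover consider "0 \<noteq> x \<and> 0 \<noteq> y" | "1 \<noteq> x \<and> 1 \<noteq> y" | "2 \<noteq> x \<and> 2 \<noteq> y"
    by fastforce
  ultimately show ?thesis by cases blast+
qed

text \<open>Reinterpret x as equal to y and swap. The result no longer has x free, so it holds in
  the original theory as well; by \<open>thm_iff\<close> truth in all theories is
  provability.\<close>

lemma thm_interchange_fresh:
  assumes \<phi>: "\<tturnstile> \<phi>" and xy: "x < n" "y < n" "y \<notin> free \<phi>"
  shows "\<tturnstile> interchange x y \<phi>"
proof (cases "x = y")
  case False
  have \<phi>f: "\<phi> \<in> forms n" using \<phi> thm_forms by blast
  have "interchange x y \<phi> \<in> W" if W: "W \<in> theories" for W
  proof -
    obtain W' where W': "W' \<in> theories" "similar x W W'" "Rel x Ident y \<in> W'"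
      using exists_equal[OF W xy(1,2) False] by blast
    have "interchange x y \<phi> \<in> W'"
      using leibniz[OF W'(1,3) \<phi>f] theory_thm[OF W'(1) \<phi>] by blast
    moreover have "x \<notin> free (interchange x y \<phi>)"
      using xy(3) by (auto simp: free_interchange transpose_def split: if_splits)
    ultimately show ?thesis
      using similar_trans_free[OF W'(2)] interchange_forms[OF \<phi>f xy(1,2)] by blast
  qed
  then show ?thesis
    using thm_iff interchange_forms[OF \<phi>f xy(1,2)] by blast
qed (use \<phi> in simp)

text \<open>Three cyclic moves into the free place swap two variables.\<close>

lemma thm_interchange:
  assumes \<phi>: "\<tturnstile> \<phi>" and xy: "x < n" "y < n" and ab: "free \<phi> \<subseteq> {a, b}"
  shows "\<tturnstile> interchange x y \<phi>"
proof -
  consider "y \<notin> free \<phi>" | "x \<notin> free \<phi>" | "x = y" | "x \<in> free \<phi>" "y \<in> free \<phi>" "x \<noteq> y" by blast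
  then show ?thesis
  proof cases
    case 1
    then show ?thesis using thm_interchange_fresh \<phi> xy by blast
  next
    case 2
    then show ?thesis using thm_interchange_fresh \<phi> xy interchange_commute by metis
  next
    case 3
    then show ?thesis using \<phi> by simp
  next
    case 4
    then have fr: "free \<phi> = {x, y}" using ab by blast
    obtain z where z: "z < n" "z \<noteq> x" "z \<noteq> y" using exists_third by blast
    have 1: "\<tturnstile> interchange x z \<phi>"
      by (rule thm_interchange_fresh) (use \<phi> xy z fr in auto)
    have fr1: "free (interchange x z \<phi>) = {z, y}"
      using z 4 by (auto simp: free_interchange fr transpose_def)
    have 2: "\<tturnstile> interchange y x (interchange x z \<phi>)"
      by (rule thm_interchange_fresh[OF 1]) (use xy z fr1 4 in auto)
    have fr2: "free (interchange y x (interchange x z \<phi>)) = {z, x}"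
      using z 4 unfolding free_interchange[of y x] fr1 by (auto simp: transpose_def)
    have "\<tturnstile> interchange z y (interchange y x (interchange x z \<phi>))"
      by (rule thm_interchange_fresh[OF 2]) (use xy z fr2 4 in auto)
    then show ?thesis
      by (simp only: interchange_via[OF z(2,3)])
  qed
qed

text \<open>The relational axioms are stated for v_0, v_1 and v_2 only; this moves them to any three
  distinct variables. The third argument of f occurs bound or not at all.\<close>

lemma thm_rename:
  assumes f: "\<And>p q u v w. interchange p q (f u v w) = f (transpose p q u) (transpose p q v) (transpose p q w)"
    and free: "\<And>u v w. free (f u v w) \<subseteq> {u, v}"
    and f0: "\<tturnstile> f 0 1 2" and xyz: "x < n" "y < n" "z < n" "x \<noteq> y" "x \<noteq> z" "y \<noteq> z"
  shows "\<tturnstile> f x y z"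
proof -
  have n': "0 < n" "1 < n" "2 < n" using n by simp_all
  \<comment> \<open>After swapping v_0 with x, the other two places are a and b; after swapping a
    with y, the last place is c.\<close>
  define a b where "a = transpose 0 x (1 :: nat)" and "b = transpose 0 x (2 :: nat)"
  have ab: "a < n" "b < n" "x \<noteq> a" "x \<noteq> b" "a \<noteq> b"
    using n' xyz(1) by (auto simp: a_def b_def transpose_def)
  define c where "c = transpose a y b"
  have c: "c < n" "x \<noteq> c" "y \<noteq> c"
    using ab xyz by (auto simp: c_def transpose_def)
  have "\<tturnstile> f x a b"
    using thm_interchange[OF f0 _ xyz(1) free, of 0] n' by (simp add: f a_def b_def)
  then have "\<tturnstile> f x y c"
    using thm_interchange[OF _ ab(1) xyz(2) free, of x a b] ab xyz by (simp add: f c_def)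
  then show ?thesis
    using thm_interchange[OF _ c(1) xyz(3) free, of x y c] c xyz by (simp add: f)
qed

lemma thm_rename2:
  assumes f: "\<And>p q u v. interchange p q (f u v) = f (transpose p q u) (transpose p q v)"
    and free: "\<And>u v. free (f u v) \<subseteq> {u, v}"
    and f0: "\<tturnstile> f 0 1" and xy: "x < n" "y < n" "x \<noteq> y"
  shows "\<tturnstile> f x y"
proof -
  obtain z where z: "z < n" "z \<noteq> x" "z \<noteq> y" using exists_third by blast
  show ?thesis
    by (rule thm_rename[of "\<lambda>u v w. f u v" x y z]) (use assms z in simp_all)
qed

section \<open>Relational operators at distinct variables\<close>

lemma theory_Iff:
  assumes "W \<in> theories" "\<phi> \<in> forms n" "\<psi> \<in> forms n"
  shows "(\<phi> \<^bold>\<Leftrightarrow> \<psi>) \<in> W \<longleftrightarrow> (\<phi> \<in> W \<longleftrightarrow> \<psi> \<in> W)"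
  using assms by (auto simp: theory_Neg theory_Imp)

lemma theory_Sum:
  assumes W: "W \<in> theories" and xy: "x < n" "y < n" "x \<noteq> y"
  shows "Rel x (A \<^bold>+ B) y \<in> W \<longleftrightarrow> Rel x A y \<in> W \<or> Rel x B y \<in> W"
proof -
  have 1: "\<tturnstile> Rel 0 (A \<^bold>+ B) 1 \<^bold>\<Leftrightarrow> Or (Rel 0 A 1) (Rel 0 B 1)"
    by (rule thm_axiom[OF _ form_axioms.intros(10)]) (use n in simp)
  have "\<tturnstile> Rel x (A \<^bold>+ B) y \<^bold>\<Leftrightarrow> Or (Rel x A y) (Rel x B y)"
    by (rule thm_rename2[of "\<lambda>x y. Rel x (A \<^bold>+ B) y \<^bold>\<Leftrightarrow> Or (Rel x A y) (Rel x B y)", OF _ _ 1]) (use xy in auto)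
  then have "(Rel x (A \<^bold>+ B) y \<^bold>\<Leftrightarrow> Or (Rel x A y) (Rel x B y)) \<in> W"
    by (rule theory_thm[OF W])
  then show ?thesis
    using W xy by (subst (asm) theory_Iff) (auto simp: theory_Imp theory_Neg)
qed

lemma theory_Compl:
  assumes W: "W \<in> theories" and xy: "x < n" "y < n" "x \<noteq> y"
  shows "Rel x (Compl A) y \<in> W \<longleftrightarrow> Rel x A y \<notin> W"
proof -
  have 1: "\<tturnstile> Rel 0 (Compl A) 1 \<^bold>\<Leftrightarrow> Neg (Rel 0 A 1)"
    by (rule thm_axiom[OF _ form_axioms.intros(11)]) (use n in simp)
  have "\<tturnstile> Rel x (Compl A) y \<^bold>\<Leftrightarrow> Neg (Rel x A y)"
    by (rule thm_rename2[of "\<lambda>x y. Rel x (Compl A) y \<^bold>\<Leftrightarrow> Neg (Rel x A y)", OF _ _ 1]) (use xy in auto)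
  then have "(Rel x (Compl A) y \<^bold>\<Leftrightarrow> Neg (Rel x A y)) \<in> W"
    by (rule theory_thm[OF W])
  then show ?thesis
    using W xy by (subst (asm) theory_Iff) (auto simp: theory_Neg)
qed

lemma theory_Conv:
  assumes W: "W \<in> theories" and xy: "x < n" "y < n" "x \<noteq> y"
  shows "Rel x (A\<^sup>\<smile>) y \<in> W \<longleftrightarrow> Rel y A x \<in> W"
proof -
  have 1: "\<tturnstile> Rel 0 (A\<^sup>\<smile>) 1 \<^bold>\<Leftrightarrow> Rel 1 A 0"
    by (rule thm_axiom[OF _ form_axioms.intros(13)]) (use n in simp)
  have "\<tturnstile> Rel x (A\<^sup>\<smile>) y \<^bold>\<Leftrightarrow> Rel y A x"
    by (rule thm_rename2[of "\<lambda>x y. Rel x (A\<^sup>\<smile>) y \<^bold>\<Leftrightarrow> Rel y A x", OF _ _ 1]) (use xy in auto)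
  then have "(Rel x (A\<^sup>\<smile>) y \<^bold>\<Leftrightarrow> Rel y A x) \<in> W"
    by (rule theory_thm[OF W])
  then show ?thesis
    using W xy by (subst (asm) theory_Iff) auto
qed

lemma theory_RProd:
  assumes W: "W \<in> theories" and xyz: "x < n" "y < n" "z < n" "x \<noteq> y" "x \<noteq> z" "y \<noteq> z"
  shows "Rel x (A \<^bold>; B) y \<in> W \<longleftrightarrow> Ex z (And (Rel x A z) (Rel z B y)) \<in> W"
proof -
  have 1: "\<tturnstile> Rel 0 (A \<^bold>; B) 1 \<^bold>\<Leftrightarrow> Ex 2 (And (Rel 0 A 2) (Rel 2 B 1))"
    by (rule thm_axiom[OF _ form_axioms.intros(12)]) (use n in simp)
  have "\<tturnstile> Rel x (A \<^bold>; B) y \<^bold>\<Leftrightarrow> Ex z (And (Rel x A z) (Rel z B y))"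
    by (rule thm_rename[of "\<lambda>x y z. Rel x (A \<^bold>; B) y \<^bold>\<Leftrightarrow> Ex z (And (Rel x A z) (Rel z B y))", OF _ _ 1])
      (use xyz in auto)
  then have "(Rel x (A \<^bold>; B) y \<^bold>\<Leftrightarrow> Ex z (And (Rel x A z) (Rel z B y))) \<in> W"
    by (rule theory_thm[OF W])
  then show ?thesis
    using W xyz by (subst (asm) theory_Iff) auto
qed

lemma theory_RProdI:
  assumes "W \<in> theories" "x < n" "y < n" "z < n" "x \<noteq> y" "x \<noteq> z" "y \<noteq> z"
    and "Rel x A z \<in> W" "Rel z B y \<in> W"
  shows "Rel x (A \<^bold>; B) y \<in> W"
  using assms by (subst theory_RProd) (auto intro!: theory_ExI simp: theory_And)

text \<open>The axioms do not relate \<open>Rel x A x\<close> to any \<open>Rel x A y\<close> with \<open>x \<noteq> y\<close>: reading all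
  \<open>Rel x A x\<close> as false satisfies them. Hence \<open>xAx\<close> has to be expressed by a formula with a
  second, bound variable.\<close>

definition diag :: "var \<Rightarrow> pred \<Rightarrow> var \<Rightarrow> form"
  where "diag x A z = Ex z (And (Rel x Ident z) (Rel x A z))"

section \<open>Atoms on the diagonal and second names for points\<close>

lemma diag_forms: "\<lbrakk>x < n; z < n\<rbrakk> \<Longrightarrow> diag x A z \<in> forms n"
  by (simp add: diag_def)

lemma free_diag: "z \<noteq> x \<Longrightarrow> free (diag x A z) = {x}"
  by (auto simp: diag_def)

lemma diagI:
  assumes "W \<in> theories" "Rel x Ident z \<in> W" "Rel x A z \<in> W"
  shows "diag x A z \<in> W"
proof -
  have "x < n" "z < n" using theory_forms[OF assms(1,2)] by simp_all
  then show ?thesis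
    unfolding diag_def using assms by (intro theory_ExI) (simp_all add: theory_And del: forms_simps(3,4))
qed

lemma diagE:
  assumes "diag x A z \<in> W" "W \<in> theories" "x < n" "z < n"
  obtains W' where "W' \<in> theories" "similar z W W'" "Rel x Ident z \<in> W'" "Rel x A z \<in> W'"
  using assms unfolding diag_def by (subst (asm) theory_Ex) (auto simp: theory_And)

lemma Ident_sym: "\<lbrakk>W \<in> theories; Rel x Ident y \<in> W\<rbrakk> \<Longrightarrow> Rel y Ident x \<in> W"
  using leibniz[of W x y "Rel x Ident y"] theory_forms[of W "Rel x Ident y"] by simp

lemma Rel_swap:
  "\<lbrakk>W \<in> theories; Rel x Ident y \<in> W\<rbrakk> \<Longrightarrow> Rel x A y \<in> W \<longleftrightarrow> Rel y A x \<in> W"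
  using leibniz[of W x y "Rel x A y"] theory_forms[of W "Rel x Ident y"] by simp

lemma Rel_subst_right:
  "\<lbrakk>W \<in> theories; Rel x Ident y \<in> W; u < n; u \<noteq> x; u \<noteq> y\<rbrakk> \<Longrightarrow> Rel u A x \<in> W \<longleftrightarrow> Rel u A y \<in> W"
  using leibniz[of W x y "Rel u A x"] theory_forms[of W "Rel x Ident y"] by simp

lemma Rel_subst_left:
  "\<lbrakk>W \<in> theories; Rel x Ident y \<in> W; u < n; u \<noteq> x; u \<noteq> y\<rbrakk> \<Longrightarrow> Rel x A u \<in> W \<longleftrightarrow> Rel y A u \<in> W"
  using leibniz[of W x y "Rel x A u"] theory_forms[of W "Rel x Ident y"] by simp

text \<open>Bound renaming has to be derived. With z and then u made equal to x, xAz becomes xAu;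
  only x is free in the result, so both reinterpretations can be undone.\<close>

lemma diag_change:
  assumes W: "W \<in> theories" and d: "diag x A z \<in> W" and xzu: "x < n" "z < n" "u < n" "z \<noteq> x" "u \<noteq> x" "u \<noteq> z"
  shows "diag x A u \<in> W"
proof -
  obtain W1 where W1: "W1 \<in> theories" "similar z W W1" "Rel x Ident z \<in> W1" "Rel x A z \<in> W1"
    using diagE[OF d W] xzu by metis
  obtain W2 where W2: "W2 \<in> theories" "similar u W1 W2" "Rel u Ident x \<in> W2" "Rel x Ident u \<in> W2"
    using exists_equal[OF W1(1), of u x] xzu by metis
  have xz: "Rel x Ident z \<in> W2" "Rel x A z \<in> W2"
    using similar_trans_free[OF W2(2)] W1(3,4) xzu by simp_all
  then have "Rel u Ident z \<in> W2"
    using Rel_subst_left[OF W2(1,3)] xzu by metis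
  then have "Rel x A u \<in> W2"
    using xz Rel_subst_right[OF W2(1)] xzu by metis
  then have "diag x A u \<in> W2"
    using W2 diagI by blast
  then have "diag x A u \<in> W1"
    using similar_trans_free[OF W2(2)] diag_forms free_diag xzu by simp
  then show ?thesis
    using similar_trans_free[OF W1(2)] diag_forms free_diag xzu by simp
qed

text \<open>The witness of \<open>diag x A z\<close> would reinterpret z and lose the given equality
  of x and z. Rebinding to a third u keeps it, and u is then a common name through which xAz is
  recovered.\<close>

lemma diag_iff_Rel:
  assumes W: "W \<in> theories" and e: "Rel x Ident z \<in> W" and xz: "z \<noteq> x"
  shows "diag x A z \<in> W \<longleftrightarrow> Rel x A z \<in> W"
proof
  assume d: "diag x A z \<in> W"
  have n': "x < n" "z < n" using theory_forms[OF W e] by simp_all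
  obtain u where u: "u < n" "u \<noteq> x" "u \<noteq> z" using exists_third by blast
  have "diag x A u \<in> W"
    using diag_change[OF W d] n' u xz by blast
  then obtain W1 where W1: "W1 \<in> theories" "similar u W W1" "Rel x Ident u \<in> W1" "Rel x A u \<in> W1"
    using diagE[OF _ W] n' u by metis
  have "Rel x Ident z \<in> W1"
    using similar_trans_free[OF W1(2)] e n' u by simp
  then have "Rel u Ident z \<in> W1"
    using Rel_subst_left[OF W1(1,3)] n' u xz by metis
  then have "Rel x A z \<in> W1"
    using Rel_subst_right[OF W1(1)] W1(4) n' u xz by metis
  then show "Rel x A z \<in> W"
    using similar_trans_free[OF W1(2)] n' u by simp
qed (use diagI[OF W e] in blast)

text \<open>The bound variable is v_0 or v_1, whichever differs from x. By
  \<open>diag_change\<close> the choice does not matter.\<close>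

definition holds :: "form set \<Rightarrow> var \<Rightarrow> pred \<Rightarrow> var \<Rightarrow> bool"
  where "holds W x A y \<longleftrightarrow>
    (if x = y then diag x A (if x = 0 then 1 else 0) \<in> W else Rel x A y \<in> W)"

lemma holds_Rel: "x \<noteq> y \<Longrightarrow> holds W x A y \<longleftrightarrow> Rel x A y \<in> W"
  by (simp add: holds_def)

lemma holds_diag:
  assumes W: "W \<in> theories" and e: "Rel x Ident z \<in> W" and xz: "x \<noteq> z"
  shows "holds W x A x \<longleftrightarrow> Rel x A z \<in> W"
proof -
  have n': "x < n" "z < n" "0 < n" "1 < n" using theory_forms[OF W e] n by simp_all
  let ?u = "if x = 0 then 1 else 0 :: nat"
  have "diag x A ?u \<in> W \<longleftrightarrow> diag x A z \<in> W"
    using diag_change[OF W, of x A ?u z] diag_change[OF W, of x A z ?u] n' xz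
    by (cases "?u = z") (auto split: if_splits)
  then show ?thesis
    using diag_iff_Rel[OF W e] xz by (simp add: holds_def)
qed

text \<open>On the diagonal the bound variable may be y itself; \<open>similar\<close> only looks at
  free variables.\<close>

lemma holds_similar:
  assumes "similar y W W'" "u < n" "w < n" "u \<noteq> y" "w \<noteq> y"
  shows "holds W' u A w \<longleftrightarrow> holds W u A w"
proof -
  have "0 < n" "1 < n" using n by simp_all
  then show ?thesis
    using assms similar_trans_free[OF assms(1)] by (auto simp: holds_def diag_forms free_diag)
qed

text \<open>Making z a second name of x turns the diagonal at x into the pair (x, z) of distinct
  variables, which the axioms govern.\<close>

lemma name_point:
  assumes W: "W \<in> theories" and xz: "x < n" "z < n" "z \<noteq> x"
  obtains W' where "W' \<in> theories" "similar z W W'" "Rel x Ident z \<in> W'" "Rel z Ident x \<in> W'"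
    "\<And>A. holds W x A x \<longleftrightarrow> Rel x A z \<in> W'"
proof -
  obtain W' where W': "W' \<in> theories" "similar z W W'" "Rel z Ident x \<in> W'" "Rel x Ident z \<in> W'"
    using exists_equal[OF W xz(2,1,3)] by blast
  have "holds W x A x \<longleftrightarrow> Rel x A z \<in> W'" for A
    using holds_similar[OF W'(2) xz(1,1)] holds_diag[OF W'(1,4)] xz by simp
  then show thesis
    using that W' by blast
qed

text \<open>The product axiom speaks of three distinct variables. If the middle point coincides with
  an end, a second name u of that end takes its place.\<close>

lemma holds_prodI_off:
  assumes W: "W \<in> theories" and xyz: "x < n" "y < n" "z < n" "x \<noteq> z"
    and A: "holds W x A y" and B: "holds W y B z"
  shows "Rel x (A \<^bold>; B) z \<in> W"
proof -
  obtain u where u: "u < n" "u \<noteq> x" "u \<noteq> z" using exists_third by blast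
  consider "y = x" | "y = z" | "y \<noteq> x" "y \<noteq> z" by blast
  then show ?thesis
  proof cases
    case 1
    obtain W' where W': "W' \<in> theories" "similar u W W'" "Rel x Ident u \<in> W'"
      "\<And>A. holds W x A x \<longleftrightarrow> Rel x A u \<in> W'"
      using name_point[OF W xyz(1) u(1,2)] by blast
    have "Rel x B z \<in> W'"
      using B 1 xyz u similar_trans_free[OF W'(2)] by (simp add: holds_Rel)
    then have "Rel u B z \<in> W'"
      using Rel_subst_left[OF W'(1,3)] xyz u by metis
    moreover have "Rel x A u \<in> W'"
      using A 1 W'(4) by simp
    ultimately have "Rel x (A \<^bold>; B) z \<in> W'"
      by (intro theory_RProdI[OF W'(1)]) (use xyz u in auto)
    then show ?thesis
      using similar_trans_free[OF W'(2)] xyz u by simp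
  next
    case 2
    obtain W' where W': "W' \<in> theories" "similar u W W'" "Rel z Ident u \<in> W'"
      "\<And>A. holds W z A z \<longleftrightarrow> Rel z A u \<in> W'"
      using name_point[OF W xyz(3) u(1,3)] by blast
    have "Rel x A z \<in> W'"
      using A 2 xyz u similar_trans_free[OF W'(2)] by (simp add: holds_Rel)
    then have "Rel x A u \<in> W'"
      using Rel_subst_right[OF W'(1,3)] xyz u by metis
    moreover have "Rel u B z \<in> W'"
      using B 2 W'(4) Rel_swap[OF W'(1,3)] by simp
    ultimately have "Rel x (A \<^bold>; B) z \<in> W'"
      by (intro theory_RProdI[OF W'(1)]) (use xyz u in auto)
    then show ?thesis
      using similar_trans_free[OF W'(2)] xyz u by simp
  next
    case 3
    then show ?thesis
      using A B xyz by (intro theory_RProdI[OF W]) (auto simp: holds_Rel)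
  qed
qed

lemma holds_prodI:
  assumes W: "W \<in> theories" and xyz: "x < n" "y < n" "z < n"
    and A: "holds W x A y" and B: "holds W y B z"
  shows "holds W x (A \<^bold>; B) z"
proof (cases "x = z")
  case True
  obtain u where u: "u < n" "u \<noteq> x" "u \<noteq> y" using exists_third by blast
  \<comment> \<open>A second name u for the right end x reduces the loop to the case of distinct
    ends.\<close>
  obtain W' where W': "W' \<in> theories" "similar u W W'" "Rel x Ident u \<in> W'"
    "\<And>A. holds W x A x \<longleftrightarrow> Rel x A u \<in> W'"
    using name_point[OF W xyz(1) u(1,2)] by blast
  have "holds W' x A y"
    using A holds_similar[OF W'(2)] xyz u by simp
  moreover have "holds W' y B u"
  proof (cases "y = x")
    case True
    then show ?thesis
      using B \<open>x = z\<close> W'(4) u by (simp add: holds_Rel)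
  next
    case False
    then have "Rel y B x \<in> W'"
      using B \<open>x = z\<close> holds_similar[OF W'(2)] xyz u holds_Rel by metis
    then show ?thesis
      using False Rel_subst_right[OF W'(1,3)] xyz u holds_Rel by metis
  qed
  ultimately have "Rel x (A \<^bold>; B) u \<in> W'"
    by (intro holds_prodI_off[OF W'(1)]) (use xyz u in auto)
  then show ?thesis
    using W'(4) True by simp
next
  case False
  then show ?thesis
    using holds_prodI_off[OF W xyz _ A B] by (simp add: holds_Rel)
qed

lemma holds_prod_witness:
  assumes W: "W \<in> theories" and xyz: "x < n" "y < n" "z < n" "y \<noteq> x" "y \<noteq> z"
    and AB: "holds W x (A \<^bold>; B) z"
  shows "\<exists>W' \<in> theories. similar y W W' \<and> Rel x A y \<in> W' \<and> Rel y B z \<in> W'"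
proof -
  have "Ex y (And (Rel x A y) (Rel y B z)) \<in> W"
  proof (cases "x = z")
    case False
    then show ?thesis
      using AB theory_RProd[OF W] xyz by (simp add: holds_Rel)
  next
    case True
    obtain u where u: "u < n" "u \<noteq> x" "u \<noteq> y" using exists_third by blast
    \<comment> \<open>The right end of the loop is called u, so that the product axiom applies to x,
      u and y. Choosing y keeps u equal to x, and u is replaced by x afterwards.\<close>
    obtain W1 where W1: "W1 \<in> theories" "similar u W W1" "Rel u Ident x \<in> W1"
      "\<And>A. holds W x A x \<longleftrightarrow> Rel x A u \<in> W1"
      using name_point[OF W xyz(1) u(1,2)] by blast
    have "Ex y (And (Rel x A y) (Rel y B u)) \<in> W1"
      using AB True W1(4) theory_RProd[OF W1(1)] xyz u by metis
    then obtain W2 where W2: "W2 \<in> theories" "similar y W1 W2" "Rel x A y \<in> W2" "Rel y B u \<in> W2"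
      using xyz u W1(1) by (subst (asm) theory_Ex) (auto simp: theory_And)
    have "Rel u Ident x \<in> W2"
      using similar_trans_free[OF W2(2)] W1(3) xyz u by simp
    then have "Rel y B x \<in> W2"
      using Rel_subst_right[OF W2(1)] W2(4) xyz u by metis
    then have "And (Rel x A y) (Rel y B x) \<in> W2"
      using theory_And[OF W2(1)] W2(3) xyz by simp
    then have "Ex y (And (Rel x A y) (Rel y B x)) \<in> W2"
      using theory_ExI W2(1) xyz by blast
    then have "Ex y (And (Rel x A y) (Rel y B x)) \<in> W1"
      using similar_trans_free[OF W2(2)] xyz by simp
    then show ?thesis
      using similar_trans_free[OF W1(2)] xyz u True by simp
  qed
  then show ?thesis
    using xyz W by (subst (asm) theory_Ex) (auto simp: theory_And)
qed

section \<open>The canonical frame of the predicate calculus\<close>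

definition world :: "form set \<Rightarrow> atom set"
  where "world W = {(x, A, y). x < n \<and> y < n \<and> holds W x A y}"

lemma world_iff: "\<lbrakk>x < n; y < n\<rbrakk> \<Longrightarrow> (x, A, y) \<in> world W \<longleftrightarrow> holds W x A y"
  by (simp add: world_def)

sublocale frame n "world ` theories"
proof
  fix M x y A B assume M: "M \<in> world ` theories" and xy: "x < n" "y < n"
  then obtain W where W: "W \<in> theories" "M = world W" by blast
  \<comment> \<open>z serves as a second name of x when x = y, so that the operator laws for
    distinct variables cover the diagonal.\<close>
  obtain z where z: "z < n" "z \<noteq> x" using exists_third by blast
  obtain W' where W': "W' \<in> theories" "similar z W W'" "Rel x Ident z \<in> W'"
    "\<And>A. holds W x A x \<longleftrightarrow> Rel x A z \<in> W'"
    using name_point[OF W(1) xy(1) z] by blast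
  show "(x, A \<^bold>+ B, y) \<in> M \<longleftrightarrow> (x, A, y) \<in> M \<or> (x, B, y) \<in> M"
    using theory_Sum[OF W(1) xy] theory_Sum[OF W'(1) xy(1) z(1)] z(2) W'(4)
    by (cases "x = y") (auto simp: W world_iff xy holds_Rel)
  show "(x, Compl A, y) \<in> M \<longleftrightarrow> (x, A, y) \<notin> M"
    using theory_Compl[OF W(1) xy] theory_Compl[OF W'(1) xy(1) z(1)] z(2) W'(4)
    by (cases "x = y") (auto simp: W world_iff xy holds_Rel)
  show "(x, A\<^sup>\<smile>, y) \<in> M \<longleftrightarrow> (y, A, x) \<in> M"
    using theory_Conv[OF W(1) xy] theory_Conv[OF W'(1) xy(1) z(1)] z(2) W'(4) Rel_swap[OF W'(1,3)]
    by (cases "x = y") (auto simp: W world_iff xy holds_Rel)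
  show "(x, Ident, x) \<in> M"
    using W'(3,4) by (simp add: W world_iff xy)
next
  fix M x y z A
  assume M: "M \<in> world ` theories" and xyz: "x < n" "y < n" "z < n"
    and A: "(x, A, z) \<in> M" and e: "(z, Ident, y) \<in> M"
  then obtain W where W: "W \<in> theories" "M = world W" by blast
  have h: "holds W x A z" "holds W z Ident y"
    using A e by (simp_all add: W world_iff xyz)
  show "(x, A, y) \<in> M"
  proof (cases "z = y")
    case False
    then have e': "Rel z Ident y \<in> W" using h by (simp add: holds_Rel)
    \<comment> \<open>If x equals z or y, one of the two atoms lies on the diagonal, and
      \<open>holds_diag\<close> reads it at the pair formed by z and y.\<close>
    then have "holds W x A y"
      using h(1) False holds_diag[OF W(1) e'] holds_diag[OF W(1) Ident_sym[OF W(1) e']]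
        Rel_swap[OF W(1) e'] Rel_subst_right[OF W(1) e' xyz(1)]
      by (cases "x = z"; cases "x = y") (auto simp: holds_Rel)
    then show ?thesis by (simp add: W world_iff xyz)
  qed (use A in simp)
next
  fix M x y z A B
  assume "M \<in> world ` theories" "x < n" "y < n" "z < n" "(x, A, y) \<in> M" "(y, B, z) \<in> M"
  then show "(x, A \<^bold>; B, z) \<in> M"
    using holds_prodI by (auto simp: world_iff)
next
  fix M x y z A B
  assume M: "M \<in> world ` theories" and xyz: "x < n" "y < n" "z < n" "y \<noteq> x" "y \<noteq> z"
    and AB: "(x, A \<^bold>; B, z) \<in> M"
  then obtain W where W: "W \<in> theories" "M = world W" by blast
  obtain W' where W': "W' \<in> theories" "similar y W W'" "Rel x A y \<in> W'" "Rel y B z \<in> W'"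
    using holds_prod_witness[OF W(1) xyz] AB xyz by (auto simp: W world_iff)
  have "agree y M (world W')"
    unfolding agree_def using holds_similar[OF W'(2)] by (auto simp: W world_def)
  moreover have "(x, A, y) \<in> world W'" "(y, B, z) \<in> world W'"
    using W' xyz by (simp_all add: world_iff holds_Rel)
  ultimately show "\<exists>M' \<in> world ` theories. agree y M M' \<and> (x, A, y) \<in> M' \<and> (y, B, z) \<in> M'"
    using W'(1) by blast
qed

text \<open>The axiom for equations speaks of v_0 and v_1. Renaming reaches all pairs of distinct
  variables, and a second name reaches the diagonal.\<close>

lemma sentence_Equation:
  "Equation (A \<doteq> B) \<in> sentences \<longleftrightarrow> (\<forall>W \<in> theories. \<forall>x < n. \<forall>y < n. holds W x A y \<longleftrightarrow> holds W x B y)"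
proof -
  have n': "0 < n" "1 < n" using n by simp_all
  let ?f = "\<lambda>x y. Rel x A y \<^bold>\<Leftrightarrow> Rel x B y"
  have f01: "?f 0 1 \<in> forms n" using n' by simp
  have "Equation (A \<doteq> B) \<in> sentences \<longleftrightarrow> (\<tturnstile> Equation (A \<doteq> B))"
    using thm_closure[of "Equation (A \<doteq> B)"] thm_sentence[of "Equation (A \<doteq> B)"] by auto
  also have "\<dots> \<longleftrightarrow> (\<tturnstile> closure (?f 0 1))"
  proof -
    have "\<tturnstile> Equation (A \<doteq> B) \<^bold>\<Leftrightarrow> closure (?f 0 1)"
      by (rule thm_axiom[OF _ _]) (use f01 in simp, subst closure_closed, simp, rule form_axioms.intros(14))
    then have *: "(Equation (A \<doteq> B) \<^bold>\<Leftrightarrow> closure (?f 0 1)) \<in> W" if "W \<in> theories" for W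
      using theory_thm that by blast
    have "Equation (A \<doteq> B) \<in> W \<longleftrightarrow> closure (?f 0 1) \<in> W" if W: "W \<in> theories" for W
      using *[OF W] f01 by (subst (asm) theory_Iff[OF W]) simp_all
    then show ?thesis
      unfolding thm_iff using f01 by (simp only: closure_forms forms_simps(2)) blast
  qed
  also have "\<dots> \<longleftrightarrow> (\<tturnstile> ?f 0 1)"
    by (rule thm_closure_iff)
  also have "\<dots> \<longleftrightarrow> (\<forall>W \<in> theories. \<forall>x < n. \<forall>y < n. holds W x A y \<longleftrightarrow> holds W x B y)"
  proof
    assume f: "\<tturnstile> ?f 0 1"
    have off: "Rel x A y \<in> W \<longleftrightarrow> Rel x B y \<in> W" if "W \<in> theories" "x < n" "y < n" "x \<noteq> y" for W x y
    proof -
      have "\<tturnstile> ?f x y"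
        by (rule thm_rename2[of ?f, OF _ _ f]) (use that in auto)
      then have "?f x y \<in> W"
        by (rule theory_thm[OF that(1)])
      then show ?thesis
        using that by (subst (asm) theory_Iff) simp_all
    qed
    show "\<forall>W \<in> theories. \<forall>x < n. \<forall>y < n. holds W x A y \<longleftrightarrow> holds W x B y"
    proof (intro ballI allI impI)
      fix W x y assume W: "W \<in> theories" and xy: "x < n" "y < n"
      obtain z where z: "z < n" "z \<noteq> x" using exists_third by blast
      obtain W' where W': "W' \<in> theories" "\<And>A. holds W x A x \<longleftrightarrow> Rel x A z \<in> W'"
        using name_point[OF W xy(1) z] by metis
      show "holds W x A y \<longleftrightarrow> holds W x B y"
        using off[OF W xy] off[OF W'(1) xy(1) z(1)] z W'(2) by (cases "x = y") (auto simp: holds_Rel)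
    qed
  next
    assume R: "\<forall>W \<in> theories. \<forall>x < n. \<forall>y < n. holds W x A y \<longleftrightarrow> holds W x B y"
    have "?f 0 1 \<in> W" if W: "W \<in> theories" for W
      using R[rule_format, OF W n'] n' by (subst theory_Iff[OF W]) (simp_all add: holds_Rel)
    then show "\<tturnstile> ?f 0 1"
      unfolding thm_iff using f01 by blast
  qed
  finally show ?thesis .
qed

lemma models_hyp: "models \<Psi>"
proof -
  have "below A B \<and> below B A" if "(A \<doteq> B) \<in> \<Psi>" for A B
    using sentence_Equation[THEN iffD1, OF form_provable.hyp[OF that]]
    by (auto simp: below_def world_iff)
  then show ?thesis
    by (simp add: models_def)
qed

text \<open>The inequality also concerns pairs of distinct but equal variables; there xAy follows
  from xAx by substitution, and \<open>valid_diag\<close> supplies xAx.\<close>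

lemma Ident_le_sentence_iff: "Equation (Ident \<lesssim> A) \<in> sentences \<longleftrightarrow> valid A"
proof -
  have n': "0 < n" "1 < n" using n by simp_all
  have sum: "holds W x (Ident \<^bold>+ A) y \<longleftrightarrow> holds W x Ident y \<or> holds W x A y"
    if "W \<in> theories" "x < n" "y < n" for W x y
    using sum_iff[OF imageI] that by (simp add: world_iff)
  have "Equation (Ident \<lesssim> A) \<in> sentences \<longleftrightarrow>
      (\<forall>W \<in> theories. \<forall>x < n. \<forall>y < n. holds W x Ident y \<longrightarrow> holds W x A y)"
    unfolding sentence_Equation using sum by blast
  also have "\<dots> \<longleftrightarrow> below Ident A"
    by (simp add: below_def world_iff)
  also have "\<dots> \<longleftrightarrow> valid A"
  proof
    assume "below Ident A"
    then show "valid A"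
      unfolding valid_def using belowD[OF _ ident_refl[OF _ n'(1)] _ n'(1,1)] by blast
  next
    assume A: "valid A"
    show "below Ident A"
      unfolding below_def
      by (intro ballI allI impI) (rule ident_subst[OF _ _ _ _ valid_diag[OF A]])
  qed
  finally show ?thesis .
qed

end

section \<open>From frames to both calculi\<close>

lemma provable_from_ballI:
  assumes "0 < n" "\<And>F. \<lbrakk>frame n F; frame.models n F \<Psi>\<rbrakk> \<Longrightarrow> \<forall>P \<in> S. frame.valid F P"
  shows "\<forall>P \<in> S. provable_from n \<Psi> P"
  by (intro ballI provable_fromI) (simp_all add: assms)

lemma rule_provable_ballI:
  assumes "0 < n"
    "\<And>F. frame n F \<Longrightarrow> \<forall>(Ps, Q) \<in> R. (\<forall>P \<in> Ps. frame.valid F P) \<longrightarrow> frame.valid F Q"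
  shows "\<forall>(Ps, Q) \<in> R. rule_provable n Ps Q"
proof clarify
  fix Ps Q assume "(Ps, Q) \<in> R"
  then show "rule_provable n Ps Q"
    using assms(2) by (intro rule_provableI[OF assms(1)]) auto
qed

text \<open>A single frame characterizes each logic exactly, so closure under the rules can be read
  off it just as membership can.\<close>

lemma exists_logic_frame:
  assumes "3 \<le> n"
  obtains F where "frame n F" "frame.models n F \<Psi>"
    "\<And>A. Equation (Ident \<lesssim> A) \<in> form_provable n \<Psi> \<longleftrightarrow> frame.valid F A"
proof -
  interpret form_theory n \<Psi> using assms by unfold_locales
  show thesis
    using that[OF frame_axioms models_hyp] Ident_le_sentence_iff by blast
qed

lemma frame_closed_under_rules:
  assumes F: "frame n F" "3 \<le> n" and L: "\<And>A. A \<in> L \<longleftrightarrow> frame.valid F A"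
  shows "\<forall>(Ps, Q) \<in> rules1 A B \<union> rules2 A B C \<union> rules3 A B C D. Ps \<subseteq> L \<longrightarrow> Q \<in> L"
proof clarify
  interpret frame n F by (rule F)
  fix Ps Q assume "(Ps, Q) \<in> rules1 A B \<union> rules2 A B C \<union> rules3 A B C D" "Ps \<subseteq> L"
  then show "Q \<in> L"
    using rules1_valid[of A B] rules2_valid[of A B C] rules3_valid[of A B C D] F(2)
    by (auto simp: L subset_iff)
qed

theorem theorem22:
  fixes A B C D :: pred
  shows
  "let
     preds1 = {
        \<^bold>t,
        A \<^bold>\<or> \<^bold>\<not> A,
        A \<^bold>\<or> \<^bold>\<sim> A};
     preds2 = {
        A \<^bold>\<rightarrow> A,
        ((A \<^bold>\<rightarrow> A) \<^bold>\<rightarrow> B) \<^bold>\<rightarrow> B,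
        A \<^bold>\<or> A \<^bold>\<rightarrow> A,
        A \<^bold>\<rightarrow> A \<^bold>\<or> B,
        B \<^bold>\<rightarrow> A \<^bold>\<or> B,
        A \<^bold>\<or> B \<^bold>\<rightarrow> B \<^bold>\<or> A,
        A \<^bold>\<rightarrow> A \<^bold>\<and> A,
        A \<^bold>\<and> B \<^bold>\<rightarrow> A,
        A \<^bold>\<and> B \<^bold>\<rightarrow> B,
        A \<^bold>\<and> B \<^bold>\<rightarrow> B \<^bold>\<and> A,
        (A \<^bold>\<or> B) \<^bold>\<or> C \<^bold>\<rightarrow> A \<^bold>\<or> (B \<^bold>\<or> C),
        (A \<^bold>\<and> B) \<^bold>\<and> C \<^bold>\<rightarrow> A \<^bold>\<and> (B \<^bold>\<and> C),
        (A \<^bold>\<or> B) \<^bold>\<and> C \<^bold>\<rightarrow> (A \<^bold>\<and> C) \<^bold>\<or> (B \<^bold>\<and> C),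
        (A \<^bold>\<and> B) \<^bold>\<or> C \<^bold>\<rightarrow> (A \<^bold>\<or> C) \<^bold>\<and> (B \<^bold>\<or> C),
        \<^bold>\<sim> \<^bold>\<sim> A \<^bold>\<rightarrow> A,
        A \<^bold>\<rightarrow> \<^bold>\<sim> \<^bold>\<sim> A,
        \<^bold>\<sim> (A \<^bold>\<or> B) \<^bold>\<rightarrow> \<^bold>\<sim> A \<^bold>\<and> \<^bold>\<sim> B,
        \<^bold>\<sim> (A \<^bold>\<and> B) \<^bold>\<rightarrow> \<^bold>\<sim> A \<^bold>\<or> \<^bold>\<sim> B,
        \<^bold>\<sim> A \<^bold>\<and> \<^bold>\<sim> B \<^bold>\<rightarrow> \<^bold>\<sim> (A \<^bold>\<or> B),
        \<^bold>\<sim> A \<^bold>\<or> \<^bold>\<sim> B \<^bold>\<rightarrow> \<^bold>\<sim> (A \<^bold>\<and> B),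
        \<^bold>\<not> \<^bold>\<not> A \<^bold>\<rightarrow> A,
        A \<^bold>\<rightarrow> \<^bold>\<not> \<^bold>\<not> A,
        \<^bold>\<not> (A \<^bold>\<or> B) \<^bold>\<rightarrow> \<^bold>\<not> A \<^bold>\<and> \<^bold>\<not> B,
        \<^bold>\<not> (A \<^bold>\<and> B) \<^bold>\<rightarrow> \<^bold>\<not> A \<^bold>\<or> \<^bold>\<not> B,
        \<^bold>\<not> A \<^bold>\<and> \<^bold>\<not> B \<^bold>\<rightarrow> \<^bold>\<not> (A \<^bold>\<or> B),
        \<^bold>\<not> A \<^bold>\<or> \<^bold>\<not> B \<^bold>\<rightarrow> \<^bold>\<not> (A \<^bold>\<and> B),
        A \<^bold>\<rightarrow> B \<^bold>\<or> \<^bold>\<not> B,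
        \<^bold>\<not> A \<^bold>\<and> A \<^bold>\<rightarrow> B};
     preds3 = {
        (A \<^bold>\<rightarrow> B) \<^bold>\<and> (A \<^bold>\<rightarrow> C) \<^bold>\<rightarrow> (A \<^bold>\<rightarrow> B \<^bold>\<and> C),
        (A \<^bold>\<rightarrow> C) \<^bold>\<and> (B \<^bold>\<rightarrow> C) \<^bold>\<rightarrow> (A \<^bold>\<or> B \<^bold>\<rightarrow> C),
        (A \<^bold>\<rightarrow> B) \<^bold>\<and> (C \<^bold>\<rightarrow> D) \<^bold>\<rightarrow> (A \<^bold>\<and> C \<^bold>\<rightarrow> B \<^bold>\<and> D),
        (A \<^bold>\<rightarrow> B) \<^bold>\<and> (C \<^bold>\<rightarrow> D) \<^bold>\<rightarrow> (A \<^bold>\<or> C \<^bold>\<rightarrow> B \<^bold>\<or> D),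
        (A \<^bold>\<rightarrow> B) \<^bold>\<or> (C \<^bold>\<rightarrow> D) \<^bold>\<rightarrow> (A \<^bold>\<and> C \<^bold>\<rightarrow> B \<^bold>\<or> D),
        A \<^bold>\<circ> B \<^bold>\<rightarrow> \<^bold>\<sim> (A \<^bold>\<rightarrow> \<^bold>\<sim> B),
        \<^bold>\<sim> (A \<^bold>\<rightarrow> \<^bold>\<sim> B) \<^bold>\<rightarrow> A \<^bold>\<circ> B,
        (A \<^bold>\<rightarrow> B) \<^bold>\<circ> A \<^bold>\<rightarrow> B,
        A \<^bold>\<rightarrow> (B \<^bold>\<rightarrow> A \<^bold>\<circ> B),
        A \<^bold>\<rightarrow> ((B \<^bold>\<rightarrow> \<^bold>\<sim> A) \<^bold>\<rightarrow> \<^bold>\<sim> B),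
        A \<^bold>\<circ> B \<^bold>\<and> C \<^bold>\<rightarrow> A \<^bold>\<circ> (B \<^bold>\<and> \<^bold>\<sim> D) \<^bold>\<or> (A \<^bold>\<and> C \<^bold>\<circ> D) \<^bold>\<circ> B,
        A \<^bold>\<circ> B \<^bold>\<and> C \<^bold>\<rightarrow> (A \<^bold>\<and> \<^bold>\<sim> D) \<^bold>\<circ> B \<^bold>\<or> A \<^bold>\<circ> (B \<^bold>\<and> D \<^bold>\<circ> C),
        A \<^bold>\<circ> B \<^bold>\<and> C \<^bold>\<rightarrow> (A \<^bold>\<and> C \<^bold>\<circ> B\<^sup>\<star>) \<^bold>\<circ> (B \<^bold>\<and> A\<^sup>\<star> \<^bold>\<circ> C),
        \<^bold>t \<^bold>\<circ> A \<^bold>\<rightarrow> A,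
        A \<^bold>\<circ> \<^bold>t \<^bold>\<rightarrow> A,
        A \<^bold>\<rightarrow> A \<^bold>\<circ> \<^bold>t\<^sup>\<star>,
        \<^bold>t \<^bold>\<rightarrow> \<^bold>t\<^sup>\<star>,
        \<^bold>t\<^sup>\<star> \<^bold>\<rightarrow> \<^bold>t,
        \<^bold>t \<^bold>\<and> \<^bold>\<sim> \<^bold>t \<^bold>\<rightarrow> A};
     rules1 = {
        ({A, B}, A \<^bold>\<and> B),
        ({A \<^bold>\<rightarrow> B, A}, B),
        ({A \<^bold>\<or> B, \<^bold>\<sim> A}, B),
        ({A}, A\<^sup>\<star>)};
     rules2 = {
        ({A \<^bold>\<rightarrow> B, B \<^bold>\<rightarrow> C}, A \<^bold>\<rightarrow> C),
        ({A \<^bold>\<rightarrow> B}, \<^bold>\<sim> B \<^bold>\<rightarrow> \<^bold>\<sim> A),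
        ({A \<^bold>\<rightarrow> \<^bold>\<sim> B}, B \<^bold>\<rightarrow> \<^bold>\<sim> A),
        ({A \<^bold>\<and> B \<^bold>\<rightarrow> C, B \<^bold>\<rightarrow> C \<^bold>\<or> A}, B \<^bold>\<rightarrow> C),
        ({A}, (A \<^bold>\<rightarrow> B) \<^bold>\<rightarrow> B),
        ({A \<^bold>\<and> B \<^bold>\<rightarrow> \<^bold>\<not> C}, A \<^bold>\<and> C \<^bold>\<rightarrow> \<^bold>\<not> B),
        ({B \<^bold>\<and> \<^bold>\<not> C \<^bold>\<rightarrow> A \<^bold>\<and> \<^bold>\<not> A}, B \<^bold>\<rightarrow> C),
        ({B \<^bold>\<and> C\<^sup>\<star> \<^bold>\<rightarrow> A \<^bold>\<and> \<^bold>\<not> A}, B \<^bold>\<rightarrow> \<^bold>\<sim> C)};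
     rules3 = {
        ({A \<^bold>\<rightarrow> B}, (B \<^bold>\<rightarrow> C) \<^bold>\<rightarrow> (A \<^bold>\<rightarrow> C)),
        ({A \<^bold>\<rightarrow> B}, (C \<^bold>\<rightarrow> A) \<^bold>\<rightarrow> (C \<^bold>\<rightarrow> B)),
        ({A \<^bold>\<rightarrow> B, C \<^bold>\<rightarrow> D}, (B \<^bold>\<rightarrow> C) \<^bold>\<rightarrow> (A \<^bold>\<rightarrow> D)),
        ({A \<^bold>\<rightarrow> B, C \<^bold>\<rightarrow> D}, A \<^bold>\<circ> C \<^bold>\<rightarrow> B \<^bold>\<circ> D),
        ({A \<^bold>\<rightarrow> (B \<^bold>\<rightarrow> C)}, B \<^bold>\<rightarrow> (\<^bold>\<sim> C \<^bold>\<rightarrow> \<^bold>\<sim> A))};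
     preds4 = {
        (A \<^bold>\<rightarrow> B) \<^bold>\<rightarrow> ((C \<^bold>\<rightarrow> A) \<^bold>\<rightarrow> (C \<^bold>\<rightarrow> B)),
        (A \<^bold>\<rightarrow> (B \<^bold>\<rightarrow> C)) \<^bold>\<rightarrow> (A \<^bold>\<circ> B \<^bold>\<rightarrow> C),
        (A \<^bold>\<circ> B \<^bold>\<rightarrow> C) \<^bold>\<rightarrow> (A \<^bold>\<rightarrow> (B \<^bold>\<rightarrow> C)),
        (A \<^bold>\<rightarrow> B) \<^bold>\<rightarrow> (A \<^bold>\<circ> C \<^bold>\<rightarrow> B \<^bold>\<circ> C),
        (A \<^bold>\<circ> B) \<^bold>\<circ> C \<^bold>\<rightarrow> A \<^bold>\<circ> (B \<^bold>\<circ> C),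
        A \<^bold>\<circ> (B \<^bold>\<circ> C) \<^bold>\<rightarrow> (A \<^bold>\<circ> B) \<^bold>\<circ> C};
     dens3 = {
        (A \<^bold>\<rightarrow> \<^bold>\<sim> A) \<^bold>\<rightarrow> \<^bold>\<sim> A,
        A \<^bold>\<and> B \<^bold>\<rightarrow> A \<^bold>\<circ> B,
        (A \<^bold>\<rightarrow> B) \<^bold>\<rightarrow> \<^bold>\<sim> A \<^bold>\<or> B};
     dens4 = {
        (A \<^bold>\<rightarrow> (A \<^bold>\<rightarrow> B)) \<^bold>\<rightarrow> (A \<^bold>\<rightarrow> B),
        (A \<^bold>\<rightarrow> (B \<^bold>\<rightarrow> C)) \<^bold>\<rightarrow> (A \<^bold>\<and> B \<^bold>\<rightarrow> C)};
     comm3 = {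
        A \<^bold>\<rightarrow> ((A \<^bold>\<rightarrow> B) \<^bold>\<rightarrow> B),
        (A \<^bold>\<rightarrow> \<^bold>\<sim> B) \<^bold>\<rightarrow> (B \<^bold>\<rightarrow> \<^bold>\<sim> A)};
     comm4 = {
        (A \<^bold>\<rightarrow> (B \<^bold>\<rightarrow> C)) \<^bold>\<rightarrow> (B \<^bold>\<rightarrow> (A \<^bold>\<rightarrow> C)),
        (A \<^bold>\<rightarrow> B) \<^bold>\<rightarrow> ((B \<^bold>\<rightarrow> C) \<^bold>\<rightarrow> (A \<^bold>\<rightarrow> C))};
     denscomm4 = {
        (A \<^bold>\<rightarrow> (B \<^bold>\<rightarrow> C)) \<^bold>\<rightarrow> ((A \<^bold>\<rightarrow> B) \<^bold>\<rightarrow> (A \<^bold>\<rightarrow> C))};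
     sym2 = {
        A \<^bold>\<and> \<^bold>\<sim> A \<^bold>\<rightarrow> B};
     sym3 = {
        A \<^bold>\<circ> B \<^bold>\<rightarrow> B \<^bold>\<circ> A}
   in
     (\<forall>P \<in> preds1. provable 1 P) \<and>
     (\<forall>P \<in> preds2. provable 2 P) \<and>
     (\<forall>P \<in> preds3. provable 3 P) \<and>
     (\<forall>(Ps, Q) \<in> rules1. rule_provable 1 Ps Q) \<and>
     (\<forall>(Ps, Q) \<in> rules2. rule_provable 2 Ps Q) \<and>
     (\<forall>(Ps, Q) \<in> rules3. rule_provable 3 Ps Q) \<and>
     (\<forall>P \<in> preds4. provable 4 P) \<and>
     (\<forall>P \<in> dens3. provable_from 3 density P) \<and>
     (\<forall>P \<in> dens4. provable_from 4 density P) \<and>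
     (\<forall>P \<in> comm3. provable_from 3 commutativity P) \<and>
     (\<forall>P \<in> comm4. provable_from 4 commutativity P) \<and>
     (\<forall>P \<in> denscomm4. provable_from 4 (density \<union> commutativity) P) \<and>
     (\<forall>P \<in> sym2. provable_from 2 symmetry P) \<and>
     (\<forall>P \<in> sym3. provable_from 3 symmetry P) \<and>
     preds1 \<union> preds2 \<union> preds3 \<subseteq> CT3 \<and>
     preds1 \<union> preds2 \<union> preds3 \<union> preds4 \<subseteq> CT4 \<and>
     preds1 \<union> preds2 \<union> preds3 \<union> preds4 \<union> comm3 \<union> comm4 \<union> denscomm4 \<subseteq> TR \<and>
     (\<forall>L \<in> {CT3, CT4, TR}. \<forall>(Ps, Q) \<in> rules1 \<union> rules2 \<union> rules3.
        Ps \<subseteq> L \<longrightarrow> Q \<in> L)"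
proof -
  let ?dc = "(A \<^bold>\<rightarrow> (B \<^bold>\<rightarrow> C)) \<^bold>\<rightarrow> ((A \<^bold>\<rightarrow> B) \<^bold>\<rightarrow> (A \<^bold>\<rightarrow> C))"
  note preds = frame.valid_preds1 frame.valid_preds2 frame.valid_preds3 frame.valid_preds4
  note dens = frame.models_density and comm = frame.models_commutativity and sym = frame.models_symmetry
  have seq:
    "\<forall>P \<in> preds1 A. provable 1 P" "\<forall>P \<in> preds2 A B C. provable 2 P"
    "\<forall>P \<in> preds3 A B C D. provable 3 P" "\<forall>P \<in> preds4 A B C. provable 4 P"
    by (rule provable_from_ballI; simp add: preds)+
  have seq_rules:
    "\<forall>(Ps, Q) \<in> rules1 A B. rule_provable 1 Ps Q" "\<forall>(Ps, Q) \<in> rules2 A B C. rule_provable 2 Ps Q"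
    "\<forall>(Ps, Q) \<in> rules3 A B C D. rule_provable 3 Ps Q"
    by (rule rule_provable_ballI; simp add: frame.rules1_valid frame.rules2_valid frame.rules3_valid)+
  have seq_dens3: "\<forall>P \<in> dens3 A B. provable_from 3 density P"
    by (rule provable_from_ballI, simp, rule frame.valid_dens3, assumption, simp) (erule (1) dens, simp)
  have seq_dens4: "\<forall>P \<in> dens4 A B C. provable_from 4 density P"
    by (rule provable_from_ballI, simp, rule frame.valid_dens4, assumption, simp) (erule (1) dens, simp)
  have seq_comm3: "\<forall>P \<in> comm3 A B. provable_from 3 commutativity P"
    by (rule provable_from_ballI, simp, rule frame.valid_comm3, assumption, simp) (erule (1) comm, simp)
  have seq_comm4: "\<forall>P \<in> comm4 A B C. provable_from 4 commutativity P"
    by (rule provable_from_ballI, simp, rule frame.valid_comm4, assumption, simp) (erule (1) comm, simp)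
  have seq_denscomm: "\<forall>P \<in> {?dc}. provable_from 4 (density \<union> commutativity) P"
    unfolding ball_simps
    by (intro conjI TrueI provable_fromI, simp, rule frame.valid_denscomm4, assumption, simp)
      (erule (1) dens, simp, erule (1) comm, simp)
  have seq_sym2: "\<forall>P \<in> {A \<^bold>\<and> \<^bold>\<sim> A \<^bold>\<rightarrow> B}. provable_from 2 symmetry P"
    unfolding ball_simps
    by (intro conjI TrueI provable_fromI, simp, rule frame.valid_sym2, assumption, simp) (erule (1) sym)
  have seq_sym3: "\<forall>P \<in> {A \<^bold>\<circ> B \<^bold>\<rightarrow> B \<^bold>\<circ> A}. provable_from 3 symmetry P"
    unfolding ball_simps
    by (intro conjI TrueI provable_fromI, simp, rule frame.valid_sym3, assumption, simp) (erule (1) sym)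
  obtain F3 where F3: "frame 3 F3" "\<And>A. A \<in> CT3 \<longleftrightarrow> frame.valid F3 A"
    by (rule exists_logic_frame[of 3 "{}"]) (auto simp: CT3_def)
  obtain F4 where F4: "frame 4 F4" "\<And>A. A \<in> CT4 \<longleftrightarrow> frame.valid F4 A"
    by (rule exists_logic_frame[of 4 "{}"]) (auto simp: CT4_def)
  obtain FT where FT: "frame 4 FT" "frame.models 4 FT (density \<union> commutativity)"
    "\<And>A. A \<in> TR \<longleftrightarrow> frame.valid FT A"
    by (rule exists_logic_frame[of 4 "density \<union> commutativity"]) (auto simp: TR_def)
  have CT3: "preds1 A \<union> preds2 A B C \<union> preds3 A B C D \<subseteq> CT3"
    by (auto simp: F3(2) preds(1-3)[OF F3(1), THEN bspec])
  have CT4: "preds1 A \<union> preds2 A B C \<union> preds3 A B C D \<union> preds4 A B C \<subseteq> CT4"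
    by (auto simp: F4(2) preds[OF F4(1), THEN bspec])
  have TR: "preds1 A \<union> preds2 A B C \<union> preds3 A B C D \<union> preds4 A B C \<union> comm3 A B \<union> comm4 A B C \<union> {?dc} \<subseteq> TR"
    by (auto simp: FT(3) preds[OF FT(1), THEN bspec] frame.valid_comm3[OF FT(1), THEN bspec]
        frame.valid_comm4[OF FT(1), THEN bspec] frame.valid_denscomm4[OF FT(1)] dens[OF FT(1,2)] comm[OF FT(1,2)])
  have rules: "\<forall>L \<in> {CT3, CT4, TR}. \<forall>(Ps, Q) \<in> rules1 A B \<union> rules2 A B C \<union> rules3 A B C D.
      Ps \<subseteq> L \<longrightarrow> Q \<in> L"
    unfolding ball_simps
    by (intro conjI TrueI frame_closed_under_rules[OF F3(1) _ F3(2)]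
        frame_closed_under_rules[OF F4(1) _ F4(2)] frame_closed_under_rules[OF FT(1) _ FT(3)]) simp_all
  show ?thesis
    using seq seq_rules seq_dens3 seq_dens4 seq_comm3 seq_comm4 seq_denscomm seq_sym2 seq_sym3
      CT3 CT4 TR rules
    unfolding preds1_def preds2_def preds3_def preds4_def rules1_def rules2_def rules3_def
      dens3_def dens4_def comm3_def comm4_def Let_def
    by (intro conjI)
qed


end
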